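(* For every $m\ge1$ and every $d\ge1$ there are admissible configurations $\Lambda$ in $\mathbb{R}^{4m}$ for which $$N_{\mathbb H}(\Lambda)\cong\mathbb{S}^{4d+3}\times(\mathbb{S}^3)^{4m-1}$$ (diffeomorphism).
   Context: $\mathbb{H}$ denotes the quaternions and $\operatorname{Sp}(1)$ the unit quaternions. A configuration $\Lambda=(\lambda_1,\ldots,\lambda_n)\subset\mathbb{R}^{4m}$ is admissible if $0\in\operatorname{conv}\{\lambda_1,\ldots,\lambda_n\}$ and, for every $I\subset\{1,\ldots,n\}$, $0\in\operatorname{conv}\{\lambda_i:i\in I\}$ implies $|I|>4m$; throughout, configurations are also assumed to have affine span $\mathbb{R}^{4m}$. Define $$Z_{\mathbb H}(\Lambda)=\Big\{q\in\mathbb{H}^n:\ \sum_i\lambda_i|q_i|^2=0,\ \sum_i|q_i|^2=1\Big\},$$ a compact smooth manifold on which $\operatorname{Sp}(1)$ acts freely by diagonal left multiplication $a\cdot(q_1,\ldots,q_n)=(aq_1,\ldots,aq_n)$, and $N_{\mathbb H}(\Lambda)=Z_{\mathbb H}(\Lambda)/\operatorname{Sp}(1)$. *)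

theory Defs
  imports "HOL-Analysis.Analysis"
begin

section \<open>Smooth maps between open subsets of coordinate spaces\<close>

text \<open>
  The dimensions of the manifolds below depend on bound variables, so R^k is the library's
  \<^const>\<open>Euclidean_space\<close>: functions from the naturals to the reals vanishing from index k on.
\<close>

definition has_partial :: "nat \<Rightarrow> ((nat \<Rightarrow> real) \<Rightarrow> real) \<Rightarrow> (nat \<Rightarrow> real) \<Rightarrow> bool"
  where "has_partial i f x \<longleftrightarrow> (\<lambda>t. f (x(i := t))) field_differentiable (at (x i))"

definition partial :: "nat \<Rightarrow> ((nat \<Rightarrow> real) \<Rightarrow> real) \<Rightarrow> (nat \<Rightarrow> real) \<Rightarrow> real"
  where "partial i f x = deriv (\<lambda>t. f (x(i := t))) (x i)"

text \<open>
  For U open in R^k, \<open>Ck_on r k U f\<close> says that all iterated partial derivatives of f of order at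
  most r exist and are continuous on U.
\<close>

primrec Ck_on :: "nat \<Rightarrow> nat \<Rightarrow> (nat \<Rightarrow> real) set \<Rightarrow> ((nat \<Rightarrow> real) \<Rightarrow> real) \<Rightarrow> bool"
  where
    "Ck_on 0 k U f \<longleftrightarrow> continuous_map (subtopology (Euclidean_space k) U) euclideanreal f"
  | "Ck_on (Suc r) k U f \<longleftrightarrow>
       continuous_map (subtopology (Euclidean_space k) U) euclideanreal f \<and>
       (\<forall>i<k. (\<forall>x\<in>U. has_partial i f x) \<and> Ck_on r k U (partial i f))"

definition smooth_on ::
    "nat \<Rightarrow> nat \<Rightarrow> (nat \<Rightarrow> real) set \<Rightarrow> ((nat \<Rightarrow> real) \<Rightarrow> (nat \<Rightarrow> real)) \<Rightarrow> bool"
  where "smooth_on k l U F \<longleftrightarrow> (\<forall>j<l. \<forall>r. Ck_on r k U (\<lambda>x. F x j))"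

definition jacobian_surjective ::
    "nat \<Rightarrow> nat \<Rightarrow> ((nat \<Rightarrow> real) \<Rightarrow> (nat \<Rightarrow> real)) \<Rightarrow> (nat \<Rightarrow> real) \<Rightarrow> bool"
  where "jacobian_surjective k l F x \<longleftrightarrow>
    (\<forall>w :: nat \<Rightarrow> real. \<exists>v :: nat \<Rightarrow> real.
       \<forall>i<l. (\<Sum>j<k. partial j (\<lambda>y. F y i) x * v j) = w i)"


section \<open>Smooth manifolds\<close>

type_synonym 'a chart = "'a set \<times> ('a \<Rightarrow> nat \<Rightarrow> real)"

record 'a smfd =
  mtop :: "'a topology"
  mdim :: nat
  atlas :: "'a chart set"

definition is_chart :: "'a topology \<Rightarrow> nat \<Rightarrow> 'a chart \<Rightarrow> bool"
  where "is_chart X k = (\<lambda>(U, \<phi>).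
    openin X U \<and> openin (Euclidean_space k) (\<phi> ` U) \<and>
    homeomorphic_map (subtopology X U) (subtopology (Euclidean_space k) (\<phi> ` U)) \<phi>)"

definition smooth_manifold :: "'a smfd \<Rightarrow> bool"
  where "smooth_manifold M \<longleftrightarrow>
    Hausdorff_space (mtop M) \<and> second_countable (mtop M) \<and>
    (\<forall>C\<in>atlas M. is_chart (mtop M) (mdim M) C) \<and>
    (\<Union>C\<in>atlas M. fst C) = topspace (mtop M) \<and>
    (\<forall>(U, \<phi>)\<in>atlas M. \<forall>(V, \<psi>)\<in>atlas M.
       smooth_on (mdim M) (mdim M) (\<phi> ` (U \<inter> V)) (\<psi> \<circ> inv_into U \<phi>))"

text \<open>
  Atlases need not be maximal. Since the charts of an atlas are pairwise compatible, the notions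
  below do not depend on the choice of an atlas of the smooth structure.
\<close>

definition smooth_map :: "'a smfd \<Rightarrow> 'b smfd \<Rightarrow> ('a \<Rightarrow> 'b) \<Rightarrow> bool"
  where "smooth_map M N f \<longleftrightarrow>
    continuous_map (mtop M) (mtop N) f \<and>
    (\<forall>(U, \<phi>)\<in>atlas M. \<forall>(V, \<psi>)\<in>atlas N.
       smooth_on (mdim M) (mdim N) (\<phi> ` {x \<in> U. f x \<in> V}) (\<psi> \<circ> f \<circ> inv_into U \<phi>))"

definition diffeomorphism :: "'a smfd \<Rightarrow> 'b smfd \<Rightarrow> ('a \<Rightarrow> 'b) \<Rightarrow> bool"
  where "diffeomorphism M N f \<longleftrightarrow>
    bij_betw f (topspace (mtop M)) (topspace (mtop N)) \<and>
    smooth_map M N f \<and> smooth_map N M (inv_into (topspace (mtop M)) f)"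

definition diffeomorphic :: "'a smfd \<Rightarrow> 'b smfd \<Rightarrow> bool"
  where "diffeomorphic M N \<longleftrightarrow>
    smooth_manifold M \<and> smooth_manifold N \<and> (\<exists>f. diffeomorphism M N f)"

definition submersion :: "'a smfd \<Rightarrow> 'b smfd \<Rightarrow> ('a \<Rightarrow> 'b) \<Rightarrow> bool"
  where "submersion M N f \<longleftrightarrow>
    smooth_map M N f \<and>
    (\<forall>(U, \<phi>)\<in>atlas M. \<forall>(V, \<psi>)\<in>atlas N. \<forall>x\<in>U. f x \<in> V \<longrightarrow>
       jacobian_surjective (mdim M) (mdim N) (\<psi> \<circ> f \<circ> inv_into U \<phi>) (\<phi> x))"

text \<open>
  Q is the quotient manifold of M along p: it carries the quotient topology and a smooth structure
  for which p is a smooth submersion. Such a smooth structure is unique if it exists.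
\<close>

definition quotient_manifold :: "'a smfd \<Rightarrow> ('a \<Rightarrow> 'b) \<Rightarrow> 'b smfd \<Rightarrow> bool"
  where "quotient_manifold M p Q \<longleftrightarrow>
    smooth_manifold M \<and> smooth_manifold Q \<and>
    quotient_map (mtop M) (mtop Q) p \<and> submersion M Q p"

text \<open>
  The k-dimensional embedded submanifold structure that X inherits from a topological embedding c
  into R^N: its charts are the local homeomorphisms to R^k that extend locally to smooth maps on
  open subsets of R^N and whose inverses are smooth as maps to R^N.
\<close>

definition embedded_mfd :: "nat \<Rightarrow> ('a \<Rightarrow> nat \<Rightarrow> real) \<Rightarrow> nat \<Rightarrow> 'a topology \<Rightarrow> 'a smfd"
  where "embedded_mfd N c k X =
    \<lparr> mtop = X, mdim = k,
      atlas = {(U, \<phi>). is_chart X k (U, \<phi>) \<and>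
        smooth_on k N (\<phi> ` U) (c \<circ> inv_into U \<phi>) \<and>
        (\<forall>p\<in>U. \<exists>W \<Phi>. openin (Euclidean_space N) W \<and> c p \<in> W \<and> smooth_on N k W \<Phi> \<and>
           (\<forall>q\<in>U. c q \<in> W \<longrightarrow> \<Phi> (c q) = \<phi> q))} \<rparr>"

definition sphere_mfd :: "nat \<Rightarrow> (nat \<Rightarrow> real) smfd"
  where "sphere_mfd n = embedded_mfd (Suc n) id n (nsphere n)"

definition prod_mfd :: "'a smfd \<Rightarrow> 'b smfd \<Rightarrow> ('a \<times> 'b) smfd"
  where "prod_mfd M N =
    \<lparr> mtop = prod_topology (mtop M) (mtop N), mdim = mdim M + mdim N,
      atlas = {(U \<times> V, \<lambda>(x, y) j. if j < mdim M then \<phi> x j else \<psi> y (j - mdim M))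
               | U \<phi> V \<psi>. (U, \<phi>) \<in> atlas M \<and> (V, \<psi>) \<in> atlas N} \<rparr>"

text \<open>
  The r-fold product of M with itself. In a product chart the coordinate with index j belongs to
  the factor with index \<open>j div mdim M\<close>.
\<close>

definition power_mfd :: "nat \<Rightarrow> 'a smfd \<Rightarrow> (nat \<Rightarrow> 'a) smfd"
  where "power_mfd r M =
    \<lparr> mtop = product_topology (\<lambda>_. mtop M) {..<r}, mdim = r * mdim M,
      atlas = {(PiE {..<r} U,
                \<lambda>x j. if j < r * mdim M
                      then \<phi> (j div mdim M) (x (j div mdim M)) (j mod mdim M) else 0)
               | U \<phi>. \<forall>i<r. (U i, \<phi> i) \<in> atlas M} \<rparr>"


section \<open>Quaternions\<close>

text \<open>
  The quadruple (a, b, c, d) stands for a + b i + c j + d k. The library's norm and topology on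
  the iterated product type are the Euclidean ones.
\<close>

type_synonym quat = "real \<times> real \<times> real \<times> real"

fun qmult :: "quat \<Rightarrow> quat \<Rightarrow> quat"  (infixl \<open>\<star>\<close> 70)
  where "(a, b, c, d) \<star> (a', b', c', d') =
    (a * a' - b * b' - c * c' - d * d',
     a * b' + b * a' + c * d' - d * c',
     a * c' - b * d' + c * a' + d * b',
     a * d' + b * c' - c * b' + d * a')"

lemma qmult_assoc: "(p \<star> q) \<star> r = p \<star> (q \<star> r)"
  by (cases p; cases q; cases r) (simp add: algebra_simps)

lemma norm_quat: "norm ((a, b, c, d) :: quat) = sqrt (a\<^sup>2 + b\<^sup>2 + c\<^sup>2 + d\<^sup>2)"
  by (simp add: norm_Pair add.assoc)

lemma norm_qmult: "norm (p \<star> q) = norm p * norm q"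
  by (cases p; cases q)
     (simp add: norm_quat real_sqrt_mult [symmetric], simp add: power2_eq_square algebra_simps)

fun qcomp :: "quat \<Rightarrow> nat \<Rightarrow> real"
  where "qcomp (a, b, c, d) j = [a, b, c, d] ! j"

text \<open>H^n is the set of sequences vanishing from index n on; \<open>qcoord\<close> identifies it with R^(4n).\<close>

definition Hn :: "nat \<Rightarrow> (nat \<Rightarrow> quat) set"
  where "Hn n = {q. \<forall>i\<ge>n. q i = 0}"

definition qcoord :: "(nat \<Rightarrow> quat) \<Rightarrow> nat \<Rightarrow> real"
  where "qcoord q j = qcomp (q (j div 4)) (j mod 4)"

definition Sp1 :: "quat set"
  where "Sp1 = {a. norm a = 1}"

definition Sp1_orbit :: "(nat \<Rightarrow> quat) \<Rightarrow> (nat \<Rightarrow> quat) set"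
  where "Sp1_orbit q = {(\<lambda>i. a \<star> q i) | a. a \<in> Sp1}"


section \<open>Configurations and their quaternionic manifolds\<close>

text \<open>
  A configuration is a list, so repetitions are allowed and the cardinality condition counts
  indices. The affine span condition is a standing assumption on configurations.
\<close>

definition admissible :: "(real ^ 'k) list \<Rightarrow> bool"
  where "admissible \<Lambda> \<longleftrightarrow>
    affine hull (set \<Lambda>) = UNIV \<and>
    0 \<in> convex hull (set \<Lambda>) \<and>
    (\<forall>I \<subseteq> {..<length \<Lambda>}. 0 \<in> convex hull ((\<lambda>i. \<Lambda> ! i) ` I) \<longrightarrow> card I > CARD('k))"

definition ZH :: "(real ^ 'k) list \<Rightarrow> (nat \<Rightarrow> quat) set"
  where "ZH \<Lambda> = {q \<in> Hn (length \<Lambda>).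
    (\<Sum>i<length \<Lambda>. (norm (q i))\<^sup>2 *\<^sub>R (\<Lambda> ! i)) = 0 \<and> (\<Sum>i<length \<Lambda>. (norm (q i))\<^sup>2) = 1}"

text \<open>Z is cut out of R^(4n) by CARD('k) + 1 independent equations, whence its dimension.\<close>

definition ZH_mfd :: "(real ^ 'k) list \<Rightarrow> (nat \<Rightarrow> quat) smfd"
  where "ZH_mfd \<Lambda> =
    embedded_mfd (4 * length \<Lambda>) qcoord (4 * length \<Lambda> - (CARD('k) + 1)) (top_of_set (ZH \<Lambda>))"

definition is_NH :: "(real ^ 'k) list \<Rightarrow> (nat \<Rightarrow> quat) set smfd \<Rightarrow> bool"
  where "is_NH \<Lambda> N \<longleftrightarrow> quotient_manifold (ZH_mfd \<Lambda>) Sp1_orbit N"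

end

theory Submission
  imports Defs
begin

text \<open>
  Write k = 4m. Take d + 1 copies of the vector -(1, ..., 1) together with the standard basis of
  R^k. The equations of Z then say that the first d + 1 quaternionic coordinates have total squared
  norm 1/(k + 1) and that each of the last k coordinates has squared norm 1/(k + 1). So Z is, up to
  scale, the product of the unit sphere in H^(d+1) and of k copies of Sp(1). Dividing all
  coordinates by the last one identifies the quotient with the product of the remaining factors.

  Smoothness is checked in ambient coordinates: all manifolds involved are embedded in a
  Euclidean space compatibly with their charts, and the maps between them extend to polynomial maps of the
  ambient spaces.
\<close>

section \<open>Calculus with iterated partial derivatives\<close>

text \<open>The last coordinate is what trivialises the action. Multiplying a point by the conjugate
  of its (rescaled, hence unit) last coordinate selects one point in each orbit, so the principal
  Sp(1)-bundle has global sections, and no slice theorem is needed. On unit quaternions conjugation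
  is inversion; this is why every map is polynomial. The factors count as follows: the d + 1 equal
  vectors yield a sphere of dimension 4(d + 1) - 1 = 4d + 3, the 4m basis vectors yield 4m
  three-spheres, and the quotient consumes one of these.

  The main obstacle is to produce charts. Those of Z do not come from an implicit function theorem:
  stereographic charts of the spheres are pulled back along the rescaling. The orbit space carries
  no structure at first; it receives one from the bijection with the remaining factors, and the
  sections then show that this structure is the quotient structure. Since smoothness means existence
  and continuity of iterated partial derivatives, the chain rule has to be derived in that
  language.\<close>

abbreviation Euc :: "nat \<Rightarrow> (nat \<Rightarrow> real) set"
  where "Euc k \<equiv> topspace (Euclidean_space k)"

lemma Euc_iff: "x \<in> Euc k \<longleftrightarrow> (\<forall>i\<ge>k. x i = 0)"
  by (simp add: topspace_Euclidean_space)

text \<open>Opens the way to \<open>continuous_on\<close> and filters in place of abstract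
  topologies.\<close>

lemma Euclidean_space_eq: "Euclidean_space k = top_of_set (Euc k)"
  by (simp add: Euclidean_space_def euclidean_product_topology)

lemma continuous_map_Euc:
  "continuous_map (subtopology (Euclidean_space k) U) euclidean f \<longleftrightarrow> continuous_on (Euc k \<inter> U) f"
  by (subst Euclidean_space_eq) (simp add: subtopology_subtopology)

text \<open>Inside R^k all coordinates from k on vanish, so only k radii of a product neighbourhood
  matter and their minimum is positive. Cubes suit partial derivatives, which move one coordinate at
  a time.\<close>

lemma openin_Euclidean_box:
  assumes "openin (Euclidean_space k) U" and "x \<in> U"
  obtains \<delta> where "\<delta> > 0" and "\<And>y. y \<in> Euc k \<Longrightarrow> (\<And>i. i < k \<Longrightarrow> \<bar>y i - x i\<bar> < \<delta>) \<Longrightarrow> y \<in> U"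
proof -
  obtain V where V: "openin (powertop_real UNIV) V" "U = V \<inter> Euc k"
    using assms(1) by (auto simp: Euclidean_space_def openin_subtopology)
  obtain B where B: "\<And>i. open (B i)" "x \<in> PiE UNIV B" "PiE UNIV B \<subseteq> V"
    using V assms(2) by (force simp: openin_product_topology_alt)
  have "\<exists>\<delta>>0. \<forall>t. \<bar>t - x i\<bar> < \<delta> \<longrightarrow> t \<in> B i" for i
    using B(1)[of i] B(2) unfolding open_dist by (auto simp: dist_real_def)
  then obtain \<delta> where \<delta>: "\<And>i. \<delta> i > 0" "\<And>i t. \<bar>t - x i\<bar> < \<delta> i \<Longrightarrow> t \<in> B i"
    by metis
  \<comment> \<open>The element 1 keeps the minimum defined for k = 0.\<close>
  define \<epsilon> where "\<epsilon> = Min (insert 1 (\<delta> ` {..<k}))"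
  have "\<epsilon> > 0"
    using \<delta>(1) by (auto simp: \<epsilon>_def)
  moreover have "y \<in> U" if y: "y \<in> Euc k" "\<And>i. i < k \<Longrightarrow> \<bar>y i - x i\<bar> < \<epsilon>" for y
  proof -
    have "y i \<in> B i" for i
    proof (cases "i < k")
      case True
      then have "\<epsilon> \<le> \<delta> i"
        by (auto simp: \<epsilon>_def intro!: Min_le)
      then show ?thesis
        using y(2)[OF True] \<delta>(2) by fastforce
    next
      case False
      then have "y i = x i"
        using y(1) assms(2) V(2) by (auto simp: Euc_iff)
      then show ?thesis
        using B(2) by auto
    qed
    then have "y \<in> PiE UNIV B"
      by auto
    then show ?thesis
      using B(3) V(2) y(1) by blast
  qed
  ultimately show ?thesis
    using that by blast
qed

lemma eventually_fun_upd_in_open: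
  assumes "openin (Euclidean_space k) U" and "x \<in> U" and "i < k"
  shows "\<forall>\<^sub>F t in nhds (x i). x(i := t) \<in> U"
proof -
  obtain \<delta> where \<delta>: "\<delta> > 0" "\<And>y. y \<in> Euc k \<Longrightarrow> (\<And>i. i < k \<Longrightarrow> \<bar>y i - x i\<bar> < \<delta>) \<Longrightarrow> y \<in> U"
    using openin_Euclidean_box assms(1,2) by metis
  have "x \<in> Euc k"
    using assms(1,2) openin_subset by blast
  then have "x(i := t) \<in> Euc k" for t
    using assms(3) by (auto simp: Euc_iff)
  then have "x(i := t) \<in> U" if "dist t (x i) < \<delta>" for t
    using that \<delta> by (auto simp: dist_real_def)
  then show ?thesis
    using \<delta>(1) eventually_nhds_metric by blast
qed

lemma has_partialD:
  "has_partial i f x \<Longrightarrow> ((\<lambda>t. f (x(i := t))) has_real_derivative partial i f x) (at (x i))"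
  by (simp add: has_partial_def partial_def DERIV_deriv_iff_field_differentiable)

lemma has_partialI:
  assumes "((\<lambda>t. f (x(i := t))) has_real_derivative D) (at (x i))"
  shows "has_partial i f x" and "partial i f x = D"
  using assms by (auto simp: has_partial_def partial_def field_differentiable_def DERIV_imp_deriv)

text \<open>A partial derivative at x sees f only on a short segment through x, and this stays in
  the open set U.\<close>

lemma partial_cong:
  assumes "openin (Euclidean_space k) U" and "x \<in> U" and "i < k" and "\<And>y. y \<in> U \<Longrightarrow> f y = g y"
  shows "has_partial i f x \<longleftrightarrow> has_partial i g x" and "partial i f x = partial i g x"
proof -
  have ev: "\<forall>\<^sub>F t in nhds (x i). f (x(i := t)) = g (x(i := t))"
    by (rule eventually_mono[OF eventually_fun_upd_in_open[OF assms(1-3)]]) (rule assms(4))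
  show "partial i f x = partial i g x"
    unfolding partial_def by (rule deriv_cong_ev[OF ev refl])
  show "has_partial i f x \<longleftrightarrow> has_partial i g x"
    unfolding has_partial_def field_differentiable_def
    using DERIV_cong_ev[OF refl ev refl] by blast
qed

lemma Ck_on_continuous:
  "Ck_on r k U f \<Longrightarrow> U \<subseteq> Euc k \<Longrightarrow> continuous_on U f"
  by (cases r) (auto simp: continuous_map_Euc Int_absorb1)

lemma Ck_on_0: "U \<subseteq> Euc k \<Longrightarrow> Ck_on 0 k U f \<longleftrightarrow> continuous_on U f"
  by (simp add: continuous_map_Euc Int_absorb1)

lemma Ck_on_Suc_imp: "Ck_on (Suc r) k U f \<Longrightarrow> Ck_on r k U f"
  by (induction r arbitrary: f) auto

text \<open>\<open>Ck_on\<close> takes functions on the whole type, whereas charts and their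
  inverses are meaningful only on U. Openness of U makes the partial derivatives agree on U too, so
  the induction passes to them.\<close>

lemma Ck_on_cong:
  assumes "openin (Euclidean_space k) U" and "\<And>y. y \<in> U \<Longrightarrow> f y = g y" and "Ck_on r k U f"
  shows "Ck_on r k U g"
  using assms(2,3)
proof (induction r arbitrary: f g)
  case 0
  then show ?case
    using Ck_on_0[OF openin_subset[OF assms(1)]] continuous_on_cong[of U U f g] by simp
next
  case (Suc r)
  have U: "U \<subseteq> Euc k"
    by (rule openin_subset[OF assms(1)])
  have "continuous_on U g"
    using Ck_on_continuous[OF Suc.prems(2) U] continuous_on_cong[of U U f g] Suc.prems(1) by simp
  moreover have "has_partial i g x" if "i < k" "x \<in> U" for i x
    using partial_cong(1)[of k U x i f g] assms(1) Suc.prems that by simp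
  moreover have "Ck_on r k U (partial i g)" if "i < k" for i
  proof (rule Suc.IH[of "partial i f"])
    show "partial i f y = partial i g y" if "y \<in> U" for y
      using partial_cong(2)[of k U y i f g] assms(1) Suc.prems(1) \<open>i < k\<close> that by simp
    show "Ck_on r k U (partial i f)"
      using Suc.prems(2) that by simp
  qed
  ultimately show ?case
    using U by (simp add: continuous_map_Euc Int_absorb1)
qed

text \<open>The working form for the closure rules: D is an explicit formula for the partial
  derivatives, so \<open>partial\<close> itself never has to be computed.\<close>

lemma Ck_on_SucI:
  assumes "openin (Euclidean_space k) U" and "continuous_on U f"
    and "\<And>i x. i < k \<Longrightarrow> x \<in> U \<Longrightarrow> ((\<lambda>t. f (x(i := t))) has_real_derivative D i x) (at (x i))"
    and "\<And>i. i < k \<Longrightarrow> Ck_on r k U (D i)"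
  shows "Ck_on (Suc r) k U f"
proof -
  have "Ck_on r k U (partial i f)" if "i < k" for i
  proof (rule Ck_on_cong[OF assms(1) _ assms(4)[OF that]])
    show "D i y = partial i f y" if "y \<in> U" for y
      using has_partialI(2)[OF assms(3)[OF \<open>i < k\<close> that]] by simp
  qed
  moreover have "has_partial i f x" if "i < k" "x \<in> U" for i x
    by (rule has_partialI(1)[OF assms(3)[OF that]])
  ultimately show ?thesis
    using assms(2) openin_subset[OF assms(1)] by (simp add: continuous_map_Euc Int_absorb1)
qed

lemma Ck_on_SucD:
  assumes "Ck_on (Suc r) k U f" and "i < k"
  shows "Ck_on r k U (partial i f)"
    and "x \<in> U \<Longrightarrow> ((\<lambda>t. f (x(i := t))) has_real_derivative partial i f x) (at (x i))"
  using assms has_partialD by auto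

lemma Ck_on_subset: "Ck_on r k U f \<Longrightarrow> V \<subseteq> U \<Longrightarrow> Ck_on r k V f"
  by (induction r arbitrary: f) (auto intro: continuous_map_from_subtopology_mono)

lemma continuous_on_local_Euc:
  assumes "U \<subseteq> Euc k"
    and "\<And>x. x \<in> U \<Longrightarrow> \<exists>V. openin (Euclidean_space k) V \<and> x \<in> V \<and> V \<subseteq> U \<and> continuous_on V f"
  shows "continuous_on U f"
  unfolding continuous_on_eq_continuous_within
proof
  fix x assume "x \<in> U"
  then obtain V where V: "openin (Euclidean_space k) V" "x \<in> V" "V \<subseteq> U" "continuous_on V f"
    using assms(2) by metis
  obtain T where T: "open T" "V = Euc k \<inter> T"
    using V(1) by (subst (asm) Euclidean_space_eq) (auto simp: openin_open)
  have "T \<inter> U - {x} = T \<inter> V - {x}"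
    using T V(3) assms(1) by auto
  then have "at x within V = at x within U"
    using at_within_nhd[of x T V U] T V(2) by (simp add: Int_commute)
  moreover have "continuous (at x within V) f"
    using V(2,4) by (simp add: continuous_on_eq_continuous_within)
  ultimately show "continuous (at x within U) f"
    by simp
qed

text \<open>Existence of partial derivatives is a pointwise condition; only continuity really has to
  be glued, at every order.\<close>

lemma Ck_on_local:
  assumes "openin (Euclidean_space k) U"
    and "\<And>x. x \<in> U \<Longrightarrow> \<exists>V. openin (Euclidean_space k) V \<and> x \<in> V \<and> V \<subseteq> U \<and> Ck_on r k V f"
  shows "Ck_on r k U f"
  using assms(2)
proof (induction r arbitrary: f)
  have U: "U \<subseteq> Euc k"
    by (rule openin_subset[OF assms(1)])
  have cont: "continuous_on U f"
    if *: "\<And>x. x \<in> U \<Longrightarrow> \<exists>V. openin (Euclidean_space k) V \<and> x \<in> V \<and> V \<subseteq> U \<and> Ck_on r k V f" for r f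
  proof (rule continuous_on_local_Euc[OF U])
    fix x assume "x \<in> U"
    then obtain V where V: "openin (Euclidean_space k) V" "x \<in> V" "V \<subseteq> U" "Ck_on r k V f"
      using * by metis
    then show "\<exists>V. openin (Euclidean_space k) V \<and> x \<in> V \<and> V \<subseteq> U \<and> continuous_on V f"
      using Ck_on_continuous[OF V(4)] U by (intro exI[of _ V]) simp
  qed
  {
    case (0 f)
    show ?case
      unfolding Ck_on_0[OF U] by (rule cont[OF 0])
  next
    case (Suc r f)
    have "has_partial i f x" if i: "i < k" and x: "x \<in> U" for i x
    proof -
      obtain V where "x \<in> V" "Ck_on (Suc r) k V f"
        using Suc.prems[OF x] by metis
      then show ?thesis
        using i by simp
    qed
    moreover have "Ck_on r k U (partial i f)" if "i < k" for i
    proof (rule Suc.IH)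
      fix x assume "x \<in> U"
      then obtain V where V: "openin (Euclidean_space k) V" "x \<in> V" "V \<subseteq> U" "Ck_on (Suc r) k V f"
        using Suc.prems by metis
      show "\<exists>V. openin (Euclidean_space k) V \<and> x \<in> V \<and> V \<subseteq> U \<and> Ck_on r k V (partial i f)"
        by (rule exI[of _ V]) (intro conjI V(1-3) Ck_on_SucD(1)[OF V(4) that])
    qed
    ultimately show ?case
      using U cont[OF Suc.prems] by (simp add: continuous_map_Euc Int_absorb1)
  }
qed

section \<open>Arithmetic of C^r functions\<close>

lemma Ck_on_const: "openin (Euclidean_space k) U \<Longrightarrow> Ck_on r k U (\<lambda>x. c)"
proof (induction r arbitrary: c)
  case 0
  then show ?case by (simp)
next
  case (Suc r)
  show ?case
    by (rule Ck_on_SucI[where D = "\<lambda>_ _. 0"]) (use Suc in auto)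
qed

lemma Ck_on_coord:
  assumes "openin (Euclidean_space k) U"
  shows "Ck_on r k U (\<lambda>x. x j)"
proof (cases r)
  case 0
  have "continuous_on U (\<lambda>x. x j)"
    by (rule continuous_on_subset[OF continuous_on_product_coordinates]) simp
  then show ?thesis
    using 0 Ck_on_0[OF openin_subset[OF assms(1)]] by simp
next
  case (Suc r')
  show ?thesis unfolding Suc
  proof (rule Ck_on_SucI[where D = "\<lambda>i _. if i = j then 1 else 0"])
    show "continuous_on U (\<lambda>x. x j)"
      by (rule continuous_on_subset[OF continuous_on_product_coordinates]) simp
  qed (use assms Ck_on_const in auto)
qed

lemma Ck_on_add:
  assumes "openin (Euclidean_space k) U" and "Ck_on r k U f" and "Ck_on r k U g"
  shows "Ck_on r k U (\<lambda>x. f x + g x)"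
  using assms(2,3)
proof (induction r arbitrary: f g)
  case 0
  then show ?case
    by (auto intro: continuous_map_add)
next
  case (Suc r)
  note U = assms(1)
  show ?case
  proof (rule Ck_on_SucI[where D = "\<lambda>i x. partial i f x + partial i g x"])
    show "continuous_on U (\<lambda>x. f x + g x)"
      by (intro continuous_on_add Suc.prems[THEN Ck_on_continuous[OF _ openin_subset[OF U]]])
    fix i assume i: "i < k"
    show "((\<lambda>t. f (x(i := t)) + g (x(i := t))) has_real_derivative
             partial i f x + partial i g x) (at (x i))" if x: "x \<in> U" for x
      by (intro DERIV_add Suc.prems[THEN Ck_on_SucD(2), OF i x])
    show "Ck_on r k U (\<lambda>x. partial i f x + partial i g x)"
      by (intro Suc.IH Suc.prems[THEN Ck_on_SucD(1), OF i])
  qed (rule U)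
qed

text \<open>The product rule yields products of functions that are at least C^r, so the induction on
  r runs for all f and g at once.\<close>

lemma Ck_on_mult:
  assumes "openin (Euclidean_space k) U" and "Ck_on r k U f" and "Ck_on r k U g"
  shows "Ck_on r k U (\<lambda>x. f x * g x)"
  using assms(2,3)
proof (induction r arbitrary: f g)
  case 0
  then show ?case
    by (auto intro: continuous_map_real_mult)
next
  case (Suc r)
  note U = assms(1)
  show ?case
  proof (rule Ck_on_SucI[where D = "\<lambda>i x. partial i f x * g x + partial i g x * f x"])
    show "continuous_on U (\<lambda>x. f x * g x)"
      by (intro continuous_on_mult Suc.prems[THEN Ck_on_continuous[OF _ openin_subset[OF U]]])
    fix i assume i: "i < k"
    show "((\<lambda>t. f (x(i := t)) * g (x(i := t))) has_real_derivative
             partial i f x * g x + partial i g x * f x) (at (x i))" if x: "x \<in> U" for x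
      using DERIV_mult[OF Ck_on_SucD(2)[OF Suc.prems(1) i x] Ck_on_SucD(2)[OF Suc.prems(2) i x]]
      by (simp only: fun_upd_triv)
    show "Ck_on r k U (\<lambda>x. partial i f x * g x + partial i g x * f x)"
      by (intro Ck_on_add U Suc.IH Ck_on_SucD(1)[OF _ i] Suc.prems Suc.prems[THEN Ck_on_Suc_imp])
  qed (rule U)
qed

text \<open>The derivative - f' / f^2 contains 1/f again; the induction hypothesis provides it at
  one order less, which is enough.\<close>

lemma Ck_on_inverse:
  assumes "openin (Euclidean_space k) U" and "Ck_on r k U f" and "\<And>x. x \<in> U \<Longrightarrow> f x \<noteq> 0"
  shows "Ck_on r k U (\<lambda>x. inverse (f x))"
  using assms(2)
proof (induction r)
  case 0
  have U: "U \<subseteq> Euc k"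
    by (rule openin_subset[OF assms(1)])
  then show ?case
    using 0 assms(3) by (simp only: Ck_on_0[OF U]) (auto intro!: continuous_on_inverse)
next
  case (Suc r)
  note U = assms(1)
  have IH: "Ck_on r k U (\<lambda>x. inverse (f x))"
    using Suc Ck_on_Suc_imp by blast
  show ?case
  proof (rule Ck_on_SucI[where D = "\<lambda>i x. (-1) * (partial i f x * (inverse (f x) * inverse (f x)))"])
    show "continuous_on U (\<lambda>x. inverse (f x))"
      using assms(3) Ck_on_continuous[OF Suc.prems openin_subset[OF U]]
      by (intro continuous_on_inverse) auto
    fix i assume i: "i < k"
    show "((\<lambda>t. inverse (f (x(i := t)))) has_real_derivative
             (-1) * (partial i f x * (inverse (f x) * inverse (f x)))) (at (x i))" if x: "x \<in> U" for x
      using DERIV_inverse_fun[OF Ck_on_SucD(2)[OF Suc.prems i x]] assms(3)[OF x]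
      by (simp add: mult_ac del: fun_upd_apply)
    show "Ck_on r k U (\<lambda>x. (-1) * (partial i f x * (inverse (f x) * inverse (f x))))"
      by (intro Ck_on_mult Ck_on_const U IH Ck_on_SucD(1)[OF _ i] Suc.prems)
  qed (rule U)
qed

lemma Ck_on_sum:
  assumes "openin (Euclidean_space k) U" and "\<And>j. j \<in> A \<Longrightarrow> Ck_on r k U (f j)"
  shows "Ck_on r k U (\<lambda>x. \<Sum>j\<in>A. f j x)"
  using assms(2)
  by (induction A rule: infinite_finite_induct)
    (auto intro: Ck_on_const[OF assms(1)] Ck_on_add[OF assms(1)])

section \<open>The chain rule for iterated partial derivatives\<close>

lemma tendsto_fun_iff:
  fixes f :: "'a \<Rightarrow> 'b \<Rightarrow> 'c::topological_space"
  shows "(f \<longlongrightarrow> l) F \<longleftrightarrow> (\<forall>i. ((\<lambda>t. f t i) \<longlongrightarrow> l i) F)"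
  using limitin_componentwise[of "\<lambda>_. euclidean" UNIV f l F] by (simp add: euclidean_product_topology)

text \<open>Treats p < q, q < p and p = q together, since the increment of a coordinate along a
  curve has no fixed sign.\<close>

lemma mvt_between:
  fixes h h' :: "real \<Rightarrow> real"
  assumes "\<And>s. \<bar>s - p\<bar> \<le> \<bar>q - p\<bar> \<Longrightarrow> (h has_real_derivative h' s) (at s)"
  shows "\<exists>\<xi>. \<bar>\<xi> - p\<bar> \<le> \<bar>q - p\<bar> \<and> h q - h p = (q - p) * h' \<xi>"
proof -
  consider "p < q" | "q < p" | "p = q"
    by linarith
  then show ?thesis
  proof cases
    case 1
    then obtain z where "p < z" "z < q" "h q - h p = (q - p) * h' z"
      using MVT2[of p q h h'] assms by (smt (verit))
    then show ?thesis
      by (intro exI[of _ z]) simp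
  next
    case 2
    then obtain z where "q < z" "z < p" "h p - h q = (p - q) * h' z"
      using MVT2[of q p h h'] assms by (smt (verit))
    then show ?thesis
      by (intro exI[of _ z]) (simp add: algebra_simps)
  qed auto
qed

text \<open>The two arguments of g differ only in coordinate j, so the mean value theorem in that
  coordinate applies.\<close>

lemma has_real_derivative_coordinate_increment:
  fixes a :: "real \<Rightarrow> nat \<Rightarrow> real" and b :: "real \<Rightarrow> real"
  assumes V: "openin (Euclidean_space l) V" and y: "y \<in> V" and j: "j < l"
    and part: "\<And>z. z \<in> V \<Longrightarrow> has_partial j g z"
    and cont: "continuous_on V (partial j g)"
    and a: "\<And>t. a t \<in> Euc l" "\<And>i. ((\<lambda>t. a t i) \<longlongrightarrow> y i) (at t0)" "a t0 = y" "\<And>t. a t j = y j"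
    and b: "(b has_real_derivative b') (at t0)" "b t0 = y j"
  shows "((\<lambda>t. g ((a t)(j := b t)) - g (a t)) has_real_derivative partial j g y * b') (at t0)"
proof -
  obtain \<delta> where \<delta>: "\<delta> > 0" "\<And>z. z \<in> Euc l \<Longrightarrow> (\<And>i. i < l \<Longrightarrow> \<bar>z i - y i\<bar> < \<delta>) \<Longrightarrow> z \<in> V"
    using openin_Euclidean_box[OF V y] by metis
  \<comment> \<open>For good t the segment from a t to \<open>(a t)(j := b t)\<close> lies in a cube
    around y contained in V.\<close>
  define good where "good t \<longleftrightarrow> (\<forall>i<l. \<bar>a t i - y i\<bar> < \<delta>) \<and> \<bar>b t - y j\<bar> < \<delta>" for t
  have upd: "(a t)(j := s) \<in> V" if "good t" "\<bar>s - y j\<bar> \<le> \<bar>b t - y j\<bar>" for t s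
    using that a(1)[of t] j by (intro \<delta>(2)) (auto simp: good_def Euc_iff)
  have b_tendsto: "(b \<longlongrightarrow> y j) (at t0)"
    using DERIV_isCont[OF b(1)] b(2) by (simp add: isCont_def)
  have near: "\<forall>\<^sub>F t in F. \<bar>u t - c\<bar> < \<delta>" if "(u \<longlongrightarrow> c) F" for u :: "real \<Rightarrow> real" and c F
    using tendstoD[OF that \<delta>(1)] by (simp add: dist_real_def)
  have "\<forall>\<^sub>F t in at t0. \<forall>i\<in>{..<l}. \<bar>a t i - y i\<bar> < \<delta>"
    by (intro eventually_ball_finite ballI near a(2)) simp
  then have good: "\<forall>\<^sub>F t in at t0. good t"
    using near[OF b_tendsto] unfolding good_def by eventually_elim simp
  have "\<exists>\<xi>. \<bar>\<xi> - y j\<bar> \<le> \<bar>b t - y j\<bar> \<and> g ((a t)(j := b t)) - g (a t) = (b t - y j) * partial j g ((a t)(j := \<xi>))"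
    if "good t" for t
  proof -
    have "((\<lambda>s. g ((a t)(j := s))) has_real_derivative partial j g ((a t)(j := s))) (at s)"
      if "\<bar>s - y j\<bar> \<le> \<bar>b t - y j\<bar>" for s
      using has_partialD[OF part[OF upd[OF \<open>good t\<close> that]]] by simp
    from mvt_between[of "y j" "b t", OF this] show ?thesis
      using a(4)[of t] by (metis fun_upd_triv)
  qed
  then obtain \<xi> where \<xi>: "\<And>t. good t \<Longrightarrow> \<bar>\<xi> t - y j\<bar> \<le> \<bar>b t - y j\<bar>"
    "\<And>t. good t \<Longrightarrow> g ((a t)(j := b t)) - g (a t) = (b t - y j) * partial j g ((a t)(j := \<xi> t))"
    by metis
  \<comment> \<open>The intermediate values are squeezed towards y j, so continuity of the partial
    derivative at y gives the limit of the difference quotients.\<close>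
  have "((\<lambda>t. \<xi> t - y j) \<longlongrightarrow> 0) (at t0)"
  proof (rule Lim_null_comparison)
    show "\<forall>\<^sub>F t in at t0. norm (\<xi> t - y j) \<le> \<bar>b t - y j\<bar>"
      using eventually_mono[OF good \<xi>(1)] by simp
    show "((\<lambda>t. \<bar>b t - y j\<bar>) \<longlongrightarrow> 0) (at t0)"
      using b_tendsto by (simp add: LIM_zero tendsto_rabs_zero)
  qed
  then have "(\<xi> \<longlongrightarrow> y j) (at t0)"
    by (simp add: LIM_zero_iff)
  then have "((\<lambda>t. (a t)(j := \<xi> t)) \<longlongrightarrow> y) (at t0)"
    unfolding tendsto_fun_iff
  proof (intro allI)
    fix i
    show "((\<lambda>t. ((a t)(j := \<xi> t)) i) \<longlongrightarrow> y i) (at t0)" if "(\<xi> \<longlongrightarrow> y j) (at t0)"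
      using a(2)[of i] that by (cases "i = j") simp_all
  qed
  then have "((\<lambda>t. partial j g ((a t)(j := \<xi> t))) \<longlongrightarrow> partial j g y) (at t0)"
    using upd \<xi>(1) by (intro continuous_on_tendsto_compose[OF cont _ y] eventually_mono[OF good]) auto
  moreover have "((\<lambda>t. (b t - y j) / (t - t0)) \<longlongrightarrow> b') (at t0)"
    using b by (simp add: has_field_derivative_iff)
  ultimately have "((\<lambda>t. partial j g ((a t)(j := \<xi> t)) * ((b t - y j) / (t - t0))) \<longlongrightarrow> partial j g y * b') (at t0)"
    by (rule tendsto_mult)
  moreover have "\<forall>\<^sub>F t in at t0. partial j g ((a t)(j := \<xi> t)) * ((b t - y j) / (t - t0)) =
      (g ((a t)(j := b t)) - g (a t)) / (t - t0)"
    by (rule eventually_mono[OF good]) (simp add: \<xi>(2))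
  moreover have "g ((a t0)(j := b t0)) - g (a t0) = 0"
    by (simp add: a(3) b(2))
  ultimately show ?thesis
    by (simp only: has_field_derivative_iff diff_zero) (rule Lim_transform_eventually)
qed

text \<open>The increment of g telescopes over the points \<open>h j t\<close>, which take their
  first j coordinates from the curve at t and the others from the curve at t0. Consecutive points
  differ in one coordinate. Continuity of the partial derivatives takes the place of total
  differentiability.\<close>

lemma has_real_derivative_along_curve:
  fixes \<gamma> :: "real \<Rightarrow> nat \<Rightarrow> real"
  assumes V: "openin (Euclidean_space l) V" and y: "\<gamma> t0 \<in> V"
    and part: "\<And>j z. j < l \<Longrightarrow> z \<in> V \<Longrightarrow> has_partial j g z"
    and cont: "\<And>j. j < l \<Longrightarrow> continuous_on V (partial j g)"
    and \<gamma>: "\<And>j. j < l \<Longrightarrow> ((\<lambda>t. \<gamma> t j) has_real_derivative \<gamma>' j) (at t0)"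
    and ev: "\<forall>\<^sub>F t in nhds t0. \<gamma> t \<in> V"
  shows "((\<lambda>t. g (\<gamma> t)) has_real_derivative (\<Sum>j<l. partial j g (\<gamma> t0) * \<gamma>' j)) (at t0)"
proof -
  define h where "h j t = (\<lambda>i. if i < j then \<gamma> t i else \<gamma> t0 i)" for j t
  have Euc: "\<gamma> t \<in> Euc l" if "\<gamma> t \<in> V" for t
    using that openin_subset[OF V] by blast
  have step: "(h j t)(j := \<gamma> t j) = h (Suc j) t" for j t
    by (auto simp: h_def fun_eq_iff)
  have "((\<lambda>t. g ((h j t)(j := \<gamma> t j)) - g (h j t)) has_real_derivative partial j g (\<gamma> t0) * \<gamma>' j) (at t0)"
    if "j < l" for j
  proof (rule has_real_derivative_coordinate_increment[OF V y that])
    show "h j t \<in> Euc l" for t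
      using that Euc[OF y] by (auto simp: h_def Euc_iff)
    show "((\<lambda>t. h j t i) \<longlongrightarrow> \<gamma> t0 i) (at t0)" for i
      using DERIV_isCont[OF \<gamma>, of i] that by (cases "i < j") (auto simp: h_def isCont_def)
  qed (use that part cont \<gamma> in \<open>auto simp: h_def\<close>)
  then have "((\<lambda>t. \<Sum>j<l. g (h (Suc j) t) - g (h j t)) has_real_derivative (\<Sum>j<l. partial j g (\<gamma> t0) * \<gamma>' j)) (at t0)"
    by (intro DERIV_sum) (simp add: step)
  then have "((\<lambda>t. g (h l t) - g (h 0 t)) has_real_derivative (\<Sum>j<l. partial j g (\<gamma> t0) * \<gamma>' j)) (at t0)"
    by (simp add: sum_lessThan_telescope[of "\<lambda>j. g (h j _)"])
  then have "((\<lambda>t. (g (h l t) - g (\<gamma> t0)) + g (\<gamma> t0)) has_real_derivative (\<Sum>j<l. partial j g (\<gamma> t0) * \<gamma>' j) + 0) (at t0)"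
    by (intro DERIV_add DERIV_const) (simp add: h_def)
  \<comment> \<open>From index l on, \<open>h l t\<close> has the coordinates of \<gamma> t0, which
    are zero. It equals \<gamma> t once \<gamma> t lies in V, that is eventually.\<close>
  moreover have "\<forall>\<^sub>F t in nhds t0. (g (h l t) - g (\<gamma> t0)) + g (\<gamma> t0) = g (\<gamma> t)"
  proof (rule eventually_mono[OF ev])
    fix t assume "\<gamma> t \<in> V"
    then have "h l t = \<gamma> t"
      using Euc[OF y] Euc[of t] by (auto simp: h_def Euc_iff fun_eq_iff)
    then show "(g (h l t) - g (\<gamma> t0)) + g (\<gamma> t0) = g (\<gamma> t)"
      by simp
  qed
  ultimately show ?thesis
    by (simp only: DERIV_cong_ev[OF refl _ refl] add_0_right)
qed

lemma continuous_on_into_Euc: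
  assumes "\<And>x. x \<in> U \<Longrightarrow> F x \<in> Euc l" and "\<And>j. j < l \<Longrightarrow> continuous_on U (\<lambda>x. F x j)"
  shows "continuous_on U F"
proof (rule continuous_on_coordinatewise_then_product)
  fix i
  show "continuous_on U (\<lambda>x. F x i)"
  proof (cases "i < l")
    case False
    then have "F x i = 0" if "x \<in> U" for x
      using assms(1)[OF that] by (simp add: Euc_iff)
    then show ?thesis
      using continuous_on_cong[of U U "\<lambda>x. F x i" "\<lambda>_. 0"] by simp
  qed (use assms in auto)
qed

lemma partial_compose:
  assumes "openin (Euclidean_space k) U" and "openin (Euclidean_space l) V" and "F ` U \<subseteq> V"
    and "\<And>j. j < l \<Longrightarrow> Ck_on (Suc 0) k U (\<lambda>x. F x j)" and "Ck_on (Suc 0) l V g"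
    and "i < k" and "x \<in> U"
  shows "((\<lambda>t. g (F (x(i := t)))) has_real_derivative
      (\<Sum>j<l. partial j g (F x) * partial i (\<lambda>x. F x j) x)) (at (x i))"
proof -
  have *: "F (x(i := x i)) = F x"
    by simp
  have "((\<lambda>t. g (F (x(i := t)))) has_real_derivative
      (\<Sum>j<l. partial j g (F (x(i := x i))) * partial i (\<lambda>x. F x j) x)) (at (x i))"
  proof (rule has_real_derivative_along_curve[OF assms(2)])
    show "\<forall>\<^sub>F t in nhds (x i). F (x(i := t)) \<in> V"
      by (rule eventually_mono[OF eventually_fun_upd_in_open[OF assms(1,7,6)]]) (use assms(3) in auto)
    show "continuous_on V (partial j g)" if "j < l" for j
      using Ck_on_continuous[OF Ck_on_SucD(1)[OF assms(5) that] openin_subset[OF assms(2)]] .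
    show "((\<lambda>t. F (x(i := t)) j) has_real_derivative partial i (\<lambda>x. F x j) x) (at (x i))" if "j < l" for j
      using Ck_on_SucD(2)[OF assms(4)[OF that] assms(6,7)] .
  qed (use assms in auto)
  then show ?thesis
    by simp
qed

lemma Ck_on_Suc_0: "Ck_on (Suc r) k U f \<Longrightarrow> Ck_on (Suc 0) k U f"
proof (induction r)
  case (Suc r)
  show ?case
    by (rule Suc.IH[OF Ck_on_Suc_imp[OF Suc.prems]])
qed

lemma continuous_on_compose_Euc:
  assumes "V \<subseteq> Euc l" and "F ` U \<subseteq> V"
    and "\<And>j. j < l \<Longrightarrow> continuous_on U (\<lambda>x. F x j)" and "continuous_on V g"
  shows "continuous_on U (\<lambda>x. g (F x))"
proof -
  have "continuous_on U F"
    by (rule continuous_on_into_Euc[where l = l]) (use assms in auto)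
  then show ?thesis
    by (rule continuous_on_compose2[OF assms(4) _ assms(2)])
qed

text \<open>By the chain rule the partial derivatives are sums of products of
  \<open>partial j g\<close> after F with partial derivatives of F. The first factors are
  compositions with F again, so the induction on r keeps F fixed and varies g.\<close>

lemma Ck_on_compose:
  assumes "openin (Euclidean_space k) U" and "openin (Euclidean_space l) V" and "F ` U \<subseteq> V"
    and "\<And>j. j < l \<Longrightarrow> Ck_on r k U (\<lambda>x. F x j)" and "Ck_on r l V g"
  shows "Ck_on r k U (\<lambda>x. g (F x))"
  using assms(4,5)
proof (induction r arbitrary: g)
  case 0
  note UV = openin_subset[OF assms(1)] openin_subset[OF assms(2)]
  show ?case
    unfolding Ck_on_0[OF UV(1)]
    by (rule continuous_on_compose_Euc[OF UV(2) assms(3) Ck_on_continuous[OF 0(1) UV(1)]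
        Ck_on_continuous[OF 0(2) UV(2)]])
next
  case (Suc r)
  note UV = openin_subset[OF assms(1)] openin_subset[OF assms(2)]
  show ?case
  proof (rule Ck_on_SucI[OF assms(1)])
    show "continuous_on U (\<lambda>x. g (F x))"
      by (rule continuous_on_compose_Euc[OF UV(2) assms(3) Ck_on_continuous[OF Suc.prems(1) UV(1)]
          Ck_on_continuous[OF Suc.prems(2) UV(2)]])
    show "((\<lambda>t. g (F (x(i := t)))) has_real_derivative
        (\<Sum>j<l. partial j g (F x) * partial i (\<lambda>x. F x j) x)) (at (x i))" if "i < k" "x \<in> U" for i x
      by (rule partial_compose[OF assms(1-3) Ck_on_Suc_0[OF Suc.prems(1)] Ck_on_Suc_0[OF Suc.prems(2)] that])
    show "Ck_on r k U (\<lambda>x. \<Sum>j<l. partial j g (F x) * partial i (\<lambda>x. F x j) x)" if i: "i < k" for i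
    proof (rule Ck_on_sum[OF assms(1)], rule Ck_on_mult[OF assms(1)])
      fix j assume "j \<in> {..<l}"
      then have j: "j < l"
        by simp
      show "Ck_on r k U (\<lambda>x. partial j g (F x))"
        by (rule Suc.IH[OF Ck_on_Suc_imp[OF Suc.prems(1)] Ck_on_SucD(1)[OF Suc.prems(2) j]])
      show "Ck_on r k U (partial i (\<lambda>x. F x j))"
        by (rule Ck_on_SucD(1)[OF Suc.prems(1)[OF j] i])
    qed
  qed
qed

section \<open>Smooth maps between open sets\<close>

lemma smooth_onD: "smooth_on k l U F \<Longrightarrow> j < l \<Longrightarrow> Ck_on r k U (\<lambda>x. F x j)"
  by (simp add: smooth_on_def)

lemma smooth_on_cong:
  assumes "openin (Euclidean_space k) U" and "\<And>y j. y \<in> U \<Longrightarrow> j < l \<Longrightarrow> F y j = G y j"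
    and "smooth_on k l U F"
  shows "smooth_on k l U G"
  unfolding smooth_on_def
proof (intro allI impI)
  fix j r assume j: "j < l"
  show "Ck_on r k U (\<lambda>x. G x j)"
    by (rule Ck_on_cong[OF assms(1) assms(2)[OF _ j] smooth_onD[OF assms(3) j]])
qed

lemma smooth_on_subset: "smooth_on k l U F \<Longrightarrow> V \<subseteq> U \<Longrightarrow> smooth_on k l V F"
  unfolding smooth_on_def using Ck_on_subset by blast

lemma smooth_on_local:
  assumes "openin (Euclidean_space k) U"
    and "\<And>x. x \<in> U \<Longrightarrow> \<exists>V. openin (Euclidean_space k) V \<and> x \<in> V \<and> V \<subseteq> U \<and> smooth_on k l V F"
  shows "smooth_on k l U F"
  unfolding smooth_on_def
proof (intro allI impI)
  fix j r assume "j < l"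
  then show "Ck_on r k U (\<lambda>x. F x j)"
    using assms(2) smooth_onD by (intro Ck_on_local[OF assms(1)]) metis
qed

lemma smooth_on_compose:
  assumes "openin (Euclidean_space k) U" and "openin (Euclidean_space l) V" and "F ` U \<subseteq> V"
    and "smooth_on k l U F" and "smooth_on l p V G"
  shows "smooth_on k p U (\<lambda>x. G (F x))"
  unfolding smooth_on_def
proof (intro allI impI)
  fix j r assume j: "j < p"
  show "Ck_on r k U (\<lambda>x. G (F x) j)"
    by (rule Ck_on_compose[OF assms(1-3) smooth_onD[OF assms(4)] smooth_onD[OF assms(5) j]])
qed

lemma smooth_on_imp_continuous_map:
  assumes "U \<subseteq> Euc k" and "F ` U \<subseteq> Euc l" and "smooth_on k l U F"
  shows "continuous_map (subtopology (Euclidean_space k) U) (Euclidean_space l) F"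
  unfolding cm_Euclidean_space_iff_continuous_on
proof
  show "continuous_on (topspace (subtopology (Euclidean_space k) U)) F"
    using assms Ck_on_continuous[OF smooth_onD[OF assms(3)] assms(1)]
    by (intro continuous_on_into_Euc[where l = l]) (auto simp: Int_absorb1)
qed (use assms in auto)

lemma openin_Euc [simp]: "openin (Euclidean_space k) (Euc k)"
  by simp

lemma smooth_on_id: "openin (Euclidean_space k) U \<Longrightarrow> smooth_on k k U (\<lambda>x. x)"
  by (simp add: smooth_on_def Ck_on_coord del: Ck_on.simps)

lemma openin_smooth_preimage:
  assumes "openin (Euclidean_space k) U" and "F ` U \<subseteq> Euc l" and "smooth_on k l U F"
    and "openin (Euclidean_space l) V"
  shows "openin (Euclidean_space k) {x \<in> U. F x \<in> V}"
  using openin_continuous_map_preimage[OF smooth_on_imp_continuous_map[OF _ assms(2,3)] assms(4)]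
    openin_subset[OF assms(1)] assms(1)
  by (auto simp: Int_absorb1 intro: openin_trans_full)


section \<open>Manifolds embedded in Euclidean space\<close>

lemma embedding_mapI:
  assumes "continuous_map X Y e" and "continuous_map (subtopology Y (e ` topspace X)) X d"
    and "\<And>x. x \<in> topspace X \<Longrightarrow> d (e x) = x"
  shows "embedding_map X Y e"
proof -
  have "homeomorphic_maps X (subtopology Y (e ` topspace X)) e d"
    using assms continuous_map_image_subset_topspace[OF assms(1)]
    by (auto simp: homeomorphic_maps_def continuous_map_in_subtopology)
  then show ?thesis
    by (auto simp: embedding_map_def homeomorphic_map_maps)
qed

lemma embedding_mapE:
  assumes "embedding_map X Y e"
  obtains d where "continuous_map X Y e" and "continuous_map (subtopology Y (e ` topspace X)) X d"
    and "\<And>x. x \<in> topspace X \<Longrightarrow> d (e x) = x"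
  using assms unfolding embedding_map_def homeomorphic_map_maps homeomorphic_maps_def
  by (auto simp: continuous_map_in_subtopology)

text \<open>Reduces continuity into a product, a power or an orbit space to continuity of the
  ambient coordinates.\<close>

lemma continuous_map_via_embedding:
  assumes e: "embedding_map Y Z e" and f: "f \<in> topspace X \<rightarrow> topspace Y"
    and ef: "continuous_map X Z (\<lambda>x. e (f x))"
  shows "continuous_map X Y f"
proof -
  obtain d where d: "continuous_map (subtopology Z (e ` topspace Y)) Y d"
    "\<And>y. y \<in> topspace Y \<Longrightarrow> d (e y) = y"
    using embedding_mapE[OF e] by metis
  have "continuous_map X (subtopology Z (e ` topspace Y)) (\<lambda>x. e (f x))"
    using ef f by (auto simp: continuous_map_in_subtopology)
  then have "continuous_map X Y (d \<circ> (\<lambda>x. e (f x)))"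
    using d(1) continuous_map_compose by blast
  then show ?thesis
    by (rule continuous_map_eq) (use d(2) f in auto)
qed

text \<open>The condition on charts in \<open>embedded_mfd\<close>, isolated so that it can be asked
  of the charts of any atlas.\<close>

definition adapted_chart ::
    "nat \<Rightarrow> ('a \<Rightarrow> nat \<Rightarrow> real) \<Rightarrow> 'a topology \<Rightarrow> nat \<Rightarrow> 'a chart \<Rightarrow> bool"
  where "adapted_chart N e X k = (\<lambda>(U, \<phi>). is_chart X k (U, \<phi>) \<and>
    smooth_on k N (\<phi> ` U) (e \<circ> inv_into U \<phi>) \<and>
    (\<forall>p\<in>U. \<exists>W \<Phi>. openin (Euclidean_space N) W \<and> e p \<in> W \<and> smooth_on N k W \<Phi> \<and>
       (\<forall>q\<in>U. e q \<in> W \<longrightarrow> \<Phi> (e q) = \<phi> q)))"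

text \<open>The atlas need not contain all adapted charts. This admits products and powers, whose
  atlases consist of product charts only, alongside the atlases of \<open>embedded_mfd\<close>, so
  that smoothness is proved in one way for all manifolds involved.\<close>

definition embedded_in :: "'a smfd \<Rightarrow> nat \<Rightarrow> ('a \<Rightarrow> nat \<Rightarrow> real) \<Rightarrow> bool"
  where "embedded_in M N e \<longleftrightarrow>
    embedding_map (mtop M) (Euclidean_space N) e \<and>
    (\<forall>C\<in>atlas M. adapted_chart N e (mtop M) (mdim M) C) \<and>
    (\<Union>C\<in>atlas M. fst C) = topspace (mtop M)"

lemma embedded_mfd_simps [simp]:
  "mtop (embedded_mfd N c k X) = X" "mdim (embedded_mfd N c k X) = k"
  "atlas (embedded_mfd N c k X) = Collect (adapted_chart N c X k)"
  by (auto simp: embedded_mfd_def adapted_chart_def)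

lemma is_chartD:
  assumes "is_chart X k (U, \<phi>)"
  shows "openin X U" and "openin (Euclidean_space k) (\<phi> ` U)" and "inj_on \<phi> U"
    and "continuous_map (subtopology X U) (Euclidean_space k) \<phi>"
    and "continuous_map (subtopology (Euclidean_space k) (\<phi> ` U)) X (inv_into U \<phi>)"
proof -
  have U: "openin X U" and img: "openin (Euclidean_space k) (\<phi> ` U)"
    and hom: "homeomorphic_map (subtopology X U) (subtopology (Euclidean_space k) (\<phi> ` U)) \<phi>"
    using assms by (auto simp: is_chart_def)
  show "openin X U" "openin (Euclidean_space k) (\<phi> ` U)"
    by fact+
  have top: "topspace (subtopology X U) = U"
    "topspace (subtopology (Euclidean_space k) (\<phi> ` U)) = \<phi> ` U"
    using openin_subset[OF U] openin_subset[OF img] by auto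
  obtain g where g: "continuous_map (subtopology X U) (subtopology (Euclidean_space k) (\<phi> ` U)) \<phi>"
    "continuous_map (subtopology (Euclidean_space k) (\<phi> ` U)) (subtopology X U) g"
    "\<forall>x\<in>U. g (\<phi> x) = x" "\<forall>y\<in>\<phi> ` U. \<phi> (g y) = y"
    using hom unfolding homeomorphic_map_maps homeomorphic_maps_def top by blast
  show "continuous_map (subtopology X U) (Euclidean_space k) \<phi>"
    using g(1) by (simp add: continuous_map_in_subtopology)
  show inj: "inj_on \<phi> U"
    using g(3) by (metis inj_onI)
  show "continuous_map (subtopology (Euclidean_space k) (\<phi> ` U)) X (inv_into U \<phi>)"
  proof (rule continuous_map_eq)
    show "continuous_map (subtopology (Euclidean_space k) (\<phi> ` U)) X g"
      using g(2) by (simp add: continuous_map_in_subtopology)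
    show "g y = inv_into U \<phi> y" if "y \<in> topspace (subtopology (Euclidean_space k) (\<phi> ` U))" for y
      using that g(3) inj unfolding top by (auto simp: inv_into_f_f)
  qed
qed

lemma openin_chart_image:
  assumes "is_chart X k (U, \<phi>)" and "openin X S" and "S \<subseteq> U"
  shows "openin (Euclidean_space k) (\<phi> ` S)"
proof -
  note chart = is_chartD[OF assms(1)]
  have "openin (subtopology (Euclidean_space k) (\<phi> ` U))
      {y \<in> topspace (subtopology (Euclidean_space k) (\<phi> ` U)). inv_into U \<phi> y \<in> S}"
    by (rule openin_continuous_map_preimage[OF chart(5) assms(2)])
  also have "{y \<in> topspace (subtopology (Euclidean_space k) (\<phi> ` U)). inv_into U \<phi> y \<in> S} = \<phi> ` S"
    using openin_subset[OF chart(2)] chart(3) assms(3) by (auto simp: inv_into_f_f)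
  finally show ?thesis
    using chart(2) openin_trans_full by blast
qed

lemma openin_domain_of_chart:
  assumes "is_chart X k (U, \<phi>)" and "continuous_map X Y f" and "openin Y V"
  shows "openin (Euclidean_space k) (\<phi> ` {x \<in> U. f x \<in> V})"
proof (rule openin_chart_image[OF assms(1)])
  have "openin X (U \<inter> {x \<in> topspace X. f x \<in> V})"
    by (intro openin_Int is_chartD(1)[OF assms(1)] openin_continuous_map_preimage[OF assms(2,3)])
  also have "U \<inter> {x \<in> topspace X. f x \<in> V} = {x \<in> U. f x \<in> V}"
    using openin_subset[OF is_chartD(1)[OF assms(1)]] by auto
  finally show "openin X {x \<in> U. f x \<in> V}" .
qed auto

text \<open>The inverse \<theta> of the chart is given explicitly. Its continuity into X needs no
  separate proof: e is an embedding and e after \<theta> is smooth, hence continuous.\<close>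

lemma adapted_chartI:
  assumes e: "embedding_map X (Euclidean_space N) e"
    and U: "openin X U" and D: "openin (Euclidean_space k) D"
    and \<phi>: "continuous_map (subtopology X U) (Euclidean_space k) \<phi>" "\<And>x. x \<in> U \<Longrightarrow> \<phi> x \<in> D"
    and \<theta>: "\<And>y. y \<in> D \<Longrightarrow> \<theta> y \<in> U" "smooth_on k N D (\<lambda>y. e (\<theta> y))"
    and inv: "\<And>x. x \<in> U \<Longrightarrow> \<theta> (\<phi> x) = x" "\<And>y. y \<in> D \<Longrightarrow> \<phi> (\<theta> y) = y"
    and ext: "\<And>p. p \<in> U \<Longrightarrow> \<exists>W \<Phi>. openin (Euclidean_space N) W \<and> e p \<in> W \<and> smooth_on N k W \<Phi> \<and>
       (\<forall>q\<in>U. e q \<in> W \<longrightarrow> \<Phi> (e q) = \<phi> q)"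
  shows "adapted_chart N e X k (U, \<phi>)"
proof -
  have img: "\<phi> ` U = D"
    using \<phi>(2) \<theta>(1) inv by force
  have inj: "inj_on \<phi> U"
    using inv(1) by (metis inj_onI)
  have inv_into: "inv_into U \<phi> y = \<theta> y" if "y \<in> D" for y
    using inv that \<theta>(1) inj by (metis inv_into_f_f)
  have UX: "U \<subseteq> topspace X" and DE: "D \<subseteq> Euc k"
    using openin_subset[OF U] openin_subset[OF D] by auto
  have eE: "e x \<in> Euc N" if "x \<in> U" for x
    using e UX that by (metis continuous_map_image_subset_topspace embedding_mapE image_subset_iff subsetD)
  have "continuous_map (subtopology (Euclidean_space k) D) (subtopology X U) \<theta>"
    unfolding continuous_map_in_subtopology
  proof
    show "continuous_map (subtopology (Euclidean_space k) D) X \<theta>"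
    proof (rule continuous_map_via_embedding[OF e])
      show "continuous_map (subtopology (Euclidean_space k) D) (Euclidean_space N) (\<lambda>y. e (\<theta> y))"
        by (rule smooth_on_imp_continuous_map[OF DE _ \<theta>(2)]) (use eE \<theta>(1) in auto)
    qed (use \<theta>(1) UX in auto)
  qed (use \<theta>(1) in auto)
  then have "homeomorphic_maps (subtopology X U) (subtopology (Euclidean_space k) D) \<phi> \<theta>"
    using \<phi> inv UX DE by (auto simp: homeomorphic_maps_def continuous_map_in_subtopology)
  then have "is_chart X k (U, \<phi>)"
    using U D by (auto simp: is_chart_def img homeomorphic_map_maps)
  moreover have "smooth_on k N D (e \<circ> inv_into U \<phi>)"
    by (rule smooth_on_cong[OF D _ \<theta>(2)]) (simp add: inv_into)
  ultimately show ?thesis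
    using ext by (simp add: adapted_chart_def img)
qed

lemma adapted_chartD:
  assumes "adapted_chart N e X k (U, \<phi>)"
  shows "is_chart X k (U, \<phi>)" and "smooth_on k N (\<phi> ` U) (\<lambda>y. e (inv_into U \<phi> y))"
    and "p \<in> U \<Longrightarrow> \<exists>W \<Phi>. openin (Euclidean_space N) W \<and> e p \<in> W \<and> smooth_on N k W \<Phi> \<and>
       (\<forall>q\<in>U. e q \<in> W \<longrightarrow> \<Phi> (e q) = \<phi> q)"
  using assms by (auto simp: adapted_chart_def o_def)

lemma embedded_inD:
  assumes "embedded_in M N e"
  shows "embedding_map (mtop M) (Euclidean_space N) e"
    and "continuous_map (mtop M) (Euclidean_space N) e"
    and "C \<in> atlas M \<Longrightarrow> adapted_chart N e (mtop M) (mdim M) C"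
    and "(\<Union>C\<in>atlas M. fst C) = topspace (mtop M)"
    and "x \<in> topspace (mtop M) \<Longrightarrow> e x \<in> Euc N"
proof -
  show *: "embedding_map (mtop M) (Euclidean_space N) e"
    "C \<in> atlas M \<Longrightarrow> adapted_chart N e (mtop M) (mdim M) C"
    "(\<Union>C\<in>atlas M. fst C) = topspace (mtop M)"
    using assms by (auto simp: embedded_in_def)
  show "continuous_map (mtop M) (Euclidean_space N) e"
    using *(1) embedding_mapE by blast
  then show "x \<in> topspace (mtop M) \<Longrightarrow> e x \<in> Euc N"
    by (auto simp: continuous_map_def)
qed

text \<open>Maps that extend to the ambient spaces are smooth in charts: locally the target chart is the
  restriction of a smooth map of the ambient space.\<close>

lemma smooth_on_charts:
  assumes M: "embedded_in M N e" and M': "embedded_in M' N' e'"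
    and U: "(U, \<phi>) \<in> atlas M" and V: "(V, \<psi>) \<in> atlas M'"
    and f: "continuous_map (mtop M) (mtop M') f"
    and G: "smooth_on N N' (Euc N) G"
      "\<And>x j. x \<in> topspace (mtop M) \<Longrightarrow> j < N' \<Longrightarrow> e' (f x) j = G (e x) j"
  shows "smooth_on (mdim M) (mdim M') (\<phi> ` {x \<in> U. f x \<in> V}) (\<psi> \<circ> f \<circ> inv_into U \<phi>)"
proof -
  note aU = adapted_chartD[OF embedded_inD(3)[OF M U]] and aV = adapted_chartD[OF embedded_inD(3)[OF M' V]]
  note cU = is_chartD[OF aU(1)] and cV = is_chartD[OF aV(1)]
  have UM: "U \<subseteq> topspace (mtop M)"
    using openin_subset[OF cU(1)] .
  note open_pre = openin_domain_of_chart[OF aU(1) f]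
  show "smooth_on (mdim M) (mdim M') (\<phi> ` {x \<in> U. f x \<in> V}) (\<psi> \<circ> f \<circ> inv_into U \<phi>)"
  proof (rule smooth_on_local[OF open_pre[OF cV(1)]])
    fix y assume "y \<in> \<phi> ` {x \<in> U. f x \<in> V}"
    then obtain p where p: "p \<in> U" "f p \<in> V" "y = \<phi> p"
      by auto
    obtain W \<Phi> where W: "openin (Euclidean_space N') W" "e' (f p) \<in> W" "smooth_on N' (mdim M') W \<Phi>"
      "\<And>q. q \<in> V \<Longrightarrow> e' q \<in> W \<Longrightarrow> \<Phi> (e' q) = \<psi> q"
      using aV(3)[OF p(2)] by metis
    \<comment> \<open>T is the part of the target chart on which \<Phi> represents \<psi>, and B its
      preimage in the source chart. On B the map in charts is the inverse chart followed by e, G and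
      \<Phi>.\<close>
    define T where "T = V \<inter> {x \<in> topspace (mtop M'). e' x \<in> W}"
    define B where "B = \<phi> ` {x \<in> U. f x \<in> T}"
    have "openin (mtop M') T"
      unfolding T_def by (intro openin_Int cV(1) openin_continuous_map_preimage[OF embedded_inD(2)[OF M'] W(1)])
    then have B: "openin (Euclidean_space (mdim M)) B"
      unfolding B_def by (rule open_pre)
    have inv: "inv_into U \<phi> (\<phi> x) = x" if "x \<in> U" for x
      using cU(3) that by (rule inv_into_f_f)
    have e'f: "smooth_on (mdim M) N' B (\<lambda>y. e' (f (inv_into U \<phi> y)))"
    proof (rule smooth_on_cong[OF B])
      show "smooth_on (mdim M) N' B (\<lambda>y. G (e (inv_into U \<phi> y)))"
      proof (rule smooth_on_compose[OF B openin_Euc _ _ G(1)])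
        show "(\<lambda>y. e (inv_into U \<phi> y)) ` B \<subseteq> Euc N"
          using embedded_inD(5)[OF M] UM by (auto simp: B_def inv)
        show "smooth_on (mdim M) N B (\<lambda>y. e (inv_into U \<phi> y))"
          by (rule smooth_on_subset[OF aU(2)]) (auto simp: B_def)
      qed
    qed (use G(2) UM in \<open>auto simp: B_def inv\<close>)
    have "smooth_on (mdim M) (mdim M') B (\<lambda>y. \<Phi> (e' (f (inv_into U \<phi> y))))"
      by (rule smooth_on_compose[OF B W(1) _ e'f W(3)]) (auto simp: B_def T_def inv)
    then have "smooth_on (mdim M) (mdim M') B (\<psi> \<circ> f \<circ> inv_into U \<phi>)"
      by (rule smooth_on_cong[OF B, rotated]) (auto simp: B_def T_def inv W(4))
    moreover have "y \<in> B" "B \<subseteq> \<phi> ` {x \<in> U. f x \<in> V}"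
      using p W(2) openin_subset[OF cV(1)] by (auto simp: B_def T_def)
    ultimately show "\<exists>B. openin (Euclidean_space (mdim M)) B \<and> y \<in> B \<and> B \<subseteq> \<phi> ` {x \<in> U. f x \<in> V} \<and>
        smooth_on (mdim M) (mdim M') B (\<psi> \<circ> f \<circ> inv_into U \<phi>)"
      using B by blast
  qed
qed

text \<open>One ambient formula G provides both the continuity of f and its smoothness in
  charts.\<close>

lemma embedded_in_smooth_map:
  assumes M: "embedded_in M N e" and M': "embedded_in M' N' e'"
    and f: "f \<in> topspace (mtop M) \<rightarrow> topspace (mtop M')"
    and G: "smooth_on N N' (Euc N) G"
      "\<And>x j. x \<in> topspace (mtop M) \<Longrightarrow> j < N' \<Longrightarrow> e' (f x) j = G (e x) j"
  shows "smooth_map M M' f"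
proof -
  have "continuous_map (mtop M) (mtop M') f"
  proof (rule continuous_map_via_embedding[OF embedded_inD(1)[OF M'] f])
    \<comment> \<open>G is prescribed only in the coordinates below N'. Cutting it off there makes
      it a map into R^N' and leaves its values relevant to f unchanged.\<close>
    let ?G = "\<lambda>z j. if j < N' then G z j else 0"
    have "smooth_on N N' (Euc N) ?G"
      by (rule smooth_on_cong[OF _ _ G(1)]) auto
    moreover have "?G ` Euc N \<subseteq> Euc N'"
      by (auto simp: Euc_iff)
    ultimately have "continuous_map (Euclidean_space N) (Euclidean_space N') ?G"
      using smooth_on_imp_continuous_map[of "Euc N" N ?G N'] by simp
    then have "continuous_map (mtop M) (Euclidean_space N') (?G \<circ> e)"
      using continuous_map_compose embedded_inD(2)[OF M] by blast
    then show "continuous_map (mtop M) (Euclidean_space N') (\<lambda>x. e' (f x))"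
    proof (rule continuous_map_eq)
      fix x assume x: "x \<in> topspace (mtop M)"
      then have "e' (f x) \<in> Euc N'"
        using embedded_inD(5)[OF M'] f by blast
      then show "(?G \<circ> e) x = e' (f x)"
        using G(2)[OF x] by (auto simp: Euc_iff fun_eq_iff)
    qed
  qed
  then show ?thesis
    using smooth_on_charts[OF M M' _ _ _ G] unfolding smooth_map_def by blast
qed

section \<open>Embedded manifolds are manifolds; diffeomorphisms from ambient formulas\<close>

lemma second_countable_euclidean:
  "second_countable (euclidean :: 'a::second_countable_topology topology)"
proof -
  obtain B :: "'a set set" where B: "countable B" "topological_basis B"
    using ex_countable_basis by metis
  have "\<exists>V\<in>B. x \<in> V \<and> V \<subseteq> U" if "open U" "x \<in> U" for U x
    using topological_basisE[OF B(2) that] by metis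
  moreover have "open V" if "V \<in> B" for V
    by (rule topological_basis_open[OF B(2) that])
  ultimately show ?thesis
    using B(1) by (auto simp: second_countable_def simp flip: open_openin)
qed

text \<open>Compatibility of two charts is smoothness of the identity map in these charts, with the
  identity as ambient formula. The separation and countability axioms are inherited from
  R^N.\<close>

lemma embedded_in_smooth_manifold:
  assumes M: "embedded_in M N e"
  shows "smooth_manifold M"
proof -
  have hom: "mtop M homeomorphic_space subtopology (Euclidean_space N) (e ` topspace (mtop M))"
    using embedding_map_imp_homeomorphic_space[OF embedded_inD(1)[OF M]] .
  have "Hausdorff_space (subtopology (Euclidean_space N) S)" "second_countable (subtopology (Euclidean_space N) S)" for S
    by (simp_all add: Euclidean_space_def euclidean_product_topology Hausdorff_space_subtopology
        second_countable_subtopology second_countable_euclidean)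
  then have "Hausdorff_space (mtop M)" "second_countable (mtop M)"
    using hom homeomorphic_Hausdorff_space homeomorphic_space_second_countability by blast+
  moreover have "smooth_on (mdim M) (mdim M) (\<phi> ` (U \<inter> V)) (\<psi> \<circ> inv_into U \<phi>)"
    if "(U, \<phi>) \<in> atlas M" "(V, \<psi>) \<in> atlas M" for U \<phi> V \<psi>
    using smooth_on_charts[OF M M that, of "\<lambda>x. x" "\<lambda>z. z"]
    by (simp add: smooth_on_id Collect_conj_eq o_def)
  moreover have "is_chart (mtop M) (mdim M) C" if "C \<in> atlas M" for C
    using embedded_inD(3)[OF M that] by (cases C) (simp add: adapted_chart_def)
  ultimately show ?thesis
    using embedded_inD(4)[OF M] unfolding smooth_manifold_def by blast
qed

lemma embedded_in_diffeomorphic: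
  assumes M: "embedded_in M N e" and M': "embedded_in M' N' e'"
    and f: "bij_betw f (topspace (mtop M)) (topspace (mtop M'))"
    and A: "smooth_on N N' (Euc N) A"
      "\<And>x j. x \<in> topspace (mtop M) \<Longrightarrow> j < N' \<Longrightarrow> e' (f x) j = A (e x) j"
    and B: "smooth_on N' N (Euc N') B"
      "\<And>x j. x \<in> topspace (mtop M) \<Longrightarrow> j < N \<Longrightarrow> e x j = B (e' (f x)) j"
  shows "diffeomorphic M M'"
proof -
  have "smooth_map M M' f"
    by (rule embedded_in_smooth_map[OF M M' _ A]) (use bij_betwE[OF f] in auto)
  moreover have "smooth_map M' M (inv_into (topspace (mtop M)) f)"
  proof (rule embedded_in_smooth_map[OF M' M _ B(1)])
    show "inv_into (topspace (mtop M)) f \<in> topspace (mtop M') \<rightarrow> topspace (mtop M)"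
      using bij_betwE[OF bij_betw_inv_into[OF f]] by auto
    show "e (inv_into (topspace (mtop M)) f y) j = B (e' y) j" if "y \<in> topspace (mtop M')" "j < N" for y j
      using B(2)[of "inv_into (topspace (mtop M)) f y" j] that f
        bij_betwE[OF bij_betw_inv_into[OF f]] bij_betw_inv_into_right[OF f] by auto
  qed
  ultimately show ?thesis
    using f embedded_in_smooth_manifold[OF M] embedded_in_smooth_manifold[OF M']
    unfolding diffeomorphic_def diffeomorphism_def by blast
qed


section \<open>Submersions and quotients obtained from sections\<close>

lemma smooth_mapD:
  assumes "smooth_map M M' f"
  shows "continuous_map (mtop M) (mtop M') f"
    and "(U, \<phi>) \<in> atlas M \<Longrightarrow> (V, \<psi>) \<in> atlas M' \<Longrightarrow>
      smooth_on (mdim M) (mdim M') (\<phi> ` {x \<in> U. f x \<in> V}) (\<psi> \<circ> f \<circ> inv_into U \<phi>)"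
  using assms unfolding smooth_map_def by blast+

lemma smooth_manifold_chart: "smooth_manifold M \<Longrightarrow> C \<in> atlas M \<Longrightarrow> is_chart (mtop M) (mdim M) C"
  by (simp add: smooth_manifold_def)

text \<open>Differentiating \<open>f \<circ> s = id\<close> in charts gives a right inverse of the Jacobian.\<close>

lemma submersion_from_local_sections:
  assumes M: "smooth_manifold M" and M': "smooth_manifold M'" and f: "smooth_map M M' f"
    and sec: "\<And>x. x \<in> topspace (mtop M) \<Longrightarrow>
      \<exists>s. smooth_map M' M s \<and> s (f x) = x \<and> (\<forall>y\<in>topspace (mtop M'). f (s y) = y)"
  shows "submersion M M' f"
proof -
  have jac: "jacobian_surjective (mdim M) (mdim M') (\<psi> \<circ> f \<circ> inv_into U \<phi>) (\<phi> x)"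
    if U: "(U, \<phi>) \<in> atlas M" and V: "(V, \<psi>) \<in> atlas M'" and x: "x \<in> U" "f x \<in> V" for U \<phi> V \<psi> x
  proof -
    let ?k = "mdim M" and ?l = "mdim M'"
    have chU: "is_chart (mtop M) ?k (U, \<phi>)" and chV: "is_chart (mtop M') ?l (V, \<psi>)"
      using smooth_manifold_chart M M' U V by metis+
    note cU = is_chartD[OF chU] and cV = is_chartD[OF chV]
    have invU: "inv_into U \<phi> (\<phi> p) = p" if "p \<in> U" for p
      using cU(3) that by (rule inv_into_f_f)
    have invV: "inv_into V \<psi> (\<psi> p) = p" if "p \<in> V" for p
      using cV(3) that by (rule inv_into_f_f)
    have "x \<in> topspace (mtop M)"
      using x(1) openin_subset[OF cU(1)] by blast
    then obtain s where s: "smooth_map M' M s" "s (f x) = x" "\<And>y. y \<in> topspace (mtop M') \<Longrightarrow> f (s y) = y"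
      using sec by metis
    define F where "F = \<psi> \<circ> f \<circ> inv_into U \<phi>"
    define S where "S = \<phi> \<circ> s \<circ> inv_into V \<psi>"
    define A where "A = \<phi> ` {p \<in> U. f p \<in> V}"
    define B where "B = \<psi> ` {y \<in> V. s y \<in> U}"
    have A: "openin (Euclidean_space ?k) A"
      unfolding A_def using openin_domain_of_chart[OF chU smooth_mapD(1)[OF f] cV(1)] by simp
    have B: "openin (Euclidean_space ?l) B"
      unfolding B_def using openin_domain_of_chart[OF chV smooth_mapD(1)[OF s(1)] cU(1)] by simp
    have smF: "smooth_on ?k ?l A F"
      unfolding A_def F_def by (rule smooth_mapD(2)[OF f U V])
    have smS: "smooth_on ?l ?k B S"
      unfolding B_def S_def by (rule smooth_mapD(2)[OF s(1) V U])
    have VM: "V \<subseteq> topspace (mtop M')"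
      using openin_subset[OF cV(1)] .
    have SB: "S ` B \<subseteq> A"
      using s(3) VM by (auto simp: A_def B_def S_def invV)
    have FS: "F (S z) = z" if "z \<in> B" for z
      using that s(3) VM by (auto simp: B_def F_def S_def invU invV)
    define z where "z = \<psi> (f x)"
    have z: "z \<in> B" "S z = \<phi> x"
      using x s(2) by (auto simp: z_def B_def S_def invV)
    have delta: "(\<Sum>j<?k. partial j (\<lambda>y. F y a) (S z) * partial i (\<lambda>y. S y j) z) = (if i = a then 1 else 0)"
      if "a < ?l" "i < ?l" for a i
    proof -
      have deriv: "((\<lambda>t. F (S (z(i := t))) a) has_real_derivative
        (\<Sum>j<?k. partial j (\<lambda>y. F y a) (S z) * partial i (\<lambda>y. S y j) z)) (at (z i))"
        by (rule partial_compose[OF B A SB smooth_onD[OF smS] smooth_onD[OF smF that(1)] that(2) z(1)])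
      have ev: "\<forall>\<^sub>F t in nhds (z i). F (S (z(i := t))) a = (z(i := t)) a"
        by (rule eventually_mono[OF eventually_fun_upd_in_open[OF B z(1) that(2)]]) (simp only: FS)
      have "((\<lambda>t. (z(i := t)) a) has_real_derivative
        (\<Sum>j<?k. partial j (\<lambda>y. F y a) (S z) * partial i (\<lambda>y. S y j) z)) (at (z i))"
        using deriv unfolding DERIV_cong_ev[OF refl ev refl] .
      moreover have "((\<lambda>t. (z(i := t)) a) has_real_derivative (if i = a then 1 else 0)) (at (z i))"
        by auto
      ultimately show ?thesis
        by (rule DERIV_unique)
    qed
    show ?thesis
      unfolding jacobian_surjective_def F_def[symmetric] z(2)[symmetric]
    proof (intro allI exI impI)
      \<comment> \<open>The preimage of w is its image under the Jacobian of the section S;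
        exchanging the two sums brings in \<open>delta\<close>.\<close>
      fix w :: "nat \<Rightarrow> real" and a assume a: "a < ?l"
      have "(\<Sum>j<?k. partial j (\<lambda>y. F y a) (S z) * (\<Sum>i<?l. w i * partial i (\<lambda>y. S y j) z)) =
          (\<Sum>j<?k. \<Sum>i<?l. w i * (partial j (\<lambda>y. F y a) (S z) * partial i (\<lambda>y. S y j) z))"
        by (simp add: sum_distrib_left mult_ac)
      also have "\<dots> = (\<Sum>i<?l. w i * (\<Sum>j<?k. partial j (\<lambda>y. F y a) (S z) * partial i (\<lambda>y. S y j) z))"
        by (subst sum.swap) (simp add: sum_distrib_left)
      also have "\<dots> = (\<Sum>i<?l. w i * (if i = a then 1 else 0))"
        by (intro sum.cong refl) (simp add: delta[OF a])
      also have "\<dots> = w a"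
        using a by (simp add: if_distrib[of "\<lambda>c. _ * c"] cong: if_cong)
      finally show "(\<Sum>j<?k. partial j (\<lambda>y. F y a) (S z) * (\<Sum>i<?l. w i * partial i (\<lambda>y. S y j) z)) = w a" .
    qed
  qed
  show ?thesis
    unfolding submersion_def using f jac by auto
qed

text \<open>A continuous map with a continuous section is a quotient map. One section suffices for
  this, and a point of M provides it; the submersion property uses sections through every
  point.\<close>

lemma quotient_manifold_from_sections:
  assumes M: "smooth_manifold M" and M': "smooth_manifold M'" and f: "smooth_map M M' f"
    and ne: "topspace (mtop M) \<noteq> {}"
    and sec: "\<And>x. x \<in> topspace (mtop M) \<Longrightarrow>
      \<exists>s. smooth_map M' M s \<and> s (f x) = x \<and> (\<forall>y\<in>topspace (mtop M'). f (s y) = y)"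
  shows "quotient_manifold M f M'"
proof -
  obtain s where s: "smooth_map M' M s" "\<And>y. y \<in> topspace (mtop M') \<Longrightarrow> f (s y) = y"
  proof -
    obtain x where "x \<in> topspace (mtop M)"
      using ne by (metis ex_in_conv)
    from sec[OF this] show ?thesis
      using that by metis
  qed
  have "quotient_map (mtop M') (mtop M') (f \<circ> s)"
    by (rule quotient_map_eq[of _ _ id]) (simp_all add: s(2) quotient_map_def Collect_conj_eq Int_absorb1)
  then have "quotient_map (mtop M) (mtop M') f"
    using quotient_map_from_composition smooth_mapD(1)[OF s(1)] smooth_mapD(1)[OF f] by metis
  then show ?thesis
    using M M' submersion_from_local_sections[OF M M' f sec] by (simp add: quotient_manifold_def)
qed

section \<open>Transport of a structure along a bijection\<close>

text \<open>Shows that X has enough adapted charts, namely those of M composed with h.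
  Precomposition with A turns local extensions of charts of M into extensions for X, and B makes the
  inverse charts smooth in the coordinates c. The atlas of \<open>embedded_mfd\<close> contains all
  adapted charts, so it remains to see that these cover X.\<close>

lemma embedded_in_transport:
  assumes M: "embedded_in M N e" and c: "embedding_map X (Euclidean_space N') c"
    and h: "bij_betw h (topspace X) (topspace (mtop M))"
    and A: "smooth_on N' N (Euc N') A" "A ` Euc N' \<subseteq> Euc N" "\<And>x. x \<in> topspace X \<Longrightarrow> e (h x) = A (c x)"
    and B: "smooth_on N N' (Euc N) B" "\<And>x j. x \<in> topspace X \<Longrightarrow> j < N' \<Longrightarrow> c x j = B (e (h x)) j"
  shows "embedded_in (embedded_mfd N' c (mdim M) X) N' c"
proof -
  have cE: "continuous_map X (Euclidean_space N') c"
    using c embedding_mapE by blast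
  have hM: "h x \<in> topspace (mtop M)" if "x \<in> topspace X" for x
    using bij_betwE[OF h] that by blast
  have h_cont: "continuous_map X (mtop M) h"
  proof (rule continuous_map_via_embedding[OF embedded_inD(1)[OF M]])
    have "continuous_map (Euclidean_space N') (Euclidean_space N) A"
      using smooth_on_imp_continuous_map[OF _ A(2,1)] by simp
    then have "continuous_map X (Euclidean_space N) (A \<circ> c)"
      using continuous_map_compose[OF cE] by blast
    then show "continuous_map X (Euclidean_space N) (\<lambda>x. e (h x))"
      by (rule continuous_map_eq) (simp add: A(3))
  qed (use hM in auto)
  define g where "g = inv_into (topspace X) h"
  have g: "g y \<in> topspace X" "h (g y) = y" if "y \<in> topspace (mtop M)" for y
    using that bij_betwE[OF bij_betw_inv_into[OF h]] bij_betw_inv_into_right[OF h] by (auto simp: g_def)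
  have gh: "g (h x) = x" if "x \<in> topspace X" for x
    using that bij_betw_inv_into_left[OF h] by (simp add: g_def)
  have chart: "adapted_chart N' c X (mdim M) ({x \<in> topspace X. h x \<in> U}, \<phi> \<circ> h)"
    if U: "(U, \<phi>) \<in> atlas M" for U \<phi>
  proof -
    note aU = adapted_chartD[OF embedded_inD(3)[OF M U]]
    note cU = is_chartD[OF aU(1)]
    have UM: "U \<subseteq> topspace (mtop M)"
      using openin_subset[OF cU(1)] .
    have inv: "inv_into U \<phi> (\<phi> p) = p" if "p \<in> U" for p
      using cU(3) that by (rule inv_into_f_f)
    show ?thesis
    proof (rule adapted_chartI[OF c, where \<theta> = "\<lambda>y. g (inv_into U \<phi> y)"])
      show "openin X {x \<in> topspace X. h x \<in> U}"
        by (rule openin_continuous_map_preimage[OF h_cont cU(1)])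
      show "openin (Euclidean_space (mdim M)) (\<phi> ` U)"
        by (rule cU(2))
      show "continuous_map (subtopology X {x \<in> topspace X. h x \<in> U}) (Euclidean_space (mdim M)) (\<phi> \<circ> h)"
        by (rule continuous_map_compose[OF _ cU(4)])
          (use h_cont in \<open>auto simp: continuous_map_in_subtopology continuous_map_from_subtopology\<close>)
      show "smooth_on (mdim M) N' (\<phi> ` U) (\<lambda>y. c (g (inv_into U \<phi> y)))"
      proof (rule smooth_on_cong[OF cU(2)])
        show "smooth_on (mdim M) N' (\<phi> ` U) (\<lambda>y. B (e (inv_into U \<phi> y)))"
          by (rule smooth_on_compose[OF cU(2) openin_Euc _ aU(2) B(1)])
            (use UM embedded_inD(5)[OF M] in \<open>auto simp: inv\<close>)
        show "B (e (inv_into U \<phi> y)) j = c (g (inv_into U \<phi> y)) j" if "y \<in> \<phi> ` U" "j < N'" for y j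
          using that UM g B(2)[of "g (inv_into U \<phi> y)" j] by (auto simp: inv)
      qed
      fix p assume p: "p \<in> {x \<in> topspace X. h x \<in> U}"
      then obtain W \<Phi> where W: "openin (Euclidean_space N) W" "e (h p) \<in> W" "smooth_on N (mdim M) W \<Phi>"
        "\<And>q. q \<in> U \<Longrightarrow> e q \<in> W \<Longrightarrow> \<Phi> (e q) = \<phi> q"
        using aU(3)[of "h p"] by auto
      have W': "openin (Euclidean_space N') {z \<in> Euc N'. A z \<in> W}"
        by (rule openin_smooth_preimage[OF openin_Euc A(2,1) W(1)])
      have cEuc: "c x \<in> Euc N'" if "x \<in> topspace X" for x
        using cE that by (auto simp: continuous_map_def)
      show "\<exists>W \<Phi>. openin (Euclidean_space N') W \<and> c p \<in> W \<and> smooth_on N' (mdim M) W \<Phi> \<and>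
          (\<forall>q\<in>{x \<in> topspace X. h x \<in> U}. c q \<in> W \<longrightarrow> \<Phi> (c q) = (\<phi> \<circ> h) q)"
      proof (intro exI conjI)
        show "smooth_on N' (mdim M) {z \<in> Euc N'. A z \<in> W} (\<lambda>z. \<Phi> (A z))"
          by (rule smooth_on_compose[OF W' W(1) _ _ W(3)]) (use smooth_on_subset[OF A(1)] in auto)
        show "c p \<in> {z \<in> Euc N'. A z \<in> W}"
          using p W(2) A(3) cEuc by auto
        show "\<forall>q\<in>{x \<in> topspace X. h x \<in> U}. c q \<in> {z \<in> Euc N'. A z \<in> W} \<longrightarrow> \<Phi> (A (c q)) = (\<phi> \<circ> h) q"
          using W(4) by (auto simp flip: A(3))
      qed (rule W')
    qed (use UM g gh in \<open>auto simp: inv\<close>)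
  qed
  show ?thesis
    unfolding embedded_in_def embedded_mfd_simps
  proof (intro conjI c ballI)
    show "(\<Union>C\<in>Collect (adapted_chart N' c X (mdim M)). fst C) = topspace X"
    proof (intro equalityI subsetI)
      fix x assume "x \<in> (\<Union>C\<in>Collect (adapted_chart N' c X (mdim M)). fst C)"
      then obtain U \<phi> where "adapted_chart N' c X (mdim M) (U, \<phi>)" "x \<in> U"
        by auto
      then show "x \<in> topspace X"
        using openin_subset[OF is_chartD(1)[OF adapted_chartD(1)]] by blast
    next
      fix x assume x: "x \<in> topspace X"
      then obtain U \<phi> where "(U, \<phi>) \<in> atlas M" "h x \<in> U"
        using hM[OF x] unfolding embedded_inD(4)[OF M, symmetric] by auto
      then show "x \<in> (\<Union>C\<in>Collect (adapted_chart N' c X (mdim M)). fst C)"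
        using chart x by (intro UN_I[of "({x \<in> topspace X. h x \<in> U}, \<phi> \<circ> h)"]) auto
    qed
  qed auto
qed

section \<open>Products, powers and spheres\<close>

definition block :: "nat \<Rightarrow> nat \<Rightarrow> (nat \<Rightarrow> real) \<Rightarrow> nat \<Rightarrow> real"
  where "block s k z = (\<lambda>j. if j < k then z (s + j) else 0)"

lemma block_Euc: "block s k z \<in> Euc k"
  by (simp add: block_def Euc_iff)

lemma smooth_on_block: "openin (Euclidean_space n) U \<Longrightarrow> smooth_on n k U (block s k)"
  by (simp add: smooth_on_def block_def Ck_on_coord del: Ck_on.simps)

lemma continuous_map_block: "continuous_map (Euclidean_space n) (Euclidean_space k) (block s k)"
  using smooth_on_imp_continuous_map[OF _ _ smooth_on_block[OF openin_Euc]] block_Euc by fastforce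

lemma openin_block_preimage:
  "openin (Euclidean_space k) A \<Longrightarrow> openin (Euclidean_space n) {z \<in> Euc n. block s k z \<in> A}"
  by (rule openin_continuous_map_preimage[OF continuous_map_block])

lemma continuous_map_into_Euc:
  assumes "\<And>x. x \<in> topspace X \<Longrightarrow> f x \<in> Euc n"
    and "\<And>j. j < n \<Longrightarrow> continuous_map X euclideanreal (\<lambda>x. f x j)"
  shows "continuous_map X (Euclidean_space n) f"
proof (rule continuous_map_eq)
  show "continuous_map X (Euclidean_space n) (\<lambda>x i. if i < n then f x i else 0)"
    unfolding continuous_map_componentwise_Euclidean_space using assms(2) by blast
  show "(\<lambda>i. if i < n then f x i else 0) = f x" if "x \<in> topspace X" for x
    using assms(1)[OF that] by (auto simp: Euc_iff fun_eq_iff)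
qed

lemma continuous_map_Euc_component:
  assumes "continuous_map X (Euclidean_space n) f"
  shows "continuous_map X euclideanreal (\<lambda>x. f x j)"
  using assms unfolding Euclidean_space_def
  by (auto simp: continuous_map_in_subtopology continuous_map_componentwise_UNIV)

definition join :: "nat \<Rightarrow> (nat \<Rightarrow> real) \<Rightarrow> (nat \<Rightarrow> real) \<Rightarrow> nat \<Rightarrow> real"
  where "join k x y = (\<lambda>j. if j < k then x j else y (j - k))"

lemma join_Euc: "x \<in> Euc k \<Longrightarrow> y \<in> Euc l \<Longrightarrow> join k x y \<in> Euc (k + l)"
  by (auto simp: join_def Euc_iff)

lemma block_join:
  "x \<in> Euc k \<Longrightarrow> block 0 k (join k x y) = x"
  "y \<in> Euc l \<Longrightarrow> block k l (join k x y) = y"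
  by (auto simp: join_def block_def Euc_iff fun_eq_iff)

lemma join_block: "z \<in> Euc (k + l) \<Longrightarrow> join k (block 0 k z) (block k l z) = z"
  by (auto simp: join_def block_def Euc_iff fun_eq_iff)

lemma smooth_on_join:
  assumes "smooth_on n k U F" and "smooth_on n l U G"
  shows "smooth_on n (k + l) U (\<lambda>z. join k (F z) (G z))"
  unfolding smooth_on_def
proof (intro allI impI)
  fix j r assume "j < k + l"
  then show "Ck_on r n U (\<lambda>z. join k (F z) (G z) j)"
    by (cases "j < k") (auto simp: join_def intro: smooth_onD[OF assms(1)] smooth_onD[OF assms(2)])
qed

lemma continuous_map_join:
  assumes f: "continuous_map X (Euclidean_space k) f" and g: "continuous_map X (Euclidean_space l) g"
  shows "continuous_map X (Euclidean_space (k + l)) (\<lambda>x. join k (f x) (g x))"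
proof (rule continuous_map_into_Euc)
  show "join k (f x) (g x) \<in> Euc (k + l)" if "x \<in> topspace X" for x
    using f g that by (intro join_Euc) (auto simp: continuous_map_def)
  show "continuous_map X euclideanreal (\<lambda>x. join k (f x) (g x) j)" for j
    using continuous_map_Euc_component[OF f, of j] continuous_map_Euc_component[OF g, of "j - k"]
    by (cases "j < k") (auto simp: join_def)
qed

text \<open>Expresses product charts by \<open>join\<close>, the operation that also forms the
  product embedding, so that one set of rules serves both.\<close>

lemma prod_mfd_simps:
  "mtop (prod_mfd M M') = prod_topology (mtop M) (mtop M')"
  "mdim (prod_mfd M M') = mdim M + mdim M'"
  "atlas (prod_mfd M M') = {(U \<times> V, \<lambda>p. join (mdim M) (\<phi> (fst p)) (\<psi> (snd p))) | U \<phi> V \<psi>.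
      (U, \<phi>) \<in> atlas M \<and> (V, \<psi>) \<in> atlas M'}"
  by (simp_all add: prod_mfd_def join_def case_prod_unfold)

lemma continuous_map_block_subtopology:
  assumes "continuous_map (subtopology (Euclidean_space k) A) X f" and "\<And>z. z \<in> B \<Longrightarrow> block s k z \<in> A"
  shows "continuous_map (subtopology (Euclidean_space n) B) X (\<lambda>z. f (block s k z))"
proof -
  have "continuous_map (subtopology (Euclidean_space n) B) (subtopology (Euclidean_space k) A) (block s k)"
    using assms(2) continuous_map_block
    by (auto simp: continuous_map_in_subtopology continuous_map_from_subtopology)
  from continuous_map_compose[OF this assms(1)] show ?thesis
    by (simp add: o_def)
qed

lemma chart_at:
  assumes "embedded_in M N e" and "x \<in> topspace (mtop M)"
  shows "\<exists>U \<phi>. (U, \<phi>) \<in> atlas M \<and> x \<in> U"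
  using assms(2) unfolding embedded_inD(4)[OF assms(1), symmetric] by auto

lemma atlas_subset:
  assumes "embedded_in M N e" and "(U, \<phi>) \<in> atlas M" and "x \<in> U"
  shows "x \<in> topspace (mtop M)"
  using assms(2,3) unfolding embedded_inD(4)[OF assms(1), symmetric] by force

text \<open>All data are joined from those of the factors: inverse charts and ambient extensions act
  on the two blocks of coordinates separately.\<close>

lemma embedded_in_prod:
  assumes M: "embedded_in M N e" and M': "embedded_in M' N' e'"
  shows "embedded_in (prod_mfd M M') (N + N') (\<lambda>p. join N (e (fst p)) (e' (snd p)))"
proof -
  let ?X = "prod_topology (mtop M) (mtop M')" and ?e = "\<lambda>p. join N (e (fst p)) (e' (snd p))"
  note eE = embedded_inD(5)[OF M] and eE' = embedded_inD(5)[OF M']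
  have emb: "embedding_map ?X (Euclidean_space (N + N')) ?e"
  proof -
    obtain d where d: "continuous_map (subtopology (Euclidean_space N) (e ` topspace (mtop M))) (mtop M) d"
      "\<And>x. x \<in> topspace (mtop M) \<Longrightarrow> d (e x) = x"
      using embedding_mapE[OF embedded_inD(1)[OF M]] by metis
    obtain d' where d': "continuous_map (subtopology (Euclidean_space N') (e' ` topspace (mtop M'))) (mtop M') d'"
      "\<And>x. x \<in> topspace (mtop M') \<Longrightarrow> d' (e' x) = x"
      using embedding_mapE[OF embedded_inD(1)[OF M']] by metis
    show ?thesis
    proof (rule embedding_mapI[where d = "\<lambda>z. (d (block 0 N z), d' (block N N' z))"])
      show "continuous_map ?X (Euclidean_space (N + N')) ?e"
      proof (rule continuous_map_join)
        show "continuous_map ?X (Euclidean_space N) (\<lambda>p. e (fst p))"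
          using continuous_map_compose[OF continuous_map_fst embedded_inD(2)[OF M]] by (simp add: o_def)
        show "continuous_map ?X (Euclidean_space N') (\<lambda>p. e' (snd p))"
          using continuous_map_compose[OF continuous_map_snd embedded_inD(2)[OF M']] by (simp add: o_def)
      qed
      show "continuous_map (subtopology (Euclidean_space (N + N')) (?e ` topspace ?X)) ?X
          (\<lambda>z. (d (block 0 N z), d' (block N N' z)))"
        unfolding continuous_map_pairwise o_def fst_conv snd_conv
        by (intro conjI continuous_map_block_subtopology[OF d(1)] continuous_map_block_subtopology[OF d'(1)])
          (auto simp: block_join eE eE')
    qed (auto simp: block_join eE eE' d(2) d'(2))
  qed
  have chart: "adapted_chart (N + N') ?e ?X (mdim M + mdim M')
      (U \<times> V, \<lambda>p. join (mdim M) (\<phi> (fst p)) (\<psi> (snd p)))"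
    if U: "(U, \<phi>) \<in> atlas M" and V: "(V, \<psi>) \<in> atlas M'" for U \<phi> V \<psi>
  proof -
    let ?k = "mdim M" and ?l = "mdim M'"
    note aU = adapted_chartD[OF embedded_inD(3)[OF M U]] and aV = adapted_chartD[OF embedded_inD(3)[OF M' V]]
    note cU = is_chartD[OF aU(1)] and cV = is_chartD[OF aV(1)]
    have inv: "inv_into U \<phi> (\<phi> p) = p" if "p \<in> U" for p
      using cU(3) that by (rule inv_into_f_f)
    have inv': "inv_into V \<psi> (\<psi> p) = p" if "p \<in> V" for p
      using cV(3) that by (rule inv_into_f_f)
    have UM: "U \<subseteq> topspace (mtop M)" and VM: "V \<subseteq> topspace (mtop M')"
      using openin_subset cU(1) cV(1) by auto
    have \<phi>E: "\<phi> x \<in> Euc ?k" if "x \<in> U" for x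
      using openin_subset[OF cU(2)] that by auto
    have \<psi>E: "\<psi> x \<in> Euc ?l" if "x \<in> V" for x
      using openin_subset[OF cV(2)] that by auto
    \<comment> \<open>D is the image of the product chart, described through its blocks so that
      openness can be read off.\<close>
    define D where "D = {z \<in> Euc (?k + ?l). block 0 ?k z \<in> \<phi> ` U} \<inter> {z \<in> Euc (?k + ?l). block ?k ?l z \<in> \<psi> ` V}"
    have D: "openin (Euclidean_space (?k + ?l)) D"
      unfolding D_def by (intro openin_Int openin_block_preimage cU(2) cV(2))
    show ?thesis
    proof (rule adapted_chartI[OF emb _ D,
          where \<theta> = "\<lambda>z. (inv_into U \<phi> (block 0 ?k z), inv_into V \<psi> (block ?k ?l z))"])
      show "openin ?X (U \<times> V)"
        using cU(1) cV(1) by (simp add: openin_prod_Times_iff)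
      show "continuous_map (subtopology ?X (U \<times> V)) (Euclidean_space (?k + ?l))
          (\<lambda>p. join ?k (\<phi> (fst p)) (\<psi> (snd p)))"
        unfolding subtopology_Times
      proof (rule continuous_map_join)
        show "continuous_map (prod_topology (subtopology (mtop M) U) (subtopology (mtop M') V))
            (Euclidean_space ?k) (\<lambda>p. \<phi> (fst p))"
          using continuous_map_compose[OF continuous_map_fst cU(4)] by (simp add: o_def)
        show "continuous_map (prod_topology (subtopology (mtop M) U) (subtopology (mtop M') V))
            (Euclidean_space ?l) (\<lambda>p. \<psi> (snd p))"
          using continuous_map_compose[OF continuous_map_snd cV(4)] by (simp add: o_def)
      qed
      show "smooth_on (?k + ?l) (N + N') D (\<lambda>z. ?e (inv_into U \<phi> (block 0 ?k z), inv_into V \<psi> (block ?k ?l z)))"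
        unfolding fst_conv snd_conv
      proof (rule smooth_on_join)
        show "smooth_on (?k + ?l) N D (\<lambda>z. e (inv_into U \<phi> (block 0 ?k z)))"
          by (rule smooth_on_compose[OF D cU(2) _ smooth_on_block[OF D] aU(2)]) (auto simp: D_def)
        show "smooth_on (?k + ?l) N' D (\<lambda>z. e' (inv_into V \<psi> (block ?k ?l z)))"
          by (rule smooth_on_compose[OF D cV(2) _ smooth_on_block[OF D] aV(2)]) (auto simp: D_def)
      qed
      show "join ?k (\<phi> (fst p)) (\<psi> (snd p)) \<in> D" if "p \<in> U \<times> V" for p
        using that \<phi>E \<psi>E by (auto simp: D_def block_join join_Euc)
      show "(inv_into U \<phi> (block 0 ?k z), inv_into V \<psi> (block ?k ?l z)) \<in> U \<times> V" if "z \<in> D" for z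
        using that by (auto simp: D_def inv_into_into)
      show "(inv_into U \<phi> (block 0 ?k (join ?k (\<phi> (fst p)) (\<psi> (snd p)))),
          inv_into V \<psi> (block ?k ?l (join ?k (\<phi> (fst p)) (\<psi> (snd p))))) = p" if "p \<in> U \<times> V" for p
        using that by (auto simp: block_join \<phi>E \<psi>E inv inv')
      show "join ?k (\<phi> (fst (inv_into U \<phi> (block 0 ?k z), inv_into V \<psi> (block ?k ?l z))))
          (\<psi> (snd (inv_into U \<phi> (block 0 ?k z), inv_into V \<psi> (block ?k ?l z)))) = z" if "z \<in> D" for z
        using that by (auto simp: D_def f_inv_into_f join_block)
      fix p assume "p \<in> U \<times> V"
      then obtain x y where p: "p = (x, y)" "x \<in> U" "y \<in> V"
        by auto
      obtain W \<Phi> where W: "openin (Euclidean_space N) W" "e x \<in> W" "smooth_on N ?k W \<Phi>"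
        "\<And>q. q \<in> U \<Longrightarrow> e q \<in> W \<Longrightarrow> \<Phi> (e q) = \<phi> q"
        using aU(3)[OF p(2)] by metis
      obtain W' \<Psi> where W': "openin (Euclidean_space N') W'" "e' y \<in> W'" "smooth_on N' ?l W' \<Psi>"
        "\<And>q. q \<in> V \<Longrightarrow> e' q \<in> W' \<Longrightarrow> \<Psi> (e' q) = \<psi> q"
        using aV(3)[OF p(3)] by metis
      let ?W = "{z \<in> Euc (N + N'). block 0 N z \<in> W} \<inter> {z \<in> Euc (N + N'). block N N' z \<in> W'}"
      have oW: "openin (Euclidean_space (N + N')) ?W"
        by (intro openin_Int openin_block_preimage W(1) W'(1))
      show "\<exists>W \<Phi>. openin (Euclidean_space (N + N')) W \<and> ?e p \<in> W \<and> smooth_on (N + N') (?k + ?l) W \<Phi> \<and>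
          (\<forall>q\<in>U \<times> V. ?e q \<in> W \<longrightarrow> \<Phi> (?e q) = join ?k (\<phi> (fst q)) (\<psi> (snd q)))"
      proof (intro exI conjI)
        show "smooth_on (N + N') (?k + ?l) ?W (\<lambda>z. join ?k (\<Phi> (block 0 N z)) (\<Psi> (block N N' z)))"
        proof (rule smooth_on_join)
          show "smooth_on (N + N') ?k ?W (\<lambda>z. \<Phi> (block 0 N z))"
            by (rule smooth_on_compose[OF oW W(1) _ smooth_on_block[OF oW] W(3)]) auto
          show "smooth_on (N + N') ?l ?W (\<lambda>z. \<Psi> (block N N' z))"
            by (rule smooth_on_compose[OF oW W'(1) _ smooth_on_block[OF oW] W'(3)]) auto
        qed
        show "?e p \<in> ?W"
          using p W(2) W'(2) UM VM eE eE' by (auto simp: block_join join_Euc subset_iff)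
        show "\<forall>q\<in>U \<times> V. ?e q \<in> ?W \<longrightarrow>
            join ?k (\<Phi> (block 0 N (?e q))) (\<Psi> (block N N' (?e q))) = join ?k (\<phi> (fst q)) (\<psi> (snd q))"
          using W(4) W'(4) UM VM eE eE' by (auto simp: block_join subset_iff)
      qed (rule oW)
    qed
  qed
  show ?thesis
    unfolding embedded_in_def prod_mfd_simps
  proof (intro conjI emb ballI)
    show "adapted_chart (N + N') ?e ?X (mdim M + mdim M') C"
      if "C \<in> {(U \<times> V, \<lambda>p. join (mdim M) (\<phi> (fst p)) (\<psi> (snd p))) | U \<phi> V \<psi>.
        (U, \<phi>) \<in> atlas M \<and> (V, \<psi>) \<in> atlas M'}" for C
      using that chart by auto
    let ?A = "{(U \<times> V, \<lambda>p. join (mdim M) (\<phi> (fst p)) (\<psi> (snd p))) | U \<phi> V \<psi>.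
        (U, \<phi>) \<in> atlas M \<and> (V, \<psi>) \<in> atlas M'}"
    show "(\<Union>C\<in>?A. fst C) = topspace ?X"
    proof (intro equalityI subsetI)
      fix p assume "p \<in> (\<Union>C\<in>?A. fst C)"
      then obtain U \<phi> V \<psi> where "(U, \<phi>) \<in> atlas M" "(V, \<psi>) \<in> atlas M'" "p \<in> U \<times> V"
        by auto
      then show "p \<in> topspace ?X"
        using atlas_subset[OF M] atlas_subset[OF M'] by auto
    next
      fix p assume "p \<in> topspace ?X"
      then obtain U \<phi> V \<psi> where "(U, \<phi>) \<in> atlas M" "(V, \<psi>) \<in> atlas M'" "fst p \<in> U" "snd p \<in> V"
        using chart_at[OF M, of "fst p"] chart_at[OF M', of "snd p"] by auto
      then show "p \<in> (\<Union>C\<in>?A. fst C)"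
        by (intro UN_I[of "(U \<times> V, \<lambda>p. join (mdim M) (\<phi> (fst p)) (\<psi> (snd p)))"])
          (auto simp: mem_Times_iff)
    qed
  qed
qed

section \<open>Finite powers of a manifold\<close>

definition concat_blocks :: "nat \<Rightarrow> nat \<Rightarrow> (nat \<Rightarrow> nat \<Rightarrow> real) \<Rightarrow> nat \<Rightarrow> real"
  where "concat_blocks r k x = (\<lambda>j. if j < r * k then x (j div k) (j mod k) else 0)"

lemma concat_blocks_Euc: "concat_blocks r k x \<in> Euc (r * k)"
  by (simp add: concat_blocks_def Euc_iff)

lemma block_index:
  fixes i j k r :: nat
  assumes "i < r" and "j < k"
  shows "i * k + j < r * k"
proof -
  have "i * k + j < Suc i * k"
    using assms(2) by simp
  also have "\<dots> \<le> r * k"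
    using assms(1) by (intro mult_le_mono1) simp
  finally show ?thesis .
qed

lemma block_concat_blocks:
  assumes "i < r" and "x i \<in> Euc k"
  shows "block (i * k) k (concat_blocks r k x) = x i"
  using assms block_index[OF assms(1)] by (auto simp: block_def concat_blocks_def Euc_iff fun_eq_iff)

lemma concat_blocks_cong: "(\<And>i. i < r \<Longrightarrow> x i = y i) \<Longrightarrow> concat_blocks r k x = concat_blocks r k y"
  by (auto simp: concat_blocks_def fun_eq_iff less_mult_imp_div_less)

lemma concat_blocks_block:
  assumes "z \<in> Euc (r * k)"
  shows "concat_blocks r k (\<lambda>i. block (i * k) k z) = z"
proof
  fix j
  show "concat_blocks r k (\<lambda>i. block (i * k) k z) j = z j"
  proof (cases "j < r * k")
    case True
    then have "k > 0"
      by (cases k) auto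
    then show ?thesis
      using True by (simp add: concat_blocks_def block_def)
  qed (use assms in \<open>auto simp: concat_blocks_def Euc_iff\<close>)
qed

lemma smooth_on_concat_blocks:
  assumes "\<And>i. i < r \<Longrightarrow> smooth_on n k U (F i)"
  shows "smooth_on n (r * k) U (\<lambda>z. concat_blocks r k (\<lambda>i. F i z))"
  unfolding smooth_on_def
proof (intro allI impI)
  fix j s assume j: "j < r * k"
  then have "j div k < r" "j mod k < k"
    by (auto simp: less_mult_imp_div_less intro!: mod_less_divisor gr0I)
  then show "Ck_on s n U (\<lambda>z. concat_blocks r k (\<lambda>i. F i z) j)"
    using smooth_onD[OF assms] j by (simp add: concat_blocks_def)
qed

lemma continuous_map_concat_blocks:
  assumes "\<And>i. i < r \<Longrightarrow> continuous_map X (Euclidean_space k) (f i)"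
  shows "continuous_map X (Euclidean_space (r * k)) (\<lambda>x. concat_blocks r k (\<lambda>i. f i x))"
proof (rule continuous_map_into_Euc)
  fix j assume "j < r * k"
  then show "continuous_map X euclideanreal (\<lambda>x. concat_blocks r k (\<lambda>i. f i x) j)"
    using continuous_map_Euc_component[OF assms] by (simp add: concat_blocks_def less_mult_imp_div_less)
qed (rule concat_blocks_Euc)

lemma power_mfd_simps:
  "mtop (power_mfd r M) = product_topology (\<lambda>_. mtop M) {..<r}"
  "mdim (power_mfd r M) = r * mdim M"
  "atlas (power_mfd r M) = {(PiE {..<r} U, \<lambda>x. concat_blocks r (mdim M) (\<lambda>i. \<phi> i (x i))) | U \<phi>.
      \<forall>i<r. (U i, \<phi> i) \<in> atlas M}"
  by (simp_all add: power_mfd_def concat_blocks_def)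

lemma openin_all_block_preimage:
  assumes "\<And>i. i < r \<Longrightarrow> openin (Euclidean_space k) (A i)"
  shows "openin (Euclidean_space n) {z \<in> Euc n. \<forall>i<r. block (i * k) k z \<in> A i}"
proof -
  have "openin (Euclidean_space n) ((\<Inter>i\<in>{..<r}. {z \<in> Euc n. block (i * k) k z \<in> A i}) \<inter> Euc n)"
    by (rule openin_INT) (use assms openin_block_preimage in auto)
  also have "(\<Inter>i\<in>{..<r}. {z \<in> Euc n. block (i * k) k z \<in> A i}) \<inter> Euc n =
      {z \<in> Euc n. \<forall>i<r. block (i * k) k z \<in> A i}"
    by auto
  finally show ?thesis .
qed

lemma embedded_in_power:
  assumes M: "embedded_in M N e"
  shows "embedded_in (power_mfd r M) (r * N) (\<lambda>x. concat_blocks r N (\<lambda>i. e (x i)))"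
proof -
  let ?X = "product_topology (\<lambda>_. mtop M) {..<r}" and ?e = "\<lambda>x. concat_blocks r N (\<lambda>i. e (x i))"
  note eE = embedded_inD(5)[OF M]
  have proj: "continuous_map ?X (mtop M) (\<lambda>x. x i)" if "i < r" for i
    using continuous_map_product_projection[of i "{..<r}" "\<lambda>_. mtop M"] that by simp
  have emb: "embedding_map ?X (Euclidean_space (r * N)) ?e"
  proof -
    obtain d where d: "continuous_map (subtopology (Euclidean_space N) (e ` topspace (mtop M))) (mtop M) d"
      "\<And>x. x \<in> topspace (mtop M) \<Longrightarrow> d (e x) = x"
      using embedding_mapE[OF embedded_inD(1)[OF M]] by metis
    show ?thesis
    proof (rule embedding_mapI[where d = "\<lambda>z. \<lambda>i\<in>{..<r}. d (block (i * N) N z)"])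
      show "continuous_map ?X (Euclidean_space (r * N)) ?e"
        using continuous_map_compose[OF proj embedded_inD(2)[OF M]]
        by (intro continuous_map_concat_blocks) (simp add: o_def)
      show "continuous_map (subtopology (Euclidean_space (r * N)) (?e ` topspace ?X)) ?X
          (\<lambda>z. \<lambda>i\<in>{..<r}. d (block (i * N) N z))"
        unfolding continuous_map_componentwise
      proof (intro conjI ballI)
        fix i assume i: "i \<in> {..<r}"
        have "continuous_map (subtopology (Euclidean_space (r * N)) (?e ` topspace ?X)) (mtop M)
            (\<lambda>z. d (block (i * N) N z))"
          by (rule continuous_map_block_subtopology[OF d(1)])
            (use i eE in \<open>auto simp: block_concat_blocks PiE_iff\<close>)
        then show "continuous_map (subtopology (Euclidean_space (r * N)) (?e ` topspace ?X)) (mtop M)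
            (\<lambda>z. (\<lambda>i\<in>{..<r}. d (block (i * N) N z)) i)"
          using i by simp
      qed auto
      show "(\<lambda>i\<in>{..<r}. d (block (i * N) N (?e x))) = x" if "x \<in> topspace ?X" for x
        using that eE d(2) by (auto simp: block_concat_blocks PiE_iff extensional_def fun_eq_iff)
    qed
  qed
  have chart: "adapted_chart (r * N) ?e ?X (r * mdim M)
      (PiE {..<r} U, \<lambda>x. concat_blocks r (mdim M) (\<lambda>i. \<phi> i (x i)))"
    if U: "\<And>i. i < r \<Longrightarrow> (U i, \<phi> i) \<in> atlas M" for U \<phi>
  proof -
    let ?k = "mdim M" and ?\<phi> = "\<lambda>x. concat_blocks r (mdim M) (\<lambda>i. \<phi> i (x i))"
    note aU = adapted_chartD[OF embedded_inD(3)[OF M U]]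
    note cU = is_chartD[OF aU(1)]
    have inv: "inv_into (U i) (\<phi> i) (\<phi> i p) = p" if "i < r" "p \<in> U i" for i p
      using cU(3)[OF that(1)] that(2) by (rule inv_into_f_f)
    have UM: "x \<in> topspace (mtop M)" if "i < r" "x \<in> U i" for i x
      using openin_subset[OF cU(1)[OF that(1)]] that(2) by blast
    have \<phi>E: "\<phi> i x \<in> Euc ?k" if "i < r" "x \<in> U i" for i x
      using openin_subset[OF cU(2)[OF that(1)]] that(2) by auto
    define D where "D = {z \<in> Euc (r * ?k). \<forall>i<r. block (i * ?k) ?k z \<in> \<phi> i ` U i}"
    \<comment> \<open>The restriction to indices below r puts the family into the extensional
      product underlying \<open>product_topology\<close>.\<close>
    define \<theta> where "\<theta> = (\<lambda>z. \<lambda>i\<in>{..<r}. inv_into (U i) (\<phi> i) (block (i * ?k) ?k z))"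
    have D: "openin (Euclidean_space (r * ?k)) D"
      unfolding D_def by (rule openin_all_block_preimage) (rule cU(2))
    have \<theta>U: "\<theta> z i \<in> U i" if "z \<in> D" "i < r" for z i
      using that by (auto simp: D_def \<theta>_def intro!: inv_into_into)
    have e\<theta>: "?e (\<theta> z) = concat_blocks r N (\<lambda>i. e (inv_into (U i) (\<phi> i) (block (i * ?k) ?k z)))" for z
      by (rule concat_blocks_cong) (simp add: \<theta>_def)
    show ?thesis
    proof (rule adapted_chartI[OF emb _ D, where \<theta> = \<theta>])
      show "openin ?X (PiE {..<r} U)"
        using cU(1) by (simp add: openin_PiE)
      show "continuous_map (subtopology ?X (PiE {..<r} U)) (Euclidean_space (r * ?k)) ?\<phi>"
      proof (rule continuous_map_concat_blocks)
        fix i assume i: "i < r"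
        have "continuous_map (subtopology ?X (PiE {..<r} U)) (subtopology (mtop M) (U i)) (\<lambda>x. x i)"
          using continuous_map_from_subtopology[OF proj[OF i]] i
          by (auto simp: continuous_map_in_subtopology PiE_iff)
        from continuous_map_compose[OF this cU(4)[OF i]]
        show "continuous_map (subtopology ?X (PiE {..<r} U)) (Euclidean_space ?k) (\<lambda>x. \<phi> i (x i))"
          by (simp add: o_def)
      qed
      show "smooth_on (r * ?k) (r * N) D (\<lambda>z. ?e (\<theta> z))"
        unfolding e\<theta>
      proof (rule smooth_on_concat_blocks)
        fix i assume i: "i < r"
        show "smooth_on (r * ?k) N D (\<lambda>z. e (inv_into (U i) (\<phi> i) (block (i * ?k) ?k z)))"
          by (rule smooth_on_compose[OF D cU(2)[OF i] _ smooth_on_block[OF D] aU(2)[OF i]])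
            (use i in \<open>auto simp: D_def\<close>)
      qed
      show "?\<phi> x \<in> D" if "x \<in> PiE {..<r} U" for x
        using that \<phi>E by (auto simp: D_def concat_blocks_Euc block_concat_blocks PiE_iff)
      show "\<theta> z \<in> PiE {..<r} U" if "z \<in> D" for z
        using \<theta>U[OF that] by (auto simp: PiE_iff \<theta>_def)
      show "\<theta> (?\<phi> x) = x" if "x \<in> PiE {..<r} U" for x
        using that \<phi>E inv by (auto simp: \<theta>_def block_concat_blocks PiE_iff extensional_def fun_eq_iff)
      show "?\<phi> (\<theta> z) = z" if "z \<in> D" for z
      proof -
        have "?\<phi> (\<theta> z) = concat_blocks r ?k (\<lambda>i. block (i * ?k) ?k z)"
          by (rule concat_blocks_cong) (use that in \<open>auto simp: D_def \<theta>_def f_inv_into_f\<close>)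
        then show ?thesis
          using that by (simp add: D_def concat_blocks_block)
      qed
      fix p assume p: "p \<in> PiE {..<r} U"
      \<comment> \<open>Abbreviating the whole condition lets W and \<Phi> be chosen for all factors
        simultaneously.\<close>
      define ext where "ext i W \<Phi> \<longleftrightarrow> openin (Euclidean_space N) W \<and> e (p i) \<in> W \<and> smooth_on N ?k W \<Phi> \<and>
          (\<forall>q\<in>U i. e q \<in> W \<longrightarrow> \<Phi> (e q) = \<phi> i q)" for i W \<Phi>
      have "\<exists>W \<Phi>. ext i W \<Phi>" if "i < r" for i
        unfolding ext_def by (rule aU(3)[OF that]) (use p that in auto)
      then obtain W \<Phi> where "\<And>i. i < r \<Longrightarrow> ext i (W i) (\<Phi> i)"
        by metis
      then have W: "\<And>i. i < r \<Longrightarrow> openin (Euclidean_space N) (W i)"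
        "\<And>i. i < r \<Longrightarrow> e (p i) \<in> W i" "\<And>i. i < r \<Longrightarrow> smooth_on N ?k (W i) (\<Phi> i)"
        "\<And>i q. i < r \<Longrightarrow> q \<in> U i \<Longrightarrow> e q \<in> W i \<Longrightarrow> \<Phi> i (e q) = \<phi> i q"
        by (simp_all add: ext_def)
      let ?W = "{z \<in> Euc (r * N). \<forall>i<r. block (i * N) N z \<in> W i}"
      have oW: "openin (Euclidean_space (r * N)) ?W"
        by (rule openin_all_block_preimage) (rule W(1))
      have block_e: "block (i * N) N (?e q) = e (q i)" if "q \<in> PiE {..<r} U" "i < r" for q i
        using that UM eE by (auto simp: block_concat_blocks PiE_iff)
      show "\<exists>W \<Phi>. openin (Euclidean_space (r * N)) W \<and> ?e p \<in> W \<and> smooth_on (r * N) (r * ?k) W \<Phi> \<and>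
          (\<forall>q\<in>PiE {..<r} U. ?e q \<in> W \<longrightarrow> \<Phi> (?e q) = ?\<phi> q)"
      proof (intro exI conjI)
        show "smooth_on (r * N) (r * ?k) ?W (\<lambda>z. concat_blocks r ?k (\<lambda>i. \<Phi> i (block (i * N) N z)))"
        proof (rule smooth_on_concat_blocks)
          fix i assume i: "i < r"
          show "smooth_on (r * N) ?k ?W (\<lambda>z. \<Phi> i (block (i * N) N z))"
            by (rule smooth_on_compose[OF oW W(1)[OF i] _ smooth_on_block[OF oW] W(3)[OF i]]) (use i in auto)
        qed
        show "?e p \<in> ?W"
          using W(2) block_e[OF p] by (simp add: concat_blocks_Euc)
        show "\<forall>q\<in>PiE {..<r} U. ?e q \<in> ?W \<longrightarrow>
            concat_blocks r ?k (\<lambda>i. \<Phi> i (block (i * N) N (?e q))) = ?\<phi> q"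
        proof (intro ballI impI concat_blocks_cong)
          fix q i assume q: "q \<in> PiE {..<r} U" "?e q \<in> ?W" and i: "i < r"
          then have "q i \<in> U i" "e (q i) \<in> W i"
            using block_e[OF q(1) i] by (auto simp: PiE_iff)
          then show "\<Phi> i (block (i * N) N (?e q)) = \<phi> i (q i)"
            using W(4)[OF i] block_e[OF q(1) i] by simp
        qed
      qed (rule oW)
    qed
  qed
  show ?thesis
    unfolding embedded_in_def power_mfd_simps
  proof (intro conjI emb ballI)
    let ?A = "{(PiE {..<r} U, \<lambda>x. concat_blocks r (mdim M) (\<lambda>i. \<phi> i (x i))) | U \<phi>.
      \<forall>i<r. (U i, \<phi> i) \<in> atlas M}"
    show "adapted_chart (r * N) ?e ?X (r * mdim M) C" if C: "C \<in> ?A" for C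
      using C chart by auto
    show "(\<Union>C\<in>?A. fst C) = topspace ?X"
    proof (intro equalityI subsetI)
      fix x assume "x \<in> (\<Union>C\<in>?A. fst C)"
      then obtain U \<phi> where U: "\<And>i. i < r \<Longrightarrow> (U i, \<phi> i) \<in> atlas M" "x \<in> PiE {..<r} U"
        by auto
      then show "x \<in> topspace ?X"
        using atlas_subset[OF M U(1)] by (auto simp: PiE_iff)
    next
      fix x assume x: "x \<in> topspace ?X"
      then have "\<exists>U \<phi>. (U, \<phi>) \<in> atlas M \<and> x i \<in> U" if "i < r" for i
        using that by (intro chart_at[OF M]) (auto simp: PiE_iff)
      then obtain U \<phi> where U: "\<And>i. i < r \<Longrightarrow> (U i, \<phi> i) \<in> atlas M" "\<And>i. i < r \<Longrightarrow> x i \<in> U i"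
        by metis
      then show "x \<in> (\<Union>C\<in>?A. fst C)"
        using x by (intro UN_I[of "(PiE {..<r} U, \<lambda>x. concat_blocks r (mdim M) (\<lambda>i. \<phi> i (x i)))"])
          (auto simp: PiE_iff)
    qed
  qed
qed

section \<open>Spheres and stereographic projection\<close>

lemma Ck_on_divide:
  assumes "openin (Euclidean_space k) U" and "Ck_on r k U f" and "Ck_on r k U g" and "\<And>x. x \<in> U \<Longrightarrow> g x \<noteq> 0"
  shows "Ck_on r k U (\<lambda>x. f x / g x)"
  unfolding divide_inverse by (intro Ck_on_mult Ck_on_inverse assms)

text \<open>For s = 1 or s = -1 this is stereographic projection from the pole with last coordinate
  s.\<close>

definition stereo :: "nat \<Rightarrow> real \<Rightarrow> (nat \<Rightarrow> real) \<Rightarrow> nat \<Rightarrow> real"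
  where "stereo n s x = (\<lambda>j. if j < n then x j / (1 - s * x n) else 0)"

text \<open>The second point in which the line through the pole and the point y of the equatorial
  hyperplane meets the sphere; q is the squared norm of y.\<close>

definition stereo_inv :: "nat \<Rightarrow> real \<Rightarrow> (nat \<Rightarrow> real) \<Rightarrow> nat \<Rightarrow> real"
  where "stereo_inv n s y = (let q = (\<Sum>i<n. (y i)\<^sup>2) in
    (\<lambda>j. if j < n then 2 * y j / (q + 1) else if j = n then s * (q - 1) / (q + 1) else 0))"

lemma topspace_nsphere:
  "topspace (nsphere n) = {x \<in> Euc (Suc n). (\<Sum>i<n. (x i)\<^sup>2) + (x n)\<^sup>2 = 1}"
  by (auto simp: nsphere_def simp flip: lessThan_Suc_atMost)

text \<open>On the sphere the first n coordinates have squared norm (1 - s x_n)(1 + s x_n), so the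
  projected point has squared norm (1 + s x_n) / (1 - s x_n). This determines x_n and hence the
  other coordinates.\<close>

lemma stereo_inv_stereo:
  assumes s: "s * s = 1" and x: "x \<in> topspace (nsphere n)" "s * x n \<noteq> 1"
  shows "stereo_inv n s (stereo n s x) = x"
proof -
  have ss: "s * (s * t) = t" for t
    using s by (simp flip: mult.assoc)
  have "(1 - s * x n) * (1 + s * x n) = 1 - (x n)\<^sup>2"
    by (simp add: algebra_simps ss power2_eq_square)
  then have sum: "(\<Sum>i<n. (x i)\<^sup>2) = (1 - s * x n) * (1 + s * x n)"
    using x(1) by (simp add: topspace_nsphere)
  have q: "(\<Sum>i<n. (stereo n s x i)\<^sup>2) = (1 + s * x n) / (1 - s * x n)"
  proof -
    have "(\<Sum>i<n. (stereo n s x i)\<^sup>2) = (\<Sum>i<n. (x i)\<^sup>2) / (1 - s * x n)\<^sup>2"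
      by (simp add: stereo_def power_divide sum_divide_distrib)
    also have "\<dots> = ((1 - s * x n) * (1 + s * x n)) / ((1 - s * x n) * (1 - s * x n))"
      by (simp only: sum power2_eq_square[of "1 - s * x n"])
    finally show ?thesis
      using x(2) by simp
  qed
  have q1: "(1 + s * x n) / (1 - s * x n) + 1 = 2 / (1 - s * x n)"
    using x(2) by (simp add: field_simps)
  have q2: "(1 + s * x n) / (1 - s * x n) - 1 = 2 * (s * x n) / (1 - s * x n)"
    using x(2) by (simp add: field_simps)
  show ?thesis
  proof
    fix j
    consider "j < n" | "j = n" | "j > n"
      by linarith
    then show "stereo_inv n s (stereo n s x) j = x j"
    proof cases
      case 1
      then show ?thesis
        using x(2) by (simp add: stereo_inv_def Let_def q q1) (simp add: stereo_def)
    next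
      case 2
      then show ?thesis
        using x(2) s by (simp add: stereo_inv_def Let_def q q1 q2)
    next
      case 3
      then show ?thesis
        using x(1) by (simp add: stereo_inv_def Let_def topspace_nsphere Euc_iff)
    qed
  qed
qed

lemma stereo_inv_in_sphere:
  assumes s: "s * s = 1" and y: "y \<in> Euc n"
  shows "stereo_inv n s y \<in> topspace (nsphere n)" and "s * stereo_inv n s y n \<noteq> 1"
    and "stereo n s (stereo_inv n s y) = y"
proof -
  define q where "q = (\<Sum>i<n. (y i)\<^sup>2)"
  have q: "q + 1 > 0" "q + 1 \<noteq> 0"
    using sum_nonneg[of "{..<n}" "\<lambda>i. (y i)\<^sup>2"] by (auto simp: q_def add_nonneg_pos)
  have last: "stereo_inv n s y n = s * (q - 1) / (q + 1)"
    by (simp add: stereo_inv_def q_def Let_def)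
  have last1: "1 - s * stereo_inv n s y n = 2 / (q + 1)"
  proof -
    have "s * stereo_inv n s y n = (q - 1) / (q + 1)"
      using s by (simp add: last flip: mult.assoc)
    then show ?thesis
      using q by (simp add: field_simps)
  qed
  have "(\<Sum>i<n. (stereo_inv n s y i)\<^sup>2) = 4 * q / (q + 1)\<^sup>2"
    by (simp add: stereo_inv_def Let_def power_divide power_mult_distrib q_def[symmetric] sum_divide_distrib[symmetric] sum_distrib_left[symmetric])
  moreover have "(stereo_inv n s y n)\<^sup>2 = (q - 1)\<^sup>2 / (q + 1)\<^sup>2"
    using s by (simp add: last power_divide power_mult_distrib power2_eq_square[of s])
  \<comment> \<open>This is the identity 4q + (q - 1)^2 = (q + 1)^2.\<close>
  moreover have "4 * q / (q + 1)\<^sup>2 + (q - 1)\<^sup>2 / (q + 1)\<^sup>2 = 1"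
    using q by (simp add: field_simps) (simp add: power2_eq_square algebra_simps)
  ultimately show "stereo_inv n s y \<in> topspace (nsphere n)"
    by (auto simp: topspace_nsphere Euc_iff) (simp add: stereo_inv_def Let_def)
  show "s * stereo_inv n s y n \<noteq> 1"
    using last1 q by auto
  show "stereo n s (stereo_inv n s y) = y"
  proof
    fix j
    show "stereo n s (stereo_inv n s y) j = y j"
    proof (cases "j < n")
      case True
      then have "stereo_inv n s y j = 2 * y j / (q + 1)"
        by (simp add: stereo_inv_def Let_def q_def)
      then show ?thesis
        using True q by (simp add: stereo_def last1)
    next
      case False
      then show ?thesis
        using y by (simp add: stereo_def Euc_iff)
    qed
  qed
qed

lemma sphere_mfd_simps:
  "mtop (sphere_mfd n) = nsphere n" "mdim (sphere_mfd n) = n"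
  "atlas (sphere_mfd n) = Collect (adapted_chart (Suc n) id (nsphere n) n)"
  by (simp_all add: sphere_mfd_def)

text \<open>The projections from the two poles cover the sphere, since no point is both poles. The
  formula of \<open>stereo\<close> is its own ambient extension, smooth off the hyperplane s z_n =
  1.\<close>

lemma embedded_in_sphere: "embedded_in (sphere_mfd n) (Suc n) id"
proof -
  have emb: "embedding_map (nsphere n) (Euclidean_space (Suc n)) id"
    by (rule embedding_mapI[where d = id]) (auto simp: nsphere_def topspace_subtopology continuous_map_in_subtopology intro!: continuous_map_from_subtopology)
  have chart: "adapted_chart (Suc n) id (nsphere n) n ({x \<in> topspace (nsphere n). s * x n \<noteq> 1}, stereo n s)"
    if s: "s * s = 1" for s
  proof -
    define W where "W = {z \<in> Euc (Suc n). s * z n \<in> - {1}}"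
    have W: "openin (Euclidean_space (Suc n)) W"
      unfolding W_def
    proof (rule openin_continuous_map_preimage)
      show "continuous_map (Euclidean_space (Suc n)) euclideanreal (\<lambda>z. s * z n)"
        using continuous_map_Euc_component[OF continuous_map_id]
        by (intro continuous_map_real_mult) (auto simp: id_def)
    qed auto
    have smW: "smooth_on (Suc n) n W (stereo n s)"
      unfolding smooth_on_def
    proof (intro allI impI)
      fix j r assume j: "j < n"
      have "Ck_on r (Suc n) W (\<lambda>z. z j / (1 + (- s) * z n))"
        by (intro Ck_on_divide Ck_on_add Ck_on_mult Ck_on_const Ck_on_coord W) (auto simp: W_def)
      then show "Ck_on r (Suc n) W (\<lambda>z. stereo n s z j)"
        using j by (simp add: stereo_def)
    qed
    have stereoE: "stereo n s z \<in> Euc n" for z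
      by (simp add: stereo_def Euc_iff)
    have U: "{x \<in> topspace (nsphere n). s * x n \<noteq> 1} = topspace (nsphere n) \<inter> W"
      by (auto simp: W_def topspace_nsphere)
    have top: "nsphere n = subtopology (Euclidean_space (Suc n)) (topspace (nsphere n))"
      by (metis nsphere_def subtopology_restrict topspace_subtopology)
    show ?thesis
    proof (rule adapted_chartI[OF emb _ openin_Euc, where \<theta> = "stereo_inv n s"])
      show "openin (nsphere n) {x \<in> topspace (nsphere n). s * x n \<noteq> 1}"
        unfolding U by (subst top) (use W in \<open>auto simp: openin_subtopology\<close>)
      show "continuous_map (subtopology (nsphere n) {x \<in> topspace (nsphere n). s * x n \<noteq> 1}) (Euclidean_space n) (stereo n s)"
        unfolding U
        by (subst top, unfold subtopology_subtopology,
            rule continuous_map_from_subtopology_mono[OF smooth_on_imp_continuous_map[OF openin_subset[OF W] _ smW]])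
          (use stereoE in auto)
      show "smooth_on n (Suc n) (Euc n) (\<lambda>y. id (stereo_inv n s y))"
        unfolding smooth_on_def
      proof (intro allI impI)
        fix j r assume j: "j < Suc n"
        have q: "Ck_on r n (Euc n) (\<lambda>y. (\<Sum>i<n. y i * y i) + c)" for c
          by (intro Ck_on_add Ck_on_sum Ck_on_mult Ck_on_coord Ck_on_const openin_Euc)
        have nz: "(\<Sum>i<n. y i * y i) + 1 \<noteq> 0" for y :: "nat \<Rightarrow> real"
          using sum_nonneg[of "{..<n}" "\<lambda>i. y i * y i"] by force
        show "Ck_on r n (Euc n) (\<lambda>y. id (stereo_inv n s y) j)"
        proof (cases "j < n")
          case True
          have "Ck_on r n (Euc n) (\<lambda>y. 2 * y j / ((\<Sum>i<n. y i * y i) + 1))"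
            by (intro Ck_on_divide Ck_on_mult Ck_on_coord Ck_on_const openin_Euc q nz)
          then show ?thesis
            using True by (simp add: stereo_inv_def Let_def power2_eq_square)
        next
          case False
          have "Ck_on r n (Euc n) (\<lambda>y. s * ((\<Sum>i<n. y i * y i) + (- 1)) / ((\<Sum>i<n. y i * y i) + 1))"
            by (intro Ck_on_divide Ck_on_mult Ck_on_const openin_Euc q nz)
          then show ?thesis
            using False j by (simp add: stereo_inv_def Let_def power2_eq_square)
        qed
      qed
      show "\<exists>W \<Phi>. openin (Euclidean_space (Suc n)) W \<and> id p \<in> W \<and> smooth_on (Suc n) n W \<Phi> \<and>
          (\<forall>q\<in>{x \<in> topspace (nsphere n). s * x n \<noteq> 1}. id q \<in> W \<longrightarrow> \<Phi> (id q) = stereo n s q)"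
        if "p \<in> {x \<in> topspace (nsphere n). s * x n \<noteq> 1}" for p
        using that W smW unfolding U by (intro exI[of _ W] exI[of _ "stereo n s"]) auto
    qed (use stereo_inv_in_sphere[OF s] stereo_inv_stereo[OF s] stereoE in auto)
  qed
  show ?thesis
    unfolding embedded_in_def sphere_mfd_simps
  proof (intro conjI emb ballI)
    show "(\<Union>C\<in>Collect (adapted_chart (Suc n) id (nsphere n) n). fst C) = topspace (nsphere n)"
    proof (intro equalityI subsetI)
      fix x assume "x \<in> (\<Union>C\<in>Collect (adapted_chart (Suc n) id (nsphere n) n). fst C)"
      then obtain U \<phi> where "adapted_chart (Suc n) id (nsphere n) n (U, \<phi>)" "x \<in> U"
        by auto
      then show "x \<in> topspace (nsphere n)"
        using openin_subset[OF is_chartD(1)[OF adapted_chartD(1)]] by blast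
    next
      fix x assume x: "x \<in> topspace (nsphere n)"
      obtain s :: real where s: "s * s = 1" "s * x n \<noteq> 1"
      proof (cases "x n = 1")
        case True
        then show ?thesis
          using that[of "-1"] by simp
      next
        case False
        then show ?thesis
          using that[of 1] by simp
      qed
      then show "x \<in> (\<Union>C\<in>Collect (adapted_chart (Suc n) id (nsphere n) n). fst C)"
        using chart[OF s(1)] x
        by (intro UN_I[of "({x \<in> topspace (nsphere n). s * x n \<noteq> 1}, stereo n s)"]) auto
    qed
  qed simp
qed

section \<open>Quaternions\<close>

fun qconj :: "quat \<Rightarrow> quat"
  where "qconj (a, b, c, d) = (a, - b, - c, - d)"

lemma norm_qconj [simp]: "norm (qconj q) = norm q"
  by (cases q) (simp add: norm_quat)

lemma qmult_one [simp]: "(1, 0, 0, 0) \<star> q = q"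
  by (cases q) simp

lemma qmult_zero [simp]: "q \<star> 0 = 0"
  by (cases q) (simp add: zero_prod_def)

lemma qmult_scaleR: "p \<star> (t *\<^sub>R q) = t *\<^sub>R (p \<star> q)" "(t *\<^sub>R p) \<star> q = t *\<^sub>R (p \<star> q)"
  by (cases p; cases q; simp add: algebra_simps)+

lemma qconj_qmult: "qconj (p \<star> q) = qconj q \<star> qconj p"
  by (cases p; cases q) (simp add: algebra_simps)

lemma qconj_unit:
  assumes "norm a = 1"
  shows "qconj a \<star> a = (1, 0, 0, 0)" and "a \<star> qconj a = (1, 0, 0, 0)"
proof -
  obtain x y z w where a: "a = (x, y, z, w)"
    by (cases a)
  have "x\<^sup>2 + y\<^sup>2 + z\<^sup>2 + w\<^sup>2 = 1"
    using assms by (simp add: a norm_quat)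
  then show "qconj a \<star> a = (1, 0, 0, 0)" "a \<star> qconj a = (1, 0, 0, 0)"
    by (simp_all add: a power2_eq_square algebra_simps)
qed

lemma qconj_cancel:
  assumes "norm a = 1"
  shows "qconj a \<star> (a \<star> q) = q" and "a \<star> (qconj a \<star> q) = q"
  using qconj_unit[OF assms] by (simp_all flip: qmult_assoc)

lemma qcomp_cases:
  "qcomp q 0 = fst q" "qcomp q (Suc 0) = fst (snd q)" "qcomp q 2 = fst (snd (snd q))"
  "qcomp q 3 = snd (snd (snd q))"
  by (cases q; simp add: numeral_2_eq_2 numeral_3_eq_3)+

lemma less_4_cases: "(l::nat) < 4 \<Longrightarrow> l = 0 \<or> l = Suc 0 \<or> l = 2 \<or> l = 3"
  by linarith

lemma qcomp_scaleR: "l < 4 \<Longrightarrow> qcomp (t *\<^sub>R q) l = t * qcomp q l"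
  by (drule less_4_cases) (auto simp: qcomp_cases)

lemma qcomp_zero: "l < 4 \<Longrightarrow> qcomp 0 l = 0"
  by (drule less_4_cases) (auto simp: qcomp_cases)

lemma norm_quat_qcomp: "(norm q)\<^sup>2 = (\<Sum>l<4. (qcomp q l)\<^sup>2)"
  by (cases q) (simp add: norm_quat numeral_eq_Suc)

text \<open>Right multiplication by a permutes the unit quaternions, with right multiplication by
  \<open>qconj a\<close> as inverse.\<close>

lemma Sp1_orbit_qmult:
  assumes "a \<in> Sp1"
  shows "Sp1_orbit (\<lambda>i. a \<star> q i) = Sp1_orbit q"
proof -
  have a: "norm a = 1"
    using assms by (simp add: Sp1_def)
  have "\<exists>c\<in>Sp1. (\<lambda>i. b \<star> (a \<star> q i)) = (\<lambda>i. c \<star> q i)" if "b \<in> Sp1" for b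
    using that a by (intro bexI[of _ "b \<star> a"]) (auto simp: qmult_assoc Sp1_def norm_qmult)
  moreover have "\<exists>c\<in>Sp1. (\<lambda>i. b \<star> q i) = (\<lambda>i. c \<star> (a \<star> q i))" if "b \<in> Sp1" for b
    using that a by (intro bexI[of _ "b \<star> qconj a"]) (auto simp: qmult_assoc Sp1_def norm_qmult qconj_cancel)
  ultimately show ?thesis
    unfolding Sp1_orbit_def by blast
qed

lemma self_in_Sp1_orbit: "q \<in> Sp1_orbit q"
  unfolding Sp1_orbit_def Sp1_def
  by (rule CollectI, intro exI[of _ "(1, 0, 0, 0)"]) (simp add: norm_quat)

section \<open>Quaternionic sequences as real sequences\<close>

text \<open>The inverse of \<open>qcoord\<close>.\<close>

definition qseq :: "(nat \<Rightarrow> real) \<Rightarrow> nat \<Rightarrow> quat"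
  where "qseq z i = (z (4 * i), z (4 * i + 1), z (4 * i + 2), z (4 * i + 3))"

lemma qcomp_qseq: "l < 4 \<Longrightarrow> qcomp (qseq z i) l = z (4 * i + l)"
  by (drule less_4_cases) (auto simp: qcomp_cases qseq_def)

lemma qcoord_qseq [simp]: "qcoord (qseq z) = z"
  by (auto simp: qcoord_def qcomp_qseq fun_eq_iff)

lemma qcoord_index: "l < 4 \<Longrightarrow> qcoord u (4 * i + l) = qcomp (u i) l"
  by (simp add: qcoord_def)

lemma qseq_qcoord [simp]: "qseq (qcoord u) = u"
proof
  fix i
  show "qseq (qcoord u) i = u i"
    using qcoord_index[of 0 u i] qcoord_index[of 1 u i] qcoord_index[of 2 u i] qcoord_index[of 3 u i]
    by (simp add: qseq_def qcomp_cases)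
qed

lemma qcoord_Euc:
  assumes "u \<in> Hn n"
  shows "qcoord u \<in> Euc (4 * n)"
  unfolding Euc_iff
proof (intro allI impI)
  fix j assume "4 * n \<le> j"
  then have "n \<le> j div 4"
    by linarith
  then show "qcoord u j = 0"
    using assms by (simp add: Hn_def qcoord_def qcomp_zero)
qed

lemma qseq_Hn: "z \<in> Euc (4 * n) \<Longrightarrow> qseq z \<in> Hn n"
  by (auto simp: Hn_def Euc_iff qseq_def zero_prod_def)

lemma qcoord_scaleR: "qcoord (\<lambda>i. t *\<^sub>R u i) = (\<lambda>j. t * qcoord u j)"
  by (auto simp: qcoord_def qcomp_scaleR)

lemma sum_lessThan_add:
  fixes f :: "nat \<Rightarrow> 'a::comm_monoid_add"
  shows "(\<Sum>i<m + k. f i) = (\<Sum>i<m. f i) + (\<Sum>j<k. f (m + j))"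
  by (induction k) (simp_all add: add.assoc)

lemma sum_qcoord_squares: "(\<Sum>j<4 * n. (qcoord u j)\<^sup>2) = (\<Sum>i<n. (norm (u i))\<^sup>2)"
proof (induction n)
  case (Suc n)
  have "4 * Suc n = 4 * n + 4"
    by simp
  moreover have "(\<Sum>l<4. (qcoord u (4 * n + l))\<^sup>2) = (norm (u n))\<^sup>2"
    unfolding norm_quat_qcomp by (intro sum.cong refl) (simp add: qcoord_index)
  ultimately show ?case
    by (simp only: sum_lessThan_add sum.lessThan_Suc Suc.IH)
qed simp

lemma continuous_on_qcoord: "continuous_on S (\<lambda>q. qcoord q j)"
proof -
  have coord: "continuous_on S (\<lambda>q::nat \<Rightarrow> quat. q i)" for i
    by (rule continuous_on_subset[OF continuous_on_product_coordinates subset_UNIV])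
  have "j mod 4 < 4"
    by simp
  from less_4_cases[OF this] show ?thesis
  proof (elim disjE)
    assume l: "j mod 4 = 0"
    show ?thesis
      unfolding qcoord_def l qcomp_cases by (rule continuous_on_fst[OF coord])
  next
    assume l: "j mod 4 = Suc 0"
    show ?thesis
      unfolding qcoord_def l qcomp_cases by (rule continuous_on_fst[OF continuous_on_snd[OF coord]])
  next
    assume l: "j mod 4 = 2"
    show ?thesis
      unfolding qcoord_def l qcomp_cases
      by (rule continuous_on_fst[OF continuous_on_snd[OF continuous_on_snd[OF coord]]])
  next
    assume l: "j mod 4 = 3"
    show ?thesis
      unfolding qcoord_def l qcomp_cases
      by (rule continuous_on_snd[OF continuous_on_snd[OF continuous_on_snd[OF coord]]])
  qed
qed

lemma continuous_on_qseq: "continuous_on S qseq"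
proof (rule continuous_on_coordinatewise_then_product)
  fix i
  have coord: "continuous_on S (\<lambda>z::nat \<Rightarrow> real. z j)" for j
    by (rule continuous_on_subset[OF continuous_on_product_coordinates subset_UNIV])
  show "continuous_on S (\<lambda>z. qseq z i)"
    unfolding qseq_def by (rule continuous_on_Pair[OF coord continuous_on_Pair[OF coord continuous_on_Pair[OF coord coord]]])
qed

lemma embedding_map_qcoord:
  assumes "S \<subseteq> Hn n"
  shows "embedding_map (top_of_set S) (Euclidean_space (4 * n)) qcoord"
proof (rule embedding_mapI[where d = qseq])
  show "continuous_map (top_of_set S) (Euclidean_space (4 * n)) qcoord"
  proof (rule continuous_map_into_Euc)
    show "qcoord x \<in> Euc (4 * n)" if "x \<in> topspace (top_of_set S)" for x
      using that assms by (intro qcoord_Euc) auto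
    show "continuous_map (top_of_set S) euclideanreal (\<lambda>x. qcoord x j)" for j
      unfolding continuous_map_iff_continuous by (rule continuous_on_qcoord)
  qed
  show "continuous_map (subtopology (Euclidean_space (4 * n)) (qcoord ` topspace (top_of_set S))) (top_of_set S) qseq"
    unfolding continuous_map_in_subtopology continuous_map_Euc
    using continuous_on_qseq by auto
qed simp

section \<open>Smoothness of quaternionic formulas\<close>

lemma Ck_on_diff:
  assumes "openin (Euclidean_space k) U" and "Ck_on r k U f" and "Ck_on r k U g"
  shows "Ck_on r k U (\<lambda>x. f x - g x)"
  using Ck_on_add[OF assms(1,2) Ck_on_mult[OF assms(1) Ck_on_const[OF assms(1), of r "-1"] assms(3)]]
  by simp

text \<open>Smoothness on the whole of R^k can be demanded because the quaternionic formulas to come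
  are polynomial in the real coordinates.\<close>

definition qsmooth :: "nat \<Rightarrow> ((nat \<Rightarrow> real) \<Rightarrow> quat) \<Rightarrow> bool"
  where "qsmooth k f \<longleftrightarrow> (\<forall>l<4. \<forall>r. Ck_on r k (Euc k) (\<lambda>z. qcomp (f z) l))"

lemma qsmooth_const: "qsmooth k (\<lambda>z. c)"
  by (simp add: qsmooth_def Ck_on_const del: Ck_on.simps)

lemma qsmooth_qseq: "qsmooth k (\<lambda>z. qseq z i)"
  by (simp add: qsmooth_def Ck_on_coord qcomp_qseq del: Ck_on.simps)

lemma qsmooth_scaleR: "qsmooth k f \<Longrightarrow> qsmooth k (\<lambda>z. t *\<^sub>R f z)"
  unfolding qsmooth_def by (auto simp: qcomp_scaleR intro!: Ck_on_mult Ck_on_const simp del: Ck_on.simps)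

lemma qsmooth_qconj:
  assumes "qsmooth k f"
  shows "qsmooth k (\<lambda>z. qconj (f z))"
proof -
  have "qcomp (qconj q) l = (if l = 0 then 1 else - 1) * qcomp q l" if "l < 4" for q l
    using less_4_cases[OF that] by (cases q) (auto simp: qcomp_cases)
  moreover have "Ck_on r k (Euc k) (\<lambda>z. (if l = 0 then 1 else - 1) * qcomp (f z) l)" if "l < 4" for l r
    by (intro Ck_on_mult Ck_on_const openin_Euc) (use assms that in \<open>simp add: qsmooth_def\<close>)
  ultimately show ?thesis
    by (simp add: qsmooth_def)
qed

lemma qcomp_qmult:
  "qcomp (p \<star> q) 0 = qcomp p 0 * qcomp q 0 - qcomp p (Suc 0) * qcomp q (Suc 0) - qcomp p 2 * qcomp q 2 - qcomp p 3 * qcomp q 3"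
  "qcomp (p \<star> q) (Suc 0) = qcomp p 0 * qcomp q (Suc 0) + qcomp p (Suc 0) * qcomp q 0 + qcomp p 2 * qcomp q 3 - qcomp p 3 * qcomp q 2"
  "qcomp (p \<star> q) 2 = qcomp p 0 * qcomp q 2 - qcomp p (Suc 0) * qcomp q 3 + qcomp p 2 * qcomp q 0 + qcomp p 3 * qcomp q (Suc 0)"
  "qcomp (p \<star> q) 3 = qcomp p 0 * qcomp q 3 + qcomp p (Suc 0) * qcomp q 2 - qcomp p 2 * qcomp q (Suc 0) + qcomp p 3 * qcomp q 0"
  by (cases p; cases q; simp add: qcomp_cases)+

lemma qsmooth_qmult:
  assumes "qsmooth k f" and "qsmooth k g"
  shows "qsmooth k (\<lambda>z. f z \<star> g z)"
  unfolding qsmooth_def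
proof (intro allI impI)
  fix l r :: nat assume "l < 4"
  have fg: "Ck_on r k (Euc k) (\<lambda>z. qcomp (f z) l)" "Ck_on r k (Euc k) (\<lambda>z. qcomp (g z) l)" if "l < 4" for l
    using assms that by (auto simp: qsmooth_def)
  show "Ck_on r k (Euc k) (\<lambda>z. qcomp (f z \<star> g z) l)"
    using less_4_cases[OF \<open>l < 4\<close>]
    by (elim disjE; hypsubst, simp only: qcomp_qmult)
      (intro Ck_on_add Ck_on_diff Ck_on_mult fg openin_Euc; simp)+
qed

lemma smooth_on_qcoord:
  assumes "\<And>i. qsmooth k (\<lambda>z. f z i)"
  shows "smooth_on k l (Euc k) (\<lambda>z. qcoord (f z))"
  using assms by (simp add: smooth_on_def qcoord_def qsmooth_def del: Ck_on.simps)


section \<open>The configuration\<close>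

text \<open>The list es numbers the index type, so that its entry j belongs to the quaternionic
  coordinate d + 1 + j.\<close>

definition conf :: "nat \<Rightarrow> 'k list \<Rightarrow> (real ^ 'k::finite) list"
  where "conf d es = replicate (Suc d) (\<chi> i. - 1) @ map (\<lambda>i. axis i 1) es"

lemma length_conf: "length (conf d es) = Suc d + length es"
  by (simp add: conf_def)

lemma conf_nth:
  "i < Suc d \<Longrightarrow> conf d es ! i = (\<chi> i. - 1)"
  "j < length es \<Longrightarrow> conf d es ! (Suc d + j) = axis (es ! j) 1"
  by (auto simp: conf_def nth_append simp del: replicate_Suc)

text \<open>Let c be the total squared norm of the first d + 1 coordinates. Component
  \<open>es ! l\<close> of the vector equation says that coordinate d + 1 + l has squared norm c, so
  the total is (k + 1) c, and it has to be 1.\<close>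

lemma ZH_conf:
  fixes es :: "'k::finite list"
  assumes es: "distinct es" "set es = UNIV" and k: "length es = k"
  shows "ZH (conf d es) = {q \<in> Hn (Suc d + k). (\<Sum>i<Suc d. (norm (q i))\<^sup>2) = 1 / (real k + 1) \<and>
    (\<forall>j<k. (norm (q (Suc d + j)))\<^sup>2 = 1 / (real k + 1))}"
proof -
  have "(\<Sum>i<Suc d + k. (norm (q i))\<^sup>2 *\<^sub>R (conf d es ! i)) = 0 \<and> (\<Sum>i<Suc d + k. (norm (q i))\<^sup>2) = 1 \<longleftrightarrow>
    (\<Sum>i<Suc d. (norm (q i))\<^sup>2) = 1 / (real k + 1) \<and> (\<forall>j<k. (norm (q (Suc d + j)))\<^sup>2 = 1 / (real k + 1))"
    (is "?L = 0 \<and> ?T = 1 \<longleftrightarrow> _") for q :: "nat \<Rightarrow> quat"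
  proof -
    define c where "c = (\<Sum>i<Suc d. (norm (q i))\<^sup>2)"
    have L: "?L = c *\<^sub>R (\<chi> i. - 1) + (\<Sum>j<k. (norm (q (Suc d + j)))\<^sup>2 *\<^sub>R axis (es ! j) 1)"
      unfolding sum_lessThan_add c_def scaleR_sum_left using k
      by (intro arg_cong2[where f = plus] sum.cong refl) (simp_all add: conf_nth del: sum.lessThan_Suc add_Suc)
    have comp: "?L $ (es ! l) = (norm (q (Suc d + l)))\<^sup>2 - c" if "l < k" for l
    proof -
      have "(\<Sum>j<k. ((norm (q (Suc d + j)))\<^sup>2 *\<^sub>R axis (es ! j) 1) $ (es ! l)) =
          (\<Sum>j<k. if j = l then (norm (q (Suc d + j)))\<^sup>2 else 0)"
        using that es(1) k by (intro sum.cong refl) (auto simp: axis_def nth_eq_iff_index_eq)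
      then show ?thesis
        unfolding L using that by (simp del: add_Suc)
    qed
    have all: "(\<forall>\<kappa>. P \<kappa>) \<longleftrightarrow> (\<forall>l<k. P (es ! l))" for P
      using es(2) k by (metis UNIV_I in_set_conv_nth)
    have L0: "?L = 0 \<longleftrightarrow> (\<forall>l<k. (norm (q (Suc d + l)))\<^sup>2 = c)"
    proof -
      have "?L = 0 \<longleftrightarrow> (\<forall>l<k. ?L $ (es ! l) = 0)"
        unfolding vec_eq_iff zero_index by (rule all)
      also have "\<dots> \<longleftrightarrow> (\<forall>l<k. (norm (q (Suc d + l)))\<^sup>2 = c)"
        by (intro all_cong1 imp_cong refl) (simp only: comp right_minus_eq)
      finally show ?thesis .
    qed
    have T: "?T = c + (\<Sum>j<k. (norm (q (Suc d + j)))\<^sup>2)"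
      unfolding sum_lessThan_add c_def ..
    have "c + (\<Sum>j<k. (norm (q (Suc d + j)))\<^sup>2) = 1 \<longleftrightarrow> c = 1 / (real k + 1)"
      if "\<forall>l<k. (norm (q (Suc d + l)))\<^sup>2 = c"
    proof -
      have "(\<Sum>j<k. (norm (q (Suc d + j)))\<^sup>2) = (\<Sum>j<k. c)"
        using that by (intro sum.cong refl) blast
      then show ?thesis
        by (simp add: field_simps)
    qed
    then have "?L = 0 \<and> ?T = 1 \<longleftrightarrow> (\<forall>l<k. (norm (q (Suc d + l)))\<^sup>2 = c) \<and> c = 1 / (real k + 1)"
      unfolding L0 T by metis
    also have "\<dots> \<longleftrightarrow> c = 1 / (real k + 1) \<and> (\<forall>j<k. (norm (q (Suc d + j)))\<^sup>2 = 1 / (real k + 1))"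
      by (cases "c = 1 / (real k + 1)") simp_all
    finally show ?thesis
      unfolding c_def .
  qed
  then show ?thesis
    unfolding ZH_def length_conf k by (simp only:)
qed

section \<open>Admissibility of the configuration\<close>

lemma set_conf: "set es = UNIV \<Longrightarrow> set (conf d es) = insert (\<chi> i. - 1) (range (\<lambda>i. axis i 1))"
  by (auto simp: conf_def)

text \<open>The vector - (1, ..., 1) and the basis vectors sum to zero, so 0 is their
  barycentre.\<close>

lemma zero_in_convex_hull_conf:
  "(0 :: real ^ 'k::finite) \<in> convex hull (insert (\<chi> i. - 1) (range (\<lambda>i. axis i 1)))"
proof -
  let ?S = "insert (\<chi> i. - 1) (range (\<lambda>i. axis i 1)) :: (real ^ 'k) set"
  let ?c = "1 / (real CARD('k) + 1)"
  \<comment> \<open>The option type indexes the k + 1 points: \<open>None\<close> stands for - (1,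
    ..., 1) and \<open>Some i\<close> for a basis vector.\<close>
  define y where "y = (\<lambda>x :: 'k option. case x of None \<Rightarrow> (\<chi> i. - 1) | Some i \<Rightarrow> axis i (1::real))"
  have "(\<Sum>x\<in>UNIV. ?c *\<^sub>R y x) \<in> convex hull ?S"
  proof (rule convex_sum)
    show "y x \<in> convex hull ?S" for x
      by (rule hull_inc) (auto simp: y_def split: option.split)
  qed (auto simp: field_simps)
  also have "(\<Sum>x\<in>UNIV. ?c *\<^sub>R y x) = 0"
  proof -
    have "(\<Sum>x\<in>UNIV. y x) = (\<chi> i. - 1) + (\<Sum>i\<in>UNIV. axis i 1)"
      by (simp add: UNIV_option_conv sum.reindex y_def)
    also have "\<dots> = 0"
      by (simp add: vec_eq_iff axis_def)
    finally show ?thesis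
      by (simp flip: scaleR_sum_right)
  qed
  finally show ?thesis .
qed

text \<open>The points lie on an affine hyperplane that misses the origin.\<close>

lemma zero_notin_convex_hull_if_inner_1:
  fixes a :: "'a::euclidean_space"
  assumes "\<And>x. x \<in> S \<Longrightarrow> a \<bullet> x = 1"
  shows "0 \<notin> convex hull S"
proof -
  have "convex hull S \<subseteq> {x. a \<bullet> x = 1}"
    by (rule hull_minimal) (use assms convex_hyperplane in auto)
  then show ?thesis
    by auto
qed

text \<open>Each point of the configuration other than the basis vector e_j lies on the hyperplane
  x_1 + ... + x_k - (k + 1) x_j = 1, and all basis vectors lie on x_1 + ... + x_k = 1.\<close>

lemma admissible_conf:
  fixes es :: "'k::finite list"
  assumes es: "distinct es" "set es = UNIV"
  shows "admissible (conf d es)"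
proof -
  let ?v = "(\<chi> i. - 1) :: real ^ 'k" and ?k = "CARD('k)"
  have k: "length es = ?k"
    using distinct_card[OF es(1)] es(2) by simp
  have "affine hull (set (conf d es)) = UNIV"
  proof -
    have "(0 :: real ^ 'k) \<in> affine hull (set (conf d es))"
      using zero_in_convex_hull_conf convex_hull_subset_affine_hull unfolding set_conf[OF es(2)] by blast
    then have "affine hull (set (conf d es)) = span (set (conf d es))"
      by (rule affine_hull_span_0)
    moreover have "(Basis :: (real ^ 'k) set) \<subseteq> set (conf d es)"
      unfolding set_conf[OF es(2)] by (auto simp: Basis_vec_def)
    ultimately show ?thesis
      using span_mono[of Basis "set (conf d es)"] by (auto simp: span_Basis)
  qed
  moreover have "card I > ?k" if I: "I \<subseteq> {..<length (conf d es)}"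
    and 0: "0 \<in> convex hull ((\<lambda>i. conf d es ! i) ` I)" for I
  proof -
    have dot: "(\<chi> i. f i) \<bullet> ?v = - (\<Sum>i\<in>UNIV. f i)" "(\<chi> i. f i) \<bullet> axis i 1 = f i" for f :: "'k \<Rightarrow> real" and i
      by (simp_all add: inner_vec_def sum_negf axis_def if_distrib[of "\<lambda>c. _ * c"] cong: if_cong)
    have idx: "(\<exists>j<?k. i = Suc d + j)" if "i \<in> I" "\<not> i < Suc d" for i
      using that I by (intro exI[of _ "i - Suc d"]) (auto simp: length_conf k)
    have "\<exists>i\<in>I. i < Suc d"
    proof (rule ccontr)
      assume no: "\<not> (\<exists>i\<in>I. i < Suc d)"
      have "(\<chi> i. 1) \<bullet> x = 1" if "x \<in> (\<lambda>i. conf d es ! i) ` I" for x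
      proof -
        obtain j where "j < ?k" "x = conf d es ! (Suc d + j)"
          using \<open>x \<in> _\<close> no idx by blast
        then show ?thesis
          using conf_nth(2)[of j es d] k dot(2) by simp
      qed
      then show False
        using zero_notin_convex_hull_if_inner_1[of "(\<lambda>i. conf d es ! i) ` I" "\<chi> i. 1"] 0 by blast
    qed
    then obtain i0 where i0: "i0 \<in> I" "i0 < Suc d"
      by blast
    have "Suc d + j \<in> I" if j: "j < ?k" for j
    proof (rule ccontr)
      assume no: "Suc d + j \<notin> I"
      \<comment> \<open>The coefficient of x_j in the hyperplane equation is 1 - (k + 1) = - k. The
        coefficients sum to -1, so their inner product with - (1, ..., 1) is 1.\<close>
      let ?f = "\<lambda>i. if i = es ! j then - real ?k else 1"
      have sum: "(\<Sum>i\<in>UNIV. ?f i) = - 1"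
      proof -
        have "(\<Sum>i\<in>UNIV. ?f i) = ?f (es ! j) + (\<Sum>i\<in>UNIV - {es ! j}. ?f i)"
          by (rule sum.remove) auto
        also have "(\<Sum>i\<in>UNIV - {es ! j}. ?f i) = real (?k - 1)"
          by (simp add: card_Diff_singleton)
        finally show ?thesis
          by (simp add: of_nat_diff Suc_leI)
      qed
      have "(\<chi> i. ?f i) \<bullet> x = 1" if "x \<in> (\<lambda>i. conf d es ! i) ` I" for x
      proof -
        obtain i where i: "i \<in> I" "x = conf d es ! i"
          using \<open>x \<in> _\<close> by blast
        show ?thesis
        proof (cases "i < Suc d")
          case True
          then show ?thesis
            using conf_nth(1)[OF True, of es] i(2) sum by (simp only: dot minus_minus)
        next
          case False
          then obtain l where l: "l < ?k" "i = Suc d + l"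
            using idx i(1) by blast
          then have "l \<noteq> j"
            using no i(1) by auto
          then have "es ! l \<noteq> es ! j"
            using es(1) j l(1) k by (simp add: nth_eq_iff_index_eq)
          then show ?thesis
            using conf_nth(2)[of l es d] l k i(2) by (simp only: dot if_False)
        qed
      qed
      then show False
        using zero_notin_convex_hull_if_inner_1[of "(\<lambda>i. conf d es ! i) ` I" "\<chi> i. ?f i"] 0 by blast
    qed
    \<comment> \<open>One index of a repeated vector and the indices of all k basis vectors make k +
      1 elements of I.\<close>
    then have sub: "insert i0 ((+) (Suc d) ` {..<?k}) \<subseteq> I"
      using i0 by auto
    have "card ((+) (Suc d) ` {..<?k}) = ?k"
      by (subst card_image) (auto simp: inj_on_def)
    then have "card (insert i0 ((+) (Suc d) ` {..<?k})) = Suc ?k"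
      using i0 by (subst card_insert_disjoint) auto
    then show ?thesis
      using card_mono[OF finite_subset[OF I finite_lessThan] sub] by simp
  qed
  moreover have "0 \<in> convex hull (set (conf d es))"
    unfolding set_conf[OF es(2)] by (rule zero_in_convex_hull_conf)
  ultimately show ?thesis
    by (simp add: admissible_def)
qed

section \<open>Products of unit spheres in quaternionic coordinates\<close>

text \<open>For r = k this is Z after rescaling, for r = k - 1 a set of normal forms for the
  orbits.\<close>

definition unit_product :: "nat \<Rightarrow> nat \<Rightarrow> (nat \<Rightarrow> quat) set"
  where "unit_product d r = {u \<in> Hn (Suc d + r). (\<Sum>i<Suc d. (norm (u i))\<^sup>2) = 1 \<and>
    (\<forall>j<r. norm (u (Suc d + j)) = 1)}"

text \<open>Regroups real coordinates as a point of S^(4d + 3) x (S^3)^r; the family is restricted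
  to indices below r as the extensional product demands.\<close>

definition split_factors :: "nat \<Rightarrow> nat \<Rightarrow> (nat \<Rightarrow> quat) \<Rightarrow> (nat \<Rightarrow> real) \<times> (nat \<Rightarrow> nat \<Rightarrow> real)"
  where "split_factors d r u = (block 0 (4 * Suc d) (qcoord u),
    \<lambda>i\<in>{..<r}. block (i * 4) 4 (block (4 * Suc d) (r * 4) (qcoord u)))"

abbreviation (input) sphere_product :: "nat \<Rightarrow> nat \<Rightarrow> ((nat \<Rightarrow> real) \<times> (nat \<Rightarrow> nat \<Rightarrow> real)) smfd"
  where "sphere_product d r \<equiv> prod_mfd (sphere_mfd (4 * d + 3)) (power_mfd r (sphere_mfd 3))"

definition sphere_product_emb :: "nat \<Rightarrow> nat \<Rightarrow> (nat \<Rightarrow> real) \<times> (nat \<Rightarrow> nat \<Rightarrow> real) \<Rightarrow> nat \<Rightarrow> real"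
  where "sphere_product_emb d r p = join (4 * Suc d) (fst p) (concat_blocks r 4 (snd p))"

lemma embedded_in_sphere_product:
  "embedded_in (sphere_product d r) (4 * (Suc d + r)) (sphere_product_emb d r)"
proof -
  have "Suc (4 * d + 3) = 4 * Suc d" "Suc 3 = (4::nat)" "4 * Suc d + r * 4 = 4 * (Suc d + r)"
    by simp_all
  then show ?thesis
    using embedded_in_prod[OF embedded_in_sphere embedded_in_power[OF embedded_in_sphere], of "4 * d + 3" r 3]
    unfolding sphere_product_emb_def by (simp only: id_def)
qed

lemma topspace_sphere_product:
  "topspace (mtop (sphere_product d r)) =
    {p. fst p \<in> topspace (nsphere (4 * d + 3)) \<and> snd p \<in> PiE {..<r} (\<lambda>_. topspace (nsphere 3))}"
  unfolding prod_mfd_simps power_mfd_simps sphere_mfd_simps topspace_prod_topology topspace_product_topology o_def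
  by (rule set_eqI) (simp only: mem_Times_iff mem_Collect_eq)

lemma mem_nsphere: "x \<in> topspace (nsphere n) \<longleftrightarrow> x \<in> Euc (Suc n) \<and> (\<Sum>j<Suc n. (x j)\<^sup>2) = 1"
  by (auto simp: topspace_nsphere)

lemma split_factors_in_sphere_product_iff:
  "split_factors d r u \<in> topspace (mtop (sphere_product d r)) \<longleftrightarrow>
    (\<Sum>i<Suc d. (norm (u i))\<^sup>2) = 1 \<and> (\<forall>j<r. norm (u (Suc d + j)) = 1)"
proof -
  have 4: "Suc (4 * d + 3) = 4 * Suc d" "Suc 3 = (4::nat)"
    by simp_all
  have norm_1: "norm x = 1 \<longleftrightarrow> (norm x)\<^sup>2 = 1" for x :: quat
    using power2_eq_iff_nonneg[of "norm x" 1] by simp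
  have "(\<Sum>j<4 * Suc d. (block 0 (4 * Suc d) (qcoord u) j)\<^sup>2) = (\<Sum>i<Suc d. (norm (u i))\<^sup>2)"
    unfolding sum_qcoord_squares[symmetric] by (intro sum.cong refl) (simp add: block_def)
  then have fst: "block 0 (4 * Suc d) (qcoord u) \<in> topspace (nsphere (4 * d + 3)) \<longleftrightarrow>
      (\<Sum>i<Suc d. (norm (u i))\<^sup>2) = 1"
    unfolding mem_nsphere 4 by (simp only: block_Euc simp_thms)
  have snd: "block (i * 4) 4 (block (4 * Suc d) (r * 4) (qcoord u)) \<in> topspace (nsphere 3) \<longleftrightarrow>
      norm (u (Suc d + i)) = 1" if "i < r" for i
  proof -
    have "(\<Sum>l<4. (block (i * 4) 4 (block (4 * Suc d) (r * 4) (qcoord u)) l)\<^sup>2) = (norm (u (Suc d + i)))\<^sup>2"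
      unfolding norm_quat_qcomp
    proof (intro sum.cong refl)
      fix l :: nat assume "l \<in> {..<4}"
      then have l: "l < 4"
        by simp
      have "4 * Suc d + (i * 4 + l) = 4 * (Suc d + i) + l"
        by simp
      then show "(block (i * 4) 4 (block (4 * Suc d) (r * 4) (qcoord u)) l)\<^sup>2 = (qcomp (u (Suc d + i)) l)\<^sup>2"
        using l block_index[OF that l] by (simp only: block_def if_True qcoord_index[OF l])
    qed
    then show ?thesis
      unfolding mem_nsphere 4 norm_1 by (simp only: block_Euc simp_thms)
  qed
  show ?thesis
    unfolding topspace_sphere_product split_factors_def mem_Collect_eq fst_conv snd_conv restrict_PiE_iff fst
    using snd by blast
qed

lemma unit_product_iff:
  "u \<in> unit_product d r \<longleftrightarrow> u \<in> Hn (Suc d + r) \<and> split_factors d r u \<in> topspace (mtop (sphere_product d r))"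
  unfolding split_factors_in_sphere_product_iff by (auto simp: unit_product_def)

text \<open>In ambient coordinates the regrouping is the identity, so it costs nothing in smoothness
  proofs.\<close>

lemma sphere_product_emb_split_factors:
  assumes "u \<in> Hn (Suc d + r)"
  shows "sphere_product_emb d r (split_factors d r u) = qcoord u"
proof -
  have 4: "4 * (Suc d + r) = 4 * Suc d + r * 4"
    by simp
  have "concat_blocks r 4 (\<lambda>i\<in>{..<r}. block (i * 4) 4 (block (4 * Suc d) (r * 4) (qcoord u))) =
      concat_blocks r 4 (\<lambda>i. block (i * 4) 4 (block (4 * Suc d) (r * 4) (qcoord u)))"
    by (rule concat_blocks_cong) simp
  also have "\<dots> = block (4 * Suc d) (r * 4) (qcoord u)"
    by (rule concat_blocks_block[OF block_Euc])
  finally show ?thesis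
    using join_block[OF qcoord_Euc[OF assms, unfolded 4]]
    by (simp only: sphere_product_emb_def split_factors_def fst_conv snd_conv)
qed

lemma split_factors_sphere_product_emb:
  assumes "p \<in> topspace (mtop (sphere_product d r))"
  shows "split_factors d r (qseq (sphere_product_emb d r p)) = p"
    and "qseq (sphere_product_emb d r p) \<in> unit_product d r"
proof -
  have 4: "Suc (4 * d + 3) = 4 * Suc d" "Suc 3 = (4::nat)"
    by simp_all
  have p: "fst p \<in> Euc (4 * Suc d)" "\<And>i. i < r \<Longrightarrow> snd p i \<in> Euc 4" "snd p \<in> extensional {..<r}"
    using assms unfolding topspace_sphere_product mem_nsphere 4 by (auto simp: PiE_iff mem_nsphere)
  have "(\<lambda>i\<in>{..<r}. block (i * 4) 4 (concat_blocks r 4 (snd p))) = snd p"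
    using p(2,3) by (auto simp: block_concat_blocks extensional_def fun_eq_iff)
  then show *: "split_factors d r (qseq (sphere_product_emb d r p)) = p"
    unfolding split_factors_def sphere_product_emb_def qcoord_qseq block_join(1)[OF p(1)]
      block_join(2)[OF concat_blocks_Euc]
    by simp
  show "qseq (sphere_product_emb d r p) \<in> unit_product d r"
    unfolding unit_product_iff *
    using assms by (intro conjI qseq_Hn embedded_inD(5)[OF embedded_in_sphere_product])
qed

lemma bij_betw_split_factors:
  "bij_betw (split_factors d r) (unit_product d r) (topspace (mtop (sphere_product d r)))"
proof (rule bij_betw_byWitness[where f' = "\<lambda>p. qseq (sphere_product_emb d r p)"])
  show "\<forall>u\<in>unit_product d r. qseq (sphere_product_emb d r (split_factors d r u)) = u"
    by (simp add: unit_product_iff sphere_product_emb_split_factors)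
  show "\<forall>p\<in>topspace (mtop (sphere_product d r)). split_factors d r (qseq (sphere_product_emb d r p)) = p"
    using split_factors_sphere_product_emb(1) by blast
  show "split_factors d r ` unit_product d r \<subseteq> topspace (mtop (sphere_product d r))"
    by (auto simp: unit_product_iff)
  show "(\<lambda>p. qseq (sphere_product_emb d r p)) ` topspace (mtop (sphere_product d r)) \<subseteq> unit_product d r"
    using split_factors_sphere_product_emb(2) by blast
qed


section \<open>Dividing by the last coordinate\<close>

text \<open>Multiplies from the left by the conjugate, which inverts a unit last coordinate, and
  drops the last coordinate, which has then become 1.\<close>

definition divide_last :: "nat \<Rightarrow> (nat \<Rightarrow> quat) \<Rightarrow> nat \<Rightarrow> quat"
  where "divide_last v u = (\<lambda>i. if i < v then qconj (u v) \<star> u i else 0)"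

text \<open>The normal form w, completed by a last coordinate 1 and then moved by a.\<close>

definition append_last :: "nat \<Rightarrow> quat \<Rightarrow> (nat \<Rightarrow> quat) \<Rightarrow> nat \<Rightarrow> quat"
  where "append_last v a w = (\<lambda>i. if i < v then a \<star> w i else if i = v then a else 0)"

lemma norm_last: "u \<in> unit_product d (Suc r) \<Longrightarrow> norm (u (Suc d + r)) = 1"
  by (simp add: unit_product_def)

lemma divide_last_unit_product:
  assumes "u \<in> unit_product d (Suc r)"
  shows "divide_last (Suc d + r) u \<in> unit_product d r"
  using assms norm_last[OF assms]
  by (auto simp: unit_product_def divide_last_def Hn_def norm_qmult simp del: sum.lessThan_Suc)

lemma append_last_unit_product:
  assumes "w \<in> unit_product d r" and "norm a = 1"
  shows "append_last (Suc d + r) a w \<in> unit_product d (Suc r)"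
proof -
  have "(\<Sum>i<Suc d. (norm (append_last (Suc d + r) a w i))\<^sup>2) = (\<Sum>i<Suc d. (norm (w i))\<^sup>2)"
    using assms(2) by (intro sum.cong refl) (auto simp: append_last_def norm_qmult)
  moreover have "append_last (Suc d + r) a w \<in> Hn (Suc d + Suc r)"
    by (simp add: Hn_def append_last_def)
  moreover have "norm (append_last (Suc d + r) a w (Suc d + j)) = 1" if "j < Suc r" for j
    using that assms by (cases "j = r") (simp_all add: append_last_def unit_product_def norm_qmult)
  ultimately show ?thesis
    using assms(1) by (simp add: unit_product_def del: sum.lessThan_Suc add_Suc)
qed

lemma divide_append_last:
  assumes "w \<in> Hn v" and "norm a = 1"
  shows "divide_last v (append_last v a w) = w"
  using assms by (auto simp: divide_last_def append_last_def qconj_cancel Hn_def)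

lemma append_divide_last:
  assumes "u \<in> Hn (Suc v)" and "norm (u v) = 1"
  shows "append_last v (u v) (divide_last v u) = u"
  using assms by (auto simp: divide_last_def append_last_def qconj_cancel Hn_def fun_eq_iff)

text \<open>Conjugation reverses products, so conj(a) and a meet in the middle and cancel.\<close>

lemma divide_last_invariant:
  "norm a = 1 \<Longrightarrow> divide_last v (\<lambda>i. a \<star> u i) = divide_last v u"
  by (auto simp: divide_last_def qconj_qmult qmult_assoc qconj_cancel fun_eq_iff)

text \<open>An element carrying u to u' has to match the last coordinates, which forces it to be
  u'_v times the conjugate of u_v.\<close>

lemma divide_last_eqD:
  assumes u: "u \<in> Hn (Suc v)" "norm (u v) = 1" and u': "u' \<in> Hn (Suc v)" "norm (u' v) = 1"
    and eq: "divide_last v u = divide_last v u'"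
  obtains a where "norm a = 1" and "u' = (\<lambda>i. a \<star> u i)"
proof
  show "norm (u' v \<star> qconj (u v)) = 1"
    using u(2) u'(2) by (simp add: norm_qmult)
  show "u' = (\<lambda>i. (u' v \<star> qconj (u v)) \<star> u i)"
  proof
    fix i
    consider "i < v" | "i = v" | "i > v"
      by linarith
    then show "u' i = (u' v \<star> qconj (u v)) \<star> u i"
    proof cases
      case 1
      then have "qconj (u v) \<star> u i = qconj (u' v) \<star> u' i"
        using fun_cong[OF eq, of i] by (simp add: divide_last_def)
      then show ?thesis
        using u'(2) by (simp add: qmult_assoc qconj_cancel)
    next
      case 2
      have "(u' v \<star> qconj (u v)) \<star> u v = u' v \<star> (1, 0, 0, 0)"
        using u(2) by (simp only: qmult_assoc qconj_unit)
      also have "\<dots> = u' v"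
        by (cases "u' v") simp
      finally show ?thesis
        using 2 by simp
    next
      case 3
      then show ?thesis
        using u(1) u'(1) by (simp add: Hn_def)
    qed
  qed
qed


section \<open>The quotient\<close>

text \<open>Turns the squared norms 1/(k + 1) of the equations into 1.\<close>

definition rescale :: "nat \<Rightarrow> (nat \<Rightarrow> quat) \<Rightarrow> nat \<Rightarrow> quat"
  where "rescale k q = (\<lambda>i. sqrt (real k + 1) *\<^sub>R q i)"

definition unscale :: "nat \<Rightarrow> (nat \<Rightarrow> quat) \<Rightarrow> nat \<Rightarrow> quat"
  where "unscale k u = (\<lambda>i. (1 / sqrt (real k + 1)) *\<^sub>R u i)"

lemma sqrt_Suc_nonzero: "sqrt (real k + 1) \<noteq> 0"
  by simp

lemma unscale_rescale [simp]: "unscale k (rescale k q) = q" "rescale k (unscale k q) = q"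
  using sqrt_Suc_nonzero[of k] by (simp_all add: rescale_def unscale_def)

lemma rescale_qmult: "rescale k (\<lambda>i. a \<star> q i) = (\<lambda>i. a \<star> rescale k q i)"
  by (simp add: rescale_def qmult_scaleR)

lemma mem_ZH_conf_iff:
  assumes "distinct es" and "set es = UNIV" and "length es = k"
  shows "q \<in> ZH (conf d es) \<longleftrightarrow> rescale k q \<in> unit_product d k"
proof -
  have n2: "(norm (rescale k q i))\<^sup>2 = (real k + 1) * (norm (q i))\<^sup>2" for i
    by (simp add: rescale_def power_mult_distrib)
  have n1: "norm (rescale k q i) = 1 \<longleftrightarrow> (norm (q i))\<^sup>2 = 1 / (real k + 1)" for i
  proof -
    have "norm (rescale k q i) = 1 \<longleftrightarrow> (norm (rescale k q i))\<^sup>2 = 1"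
      using power2_eq_iff_nonneg[of "norm (rescale k q i)" 1] by simp
    then show ?thesis
      by (simp add: n2 field_simps)
  qed
  have "(\<Sum>i<Suc d. (norm (rescale k q i))\<^sup>2) = 1 \<longleftrightarrow> (\<Sum>i<Suc d. (norm (q i))\<^sup>2) = 1 / (real k + 1)"
    unfolding n2 sum_distrib_left[symmetric] by (simp add: field_simps del: sum.lessThan_Suc)
  moreover have "rescale k q \<in> Hn n \<longleftrightarrow> q \<in> Hn n" for n
    using sqrt_Suc_nonzero[of k] by (auto simp: Hn_def rescale_def)
  ultimately show ?thesis
    unfolding ZH_conf[OF assms] unit_product_def by (simp only: mem_Collect_eq n1)
qed

lemma bij_betw_rescale:
  assumes "distinct es" and "set es = UNIV" and "length es = k"
  shows "bij_betw (rescale k) (ZH (conf d es)) (unit_product d k)"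
  by (rule bij_betw_byWitness[where f' = "unscale k"]) (auto simp: mem_ZH_conf_iff[OF assms])

lemma smooth_on_qcoord_scaleR:
  assumes "\<And>i. qsmooth n (\<lambda>z. f z i)"
  shows "smooth_on n l (Euc n) (\<lambda>z. qcoord (\<lambda>i. t *\<^sub>R f z i))"
  by (intro smooth_on_qcoord qsmooth_scaleR assms)

text \<open>In ambient coordinates the passage from Z to the product of spheres is multiplication by
  sqrt(k + 1). So the two ambient maps needed for the transport of charts are homotheties.\<close>

lemma embedded_in_ZH_conf:
  fixes es :: "'k::finite list"
  assumes es: "distinct es" "set es = UNIV" "length es = k"
  shows "embedded_in (ZH_mfd (conf d es)) (4 * (Suc d + k)) qcoord"
proof -
  let ?Z = "ZH (conf d es)" and ?n = "4 * (Suc d + k)"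
  have k: "CARD('k) = k"
    using distinct_card[OF es(1)] es by simp
  have Z: "?Z \<subseteq> Hn (Suc d + k)"
    unfolding ZH_conf[OF es] by blast
  \<comment> \<open>Both sides are 4d + 3 + 3k.\<close>
  have dim: "mdim (sphere_product d k) = ?n - (CARD('k) + 1)"
    by (simp add: prod_mfd_simps power_mfd_simps sphere_mfd_simps k)
  have uHn: "rescale k q \<in> Hn (Suc d + k)" if "q \<in> ?Z" for q
    using that unfolding mem_ZH_conf_iff[OF es] by (simp add: unit_product_def)
  have "embedded_in (embedded_mfd ?n qcoord (mdim (sphere_product d k)) (top_of_set ?Z)) ?n qcoord"
  proof (rule embedded_in_transport[OF embedded_in_sphere_product embedding_map_qcoord[OF Z]])
    show "bij_betw (\<lambda>q. split_factors d k (rescale k q)) (topspace (top_of_set ?Z)) (topspace (mtop (sphere_product d k)))"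
      using bij_betw_trans[OF bij_betw_rescale[OF es] bij_betw_split_factors] by (simp add: o_def)
    show "smooth_on ?n ?n (Euc ?n) (\<lambda>z. qcoord (\<lambda>i. sqrt (real k + 1) *\<^sub>R qseq z i))"
      by (rule smooth_on_qcoord_scaleR[OF qsmooth_qseq])
    show "smooth_on ?n ?n (Euc ?n) (\<lambda>z. qcoord (\<lambda>i. (1 / sqrt (real k + 1)) *\<^sub>R qseq z i))"
      by (rule smooth_on_qcoord_scaleR[OF qsmooth_qseq])
    show "(\<lambda>z. qcoord (\<lambda>i. sqrt (real k + 1) *\<^sub>R qseq z i)) ` Euc ?n \<subseteq> Euc ?n"
      by (auto simp: qcoord_scaleR Euc_iff)
    show "sphere_product_emb d k (split_factors d k (rescale k q)) = qcoord (\<lambda>i. sqrt (real k + 1) *\<^sub>R qseq (qcoord q) i)"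
      if "q \<in> topspace (top_of_set ?Z)" for q
      using that uHn by (simp add: sphere_product_emb_split_factors) (simp add: rescale_def)
    show "qcoord q j = qcoord (\<lambda>i. (1 / sqrt (real k + 1)) *\<^sub>R qseq (sphere_product_emb d k (split_factors d k (rescale k q))) i) j"
      if "q \<in> topspace (top_of_set ?Z)" for q j
    proof -
      have "sphere_product_emb d k (split_factors d k (rescale k q)) = qcoord (rescale k q)"
        using that uHn by (intro sphere_product_emb_split_factors) simp
      then show ?thesis
        unfolding unscale_def[symmetric] by simp
    qed
  qed
  then show ?thesis
    unfolding dim ZH_mfd_def length_conf es(3) by simp
qed

section \<open>The structure on the orbit space\<close>

text \<open>Serves to give the set of orbits a topology. That it is the quotient topology is
  established afterwards, from the sections.\<close>

lemma embedding_map_pullback: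
  assumes "bij_betw h S (topspace Y)"
  shows "embedding_map (pullback_topology S h Y) Y h" and "topspace (pullback_topology S h Y) = S"
proof -
  show top: "topspace (pullback_topology S h Y) = S"
    using bij_betwE[OF assms] by (auto simp: topspace_pullback_topology)
  show "embedding_map (pullback_topology S h Y) Y h"
  proof (rule embedding_mapI[where d = "inv_into S h"])
    show "continuous_map (pullback_topology S h Y) Y h"
      using continuous_map_pullback[OF continuous_map_id, of S h Y] by (simp add: o_def id_def)
    have "continuous_map Y (pullback_topology S h Y) (inv_into S h)"
    proof (rule continuous_map_pullback')
      show "continuous_map Y Y (h \<circ> inv_into S h)"
        by (rule continuous_map_eq[OF continuous_map_id])
          (simp add: bij_betw_inv_into_right[OF assms])
      show "topspace Y \<subseteq> inv_into S h -` S"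
        using bij_betwE[OF bij_betw_inv_into[OF assms]] by auto
    qed
    then show "continuous_map (subtopology Y (h ` topspace (pullback_topology S h Y))) (pullback_topology S h Y) (inv_into S h)"
      by (rule continuous_map_from_subtopology)
    show "inv_into S h (h x) = x" if "x \<in> topspace (pullback_topology S h Y)" for x
      using that bij_betw_inv_into_left[OF assms] unfolding top by blast
  qed
qed

text \<open>The orbit space is given the structure of the product of spheres, transported along the
  bijection h induced by dividing by the last coordinate. Appending a fixed last coordinate a is a
  section of the projection, and a can be chosen so that it passes through any given point.\<close>

lemma quotient_of_ZH_conf:
  fixes es :: "'k::finite list"
  assumes es: "distinct es" "set es = UNIV" "length es = Suc r"
  shows "\<exists>N. is_NH (conf d es) N \<and> diffeomorphic N (sphere_product d r)"
proof -
  let ?Z = "ZH (conf d es)" and ?v = "Suc d + r" and ?P = "sphere_product d r" and ?E = "sphere_product_emb d r"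
  let ?n = "4 * (Suc d + r)" and ?nZ = "4 * (Suc d + Suc r)"
  let ?rs = "rescale (Suc r)" and ?us = "unscale (Suc r)"
  define proj where "proj q = split_factors d r (divide_last ?v (?rs q))" for q
  define S where "S = Sp1_orbit ` ?Z"
  \<comment> \<open>The representative chosen by \<open>inv_into\<close> is immaterial: dividing by
    the last coordinate is invariant under the action.\<close>
  define h where "h y = proj (inv_into ?Z Sp1_orbit y)" for y
  have Z: "?rs q \<in> unit_product d (Suc r)" "?rs q \<in> Hn (Suc ?v)" "norm (?rs q ?v) = 1" if "q \<in> ?Z" for q
  proof -
    show u: "?rs q \<in> unit_product d (Suc r)"
      using that unfolding mem_ZH_conf_iff[OF es] .
    then show "?rs q \<in> Hn (Suc ?v)"
      by (simp add: unit_product_def)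
    show "norm (?rs q ?v) = 1"
      by (rule norm_last[OF u])
  qed
  have div: "divide_last ?v (?rs q) \<in> unit_product d r" if "q \<in> ?Z" for q
    by (rule divide_last_unit_product[OF Z(1)[OF that]])
  have h_orbit: "h (Sp1_orbit q) = proj q" if q: "q \<in> ?Z" for q
  proof -
    define q' where "q' = inv_into ?Z Sp1_orbit (Sp1_orbit q)"
    have "Sp1_orbit q' = Sp1_orbit q"
      unfolding q'_def by (rule f_inv_into_f[OF imageI[OF q]])
    then have "q \<in> Sp1_orbit q'"
      using self_in_Sp1_orbit[of q] by simp
    then obtain a where a: "q = (\<lambda>i. a \<star> q' i)" "norm a = 1"
      unfolding Sp1_orbit_def Sp1_def by auto
    have "proj q = proj q'"
      unfolding a(1) proj_def rescale_qmult divide_last_invariant[OF a(2)] ..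
    then show ?thesis
      by (simp add: h_def q'_def)
  qed
  have orbit_eq: "Sp1_orbit q = Sp1_orbit q'" if q: "q \<in> ?Z" "q' \<in> ?Z" and eq: "proj q = proj q'" for q q'
  proof -
    have "divide_last ?v (?rs q) = divide_last ?v (?rs q')"
      by (rule inj_onD[OF bij_betw_imp_inj_on[OF bij_betw_split_factors] eq[unfolded proj_def] div[OF q(1)] div[OF q(2)]])
    then obtain a where a: "norm a = 1" "?rs q' = (\<lambda>i. a \<star> ?rs q i)"
      by (rule divide_last_eqD[OF Z(2,3)[OF q(1)] Z(2,3)[OF q(2)]])
    then have "?us (?rs q') = ?us (?rs (\<lambda>i. a \<star> q i))"
      by (simp add: rescale_qmult)
    then have "q' = (\<lambda>i. a \<star> q i)"
      by simp
    then show ?thesis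
      using Sp1_orbit_qmult[of a q] a(1) by (simp add: Sp1_def)
  qed
  \<comment> \<open>For fixed a this is a section of \<open>proj\<close> with values in Z; after
    rescaling its last coordinate is constantly a.\<close>
  define lift where "lift a y = ?us (append_last ?v a (qseq (?E y)))" for a y
  have lift: "lift a y \<in> ?Z" "proj (lift a y) = y" if y: "y \<in> topspace (mtop ?P)" and a: "norm a = 1" for a y
  proof -
    have w: "qseq (?E y) \<in> unit_product d r"
      by (rule split_factors_sphere_product_emb(2)[OF y])
    show "lift a y \<in> ?Z"
      unfolding mem_ZH_conf_iff[OF es] lift_def unscale_rescale by (rule append_last_unit_product[OF w a])
    have "qseq (?E y) \<in> Hn ?v"
      using w by (simp add: unit_product_def)
    then show "proj (lift a y) = y"
      unfolding proj_def lift_def unscale_rescale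
      by (simp only: divide_append_last[OF _ a] split_factors_sphere_product_emb(1)[OF y])
  qed
  have bij: "bij_betw h S (topspace (mtop ?P))"
    unfolding bij_betw_def
  proof
    show "inj_on h S"
    proof (rule inj_onI)
      fix x y assume "x \<in> S" "y \<in> S" and eq: "h x = h y"
      then obtain q q' where q: "q \<in> ?Z" "q' \<in> ?Z" "x = Sp1_orbit q" "y = Sp1_orbit q'"
        unfolding S_def by blast
      then show "x = y"
        using orbit_eq[OF q(1,2)] eq by (simp add: h_orbit)
    qed
    have "h (Sp1_orbit q) \<in> topspace (mtop ?P)" if "q \<in> ?Z" for q
      using div[OF that] bij_betwE[OF bij_betw_split_factors] by (simp add: h_orbit[OF that] proj_def)
    moreover have "y \<in> h ` S" if "y \<in> topspace (mtop ?P)" for y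
    proof -
      have 1: "norm ((1, 0, 0, 0) :: quat) = 1"
        by (simp add: norm_quat)
      have "y = h (Sp1_orbit (lift (1, 0, 0, 0) y))"
        by (simp add: h_orbit[OF lift(1)[OF that 1]] lift(2)[OF that 1])
      then show ?thesis
        using lift(1)[OF that 1] unfolding S_def by blast
    qed
    ultimately show "h ` S = topspace (mtop ?P)"
      unfolding S_def by blast
  qed
  define X where "X = pullback_topology S h (mtop ?P)"
  \<comment> \<open>With this embedding h becomes the identity in ambient coordinates, so the
    identity serves as ambient map both for the transport and for the diffeomorphism.\<close>
  define N where "N = embedded_mfd ?n (?E \<circ> h) (mdim ?P) X"
  have X: "topspace X = S" "embedding_map X (mtop ?P) h"
    using embedding_map_pullback[OF bij] by (auto simp: X_def)
  have emN: "embedded_in N ?n (?E \<circ> h)"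
    unfolding N_def
  proof (rule embedded_in_transport[OF embedded_in_sphere_product])
    show "embedding_map X (Euclidean_space ?n) (?E \<circ> h)"
      by (rule embedding_map_compose[OF X(2) embedded_inD(1)[OF embedded_in_sphere_product]])
    show "bij_betw h (topspace X) (topspace (mtop ?P))"
      using bij X(1) by simp
    show "smooth_on ?n ?n (Euc ?n) (\<lambda>z. z)" "smooth_on ?n ?n (Euc ?n) (\<lambda>z. z)"
      by (rule smooth_on_id[OF openin_Euc])+
  qed simp_all
  have topN: "topspace (mtop N) = S"
    by (simp add: N_def X(1))
  have diffeo: "diffeomorphic N ?P"
  proof (rule embedded_in_diffeomorphic[OF emN embedded_in_sphere_product])
    show "bij_betw h (topspace (mtop N)) (topspace (mtop ?P))"
      using bij topN by simp
    show "smooth_on ?n ?n (Euc ?n) (\<lambda>z. z)" "smooth_on ?n ?n (Euc ?n) (\<lambda>z. z)"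
      by (rule smooth_on_id[OF openin_Euc])+
  qed simp_all
  have emZ: "embedded_in (ZH_mfd (conf d es)) ?nZ qcoord"
    by (rule embedded_in_ZH_conf[OF es])
  have topZ: "topspace (mtop (ZH_mfd (conf d es))) = ?Z"
    by (simp add: ZH_mfd_def)
  have smooth_orbit: "smooth_map (ZH_mfd (conf d es)) N Sp1_orbit"
  proof (rule embedded_in_smooth_map[OF emZ emN])
    show "Sp1_orbit \<in> topspace (mtop (ZH_mfd (conf d es))) \<rightarrow> topspace (mtop N)"
      unfolding topZ topN S_def by blast
    let ?u = "\<lambda>z i. sqrt (real (Suc r) + 1) *\<^sub>R qseq z i"
    show "smooth_on ?nZ ?n (Euc ?nZ) (\<lambda>z. qcoord (\<lambda>i. if i < ?v then qconj (?u z ?v) \<star> ?u z i else 0))"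
    proof (rule smooth_on_qcoord)
      show "qsmooth ?nZ (\<lambda>z. if i < ?v then qconj (?u z ?v) \<star> ?u z i else 0)" for i
      proof (cases "i < ?v")
        case True
        show ?thesis
          unfolding if_P[OF True]
          by (rule qsmooth_qmult[OF qsmooth_qconj[OF qsmooth_scaleR[OF qsmooth_qseq]] qsmooth_scaleR[OF qsmooth_qseq]])
      next
        case False
        show ?thesis
          unfolding if_not_P[OF False] by (rule qsmooth_const)
      qed
    qed
    show "(?E \<circ> h) (Sp1_orbit q) j = qcoord (\<lambda>i. if i < ?v then qconj (?u (qcoord q) ?v) \<star> ?u (qcoord q) i else 0) j"
      if "q \<in> topspace (mtop (ZH_mfd (conf d es)))" for q j
    proof -
      have q: "q \<in> ?Z"
        using that by (simp add: topZ)
      then have "divide_last ?v (?rs q) \<in> Hn ?v"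
        using div[OF q] by (simp add: unit_product_def)
      then show ?thesis
        by (simp only: o_def h_orbit[OF q] proj_def sphere_product_emb_split_factors qseq_qcoord divide_last_def rescale_def)
    qed
  qed
  have sec: "\<exists>s. smooth_map N (ZH_mfd (conf d es)) s \<and> s (Sp1_orbit q) = q \<and>
      (\<forall>y\<in>topspace (mtop N). Sp1_orbit (s y) = y)" if "q \<in> topspace (mtop (ZH_mfd (conf d es)))" for q
  proof (intro exI conjI ballI)
    have q: "q \<in> ?Z"
      using that by (simp add: topZ)
    define a where "a = ?rs q ?v"
    have a: "norm a = 1"
      unfolding a_def by (rule Z(3)[OF q])
    have hN: "h y \<in> topspace (mtop ?P)" if "y \<in> S" for y
      using bij_betwE[OF bij] that by blast
    show "smooth_map N (ZH_mfd (conf d es)) (\<lambda>y. lift a (h y))"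
    proof (rule embedded_in_smooth_map[OF emN emZ])
      show "(\<lambda>y. lift a (h y)) \<in> topspace (mtop N) \<rightarrow> topspace (mtop (ZH_mfd (conf d es)))"
        unfolding topZ topN using lift(1)[OF hN a] by blast
      show "smooth_on ?n ?nZ (Euc ?n) (\<lambda>z. qcoord (?us (append_last ?v a (qseq z))))"
        unfolding unscale_def append_last_def
      proof (rule smooth_on_qcoord_scaleR)
        show "qsmooth ?n (\<lambda>z. if i < ?v then a \<star> qseq z i else if i = ?v then a else 0)" for i
        proof (cases "i < ?v")
          case True
          show ?thesis
            unfolding if_P[OF True] by (rule qsmooth_qmult[OF qsmooth_const qsmooth_qseq])
        next
          case False
          show ?thesis
            unfolding if_not_P[OF False] by (rule qsmooth_const)
        qed
      qed
    qed (simp add: lift_def)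
    have "divide_last ?v (?rs q) \<in> Hn ?v"
      using div[OF q] by (simp add: unit_product_def)
    then have "?E (h (Sp1_orbit q)) = qcoord (divide_last ?v (?rs q))"
      by (simp only: h_orbit[OF q] proj_def sphere_product_emb_split_factors)
    then show "lift a (h (Sp1_orbit q)) = q"
      using append_divide_last[OF Z(2,3)[OF q]] by (simp add: lift_def a_def)
    fix y assume "y \<in> topspace (mtop N)"
    then have y: "y \<in> S"
      by (simp add: topN)
    have "Sp1_orbit (lift a (h y)) \<in> S" "h (Sp1_orbit (lift a (h y))) = h y"
      using lift[OF hN[OF y] a] h_orbit by (auto simp: S_def)
    then show "Sp1_orbit (lift a (h y)) = y"
      using bij_betw_imp_inj_on[OF bij] y by (metis inj_onD)
  qed
  \<comment> \<open>The base point (1, 0, ..., 0) in every factor, scaled back, lies in Z.\<close>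
  have ne: "topspace (mtop (ZH_mfd (conf d es))) \<noteq> {}"
  proof -
    define x :: "nat \<Rightarrow> real" where "x = (\<lambda>n. if n = 0 then 1 else 0)"
    define p where "p = (x, \<lambda>i\<in>{..<Suc r}. x)"
    have "x \<in> topspace (nsphere n)" for n
      unfolding x_def by (rule in_topspace_nsphere)
    then have "p \<in> topspace (mtop (sphere_product d (Suc r)))"
      unfolding topspace_sphere_product p_def mem_Collect_eq fst_conv snd_conv restrict_PiE_iff by blast
    then have "?us (qseq (sphere_product_emb d (Suc r) p)) \<in> ?Z"
      unfolding mem_ZH_conf_iff[OF es] unscale_rescale by (rule split_factors_sphere_product_emb(2))
    then show ?thesis
      unfolding topZ by blast
  qed
  have "is_NH (conf d es) N"
    unfolding is_NH_def
    by (rule quotient_manifold_from_sections[OF embedded_in_smooth_manifold[OF emZ]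
          embedded_in_smooth_manifold[OF emN] smooth_orbit ne sec])
  then show ?thesis
    using diffeo by blast
qed

theorem theorem16p6:
  fixes m d :: nat
  assumes "m \<ge> 1" and "d \<ge> 1" and "CARD('k::finite) = 4 * m"
  shows "\<exists>\<Lambda> :: (real ^ 'k) list. admissible \<Lambda> \<and>
    (\<exists>N. is_NH \<Lambda> N \<and>
       diffeomorphic N (prod_mfd (sphere_mfd (4 * d + 3)) (power_mfd (4 * m - 1) (sphere_mfd 3))))"
proof -
  obtain es :: "'k list" where es: "set es = UNIV" "distinct es"
    using finite_distinct_list[of "UNIV :: 'k set"] by auto
  \<comment> \<open>Since m is positive, the truncated subtraction 4m - 1 is exact.\<close>
  then have len: "length es = Suc (4 * m - 1)"
    using distinct_card[OF es(2)] assms(1,3) by simp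
  show ?thesis
    using admissible_conf[OF es(2,1)] quotient_of_ZH_conf[OF es(2,1) len] by blast
qed

end
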